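(* Let $K\subseteq\mathbb R^2$ be a polygon. Assume that there exists a subtriangulation $\mathcal T(K)$ of $K$ into shape-regular triangles $T$ such that $h_K\approx h_T$ for all $T\in\mathcal T(K)$. Let $p\in\mathbb N$ and $q\in\mathbb P_p(K)$. Then $$\|q\|_{0,K}\le c\,\frac{(p+1)^2}{h_K}\,\|q\|_{-1,K},$$ where $c$ is a positive constant independent of $p$, $q$ and $h_K$.
   Context: $h_\omega=\mathrm{diam}(\omega)$ for $\omega\subseteq\mathbb R^2$. $\mathbb P_p(K)$ is the space of polynomials of degree at most $p$ on $K$, $\|\cdot\|_{0,K}$ the $L^2(K)$ norm, $|\cdot|_{1,K}$ the $H^1(K)$ seminorm. $\|q\|_{-1,K}=\|q\|_{(H^1_0(K))^*}=\sup_{\Phi\in H^1_0(K)\setminus\{0\}}\frac{(q,\Phi)_{0,K}}{|\Phi|_{1,K}}$. "Shape-regular" means that each triangle $T\in\mathcal T(K)$ is star-shaped with respect to a ball of radius at least $\gamma_1h_T$ for a fixed constant $\gamma_1>0$. $h_K\approx h_T$ means $c_1h_K\le h_T\le c_2h_K$ with fixed positive constants $c_1,c_2$. The constant $c$ may depend on $\gamma_1,c_1,c_2$. *)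

theory Defs
  imports "HOL-Analysis.Analysis"
begin

text \<open>A polygon is an open set: the inside of a closed, non-self-intersecting polygonal line.
  The line is given by its list of vertices, the first vertex being repeated at the end.\<close>

fun polygonal_path :: "'a::euclidean_space list \<Rightarrow> real \<Rightarrow> 'a" where
  "polygonal_path [] = linepath 0 0"
| "polygonal_path [a] = linepath a a"
| "polygonal_path [a, b] = linepath a b"
| "polygonal_path (a # b # c # vs) = linepath a b +++ polygonal_path (b # c # vs)"

definition polygon :: "(real^2) set \<Rightarrow> bool" where
  "polygon K \<longleftrightarrow>
     (\<exists>vs. simple_path (polygonal_path vs) \<and>
           pathfinish (polygonal_path vs) = pathstart (polygonal_path vs) \<and>
           K = inside (path_image (polygonal_path vs)))"

text \<open>The triangles are closed, so they cover the closure of the (open) polygon.\<close>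

definition subtriangulation :: "(real^2) set set \<Rightarrow> (real^2) set \<Rightarrow> bool" where
  "subtriangulation \<T> K \<longleftrightarrow>
     triangulation \<T> \<and> (\<forall>T\<in>\<T>. 2 simplex T) \<and> \<Union>\<T> = closure K"

definition star_shaped_wrt :: "'a::real_vector set \<Rightarrow> 'a set \<Rightarrow> bool" where
  "star_shaped_wrt B S \<longleftrightarrow> B \<subseteq> S \<and> (\<forall>x\<in>B. \<forall>y\<in>S. closed_segment x y \<subseteq> S)"

definition shape_regular :: "real \<Rightarrow> 'a::real_normed_vector set \<Rightarrow> bool" where
  "shape_regular \<gamma> T \<longleftrightarrow> (\<exists>x r. r \<ge> \<gamma> * diameter T \<and> r > 0 \<and> star_shaped_wrt (ball x r) T)"

definition poly_space :: "nat \<Rightarrow> (real^2) set \<Rightarrow> (real^2 \<Rightarrow> real) set" where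
  "poly_space p K =
     {q. \<exists>a :: nat \<Rightarrow> nat \<Rightarrow> real. \<forall>x\<in>K. q x = (\<Sum>i\<le>p. \<Sum>j\<le>p - i. a i j * (x$1)^i * (x$2)^j)}"

text \<open>Elements of Lebesgue and Sobolev spaces are represented by functions on the whole space,
  of which only the values almost everywhere on the open set \<open>\<Omega>\<close> matter.\<close>

definition l2_space :: "'a::euclidean_space set \<Rightarrow> ('a \<Rightarrow> real) set" where
  "l2_space \<Omega> =
     {f \<in> borel_measurable (lebesgue_on \<Omega>). integrable (lebesgue_on \<Omega>) (\<lambda>x. (f x)^2)}"

definition l2_inner :: "'a::euclidean_space set \<Rightarrow> ('a \<Rightarrow> real) \<Rightarrow> ('a \<Rightarrow> real) \<Rightarrow> real" where
  "l2_inner \<Omega> f g = (LINT x|lebesgue_on \<Omega>. f x * g x)"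

definition l2_norm :: "'a::euclidean_space set \<Rightarrow> ('a \<Rightarrow> real) \<Rightarrow> real" where
  "l2_norm \<Omega> f = sqrt (l2_inner \<Omega> f f)"

definition partial_deriv :: "'n \<Rightarrow> (real^'n::finite \<Rightarrow> real) \<Rightarrow> real^'n \<Rightarrow> real" where
  "partial_deriv i f x = frechet_derivative f (at x) (axis i 1)"

fun Ck :: "nat \<Rightarrow> (real^'n::finite \<Rightarrow> real) \<Rightarrow> bool" where
  "Ck 0 f \<longleftrightarrow> continuous_on UNIV f"
| "Ck (Suc k) f \<longleftrightarrow> (\<forall>x. f differentiable (at x)) \<and> (\<forall>i. Ck k (partial_deriv i f))"

definition test_functions :: "(real^'n::finite) set \<Rightarrow> (real^'n \<Rightarrow> real) set" where
  "test_functions \<Omega> =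
     {\<phi>. (\<forall>k. Ck k \<phi>) \<and> compact (closure {x. \<phi> x \<noteq> 0}) \<and> closure {x. \<phi> x \<noteq> 0} \<subseteq> \<Omega>}"

definition has_weak_gradient ::
  "(real^'n::finite) set \<Rightarrow> (real^'n \<Rightarrow> real) \<Rightarrow> (real^'n \<Rightarrow> real^'n) \<Rightarrow> bool" where
  "has_weak_gradient \<Omega> f g \<longleftrightarrow>
     f \<in> l2_space \<Omega> \<and> (\<forall>i. (\<lambda>x. g x $ i) \<in> l2_space \<Omega>) \<and>
     (\<forall>\<phi>\<in>test_functions \<Omega>. \<forall>i.
        l2_inner \<Omega> f (partial_deriv i \<phi>) = - l2_inner \<Omega> (\<lambda>x. g x $ i) \<phi>)"

text \<open>The weak gradient is unique only up to null sets; \<open>h1_seminorm\<close> does not depend on the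
  representative chosen here.\<close>

definition weak_gradient ::
  "(real^'n::finite) set \<Rightarrow> (real^'n \<Rightarrow> real) \<Rightarrow> real^'n \<Rightarrow> real^'n" where
  "weak_gradient \<Omega> f = (SOME g. has_weak_gradient \<Omega> f g)"

definition h1_space :: "(real^'n::finite) set \<Rightarrow> (real^'n \<Rightarrow> real) set" where
  "h1_space \<Omega> = {f. \<exists>g. has_weak_gradient \<Omega> f g}"

definition h1_seminorm :: "(real^'n::finite) set \<Rightarrow> (real^'n \<Rightarrow> real) \<Rightarrow> real" where
  "h1_seminorm \<Omega> f = l2_norm \<Omega> (\<lambda>x. norm (weak_gradient \<Omega> f x))"

definition h1_norm :: "(real^'n::finite) set \<Rightarrow> (real^'n \<Rightarrow> real) \<Rightarrow> real" where
  "h1_norm \<Omega> f = sqrt ((l2_norm \<Omega> f)^2 + (h1_seminorm \<Omega> f)^2)"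

text \<open>The closure of the test functions in the \<open>H\<^sup>1\<close> norm.\<close>

definition h10_space :: "(real^'n::finite) set \<Rightarrow> (real^'n \<Rightarrow> real) set" where
  "h10_space \<Omega> =
     {f \<in> h1_space \<Omega>. \<forall>e>0. \<exists>\<phi>\<in>test_functions \<Omega>. h1_norm \<Omega> (\<lambda>x. f x - \<phi> x) < e}"

text \<open>The supremum is taken in the extended reals, so that it is meaningful without a prior
  proof of boundedness. The zero element of \<open>H\<^sup>1\<^sub>0\<close> is the class of functions
  vanishing almost everywhere on \<open>\<Omega>\<close>.\<close>

definition hm1_norm :: "(real^'n::finite) set \<Rightarrow> (real^'n \<Rightarrow> real) \<Rightarrow> ereal" where
  "hm1_norm \<Omega> q =
     (SUP \<Phi> \<in> {\<Phi> \<in> h10_space \<Omega>. \<not> (AE x in lebesgue_on \<Omega>. \<Phi> x = 0)}.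
        ereal (l2_inner \<Omega> q \<Phi> / h1_seminorm \<Omega> \<Phi>))"

end

theory Submission
  imports Defs
begin

text \<open>The dual norm is bounded below by a single test function. Let \<open>P\<close> be the polynomial that agrees with
\<open>q\<close> on \<open>K\<close>, put \<open>h = diameter K\<close>, and take \<open>\<Phi> = \<eta> P\<close> with a smooth cutoff \<open>0 \<le> \<eta> \<le> 1\<close> that vanishes near
the boundary of every triangle and equals 1 outside a boundary layer of relative width \<open>\<epsilon>\<close> of order
\<open>(p + 1)\<^sup>-\<^sup>2\<close>. Then \<open>\<Phi>\<close> is itself a test function on \<open>K\<close>, and two facts about polynomials of degree at
most \<open>p\<close> finish the proof:

\<^item> the boundary layer carries at most half of the \<open>L\<^sup>2\<close> mass, so \<open>2 (q, \<Phi>) \<ge> \<parallel>q\<parallel>\<^sup>2\<close>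
  (\<open>triangle_boundary_layer\<close>);

\<^item> the gradient of \<open>\<Phi>\<close> is of order \<open>(p + 1)\<^sup>2 / h\<close> times \<open>\<parallel>q\<parallel>\<close>. Its summand \<open>\<eta> grad P\<close> is controlled by the
  \<open>L\<^sup>2\<close> Markov inequality (\<open>triangle_gradient\<close>), and its summand \<open>P grad \<eta>\<close> by the size \<open>1 / (\<epsilon> h)\<close> of
  the gradient of the cutoff (\<open>triangle_cutoff\<close>).

The quotient \<open>(q, \<Phi>) / |\<Phi>|\<^sub>1\<close> is therefore at least a constant times \<open>h (p + 1)\<^sup>-\<^sup>2 \<parallel>q\<parallel>\<close>.

Both facts are reduced to one dimension. A triangle is covered by three parallelograms, one at
each vertex and spanned by half of the two edges there; by Fubini it suffices to treat polynomials
on \<open>[0, 1]\<close>. There everything follows from one identity for a polynomial \<open>e\<close> of exact degree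
\<open>n\<close> that is orthogonal to all lower degrees: \<open>e(1)\<^sup>2 = (2 n + 1) \<integral> e\<^sup>2\<close>
(\<open>legendre_endpoint\<close>). The shape regularity enters only through the gradients of the barycentric
coordinates, whose length is at most the reciprocal of the radius of an inscribed ball
(\<open>bary_normal_bound\<close>).

The remaining work connects this estimate with the Sobolev spaces. The weak gradient of a test
function is its classical gradient, by integration by parts and by the fundamental lemma of the
calculus of variations (\<open>weak_gradient_test_function\<close>). The Jordan curve theorem ensures that the
interiors of the triangles lie in the open polygon (\<open>polygon_topology\<close>), so that \<open>\<Phi>\<close> is supported
in it.\<close>

section \<open>Polynomials on the unit interval\<close>

text \<open>Polynomials of degree less than \<open>n\<close>. In contrast to a condition on \<open>degree\<close>, this is a linear space also
for \<open>n = 0\<close>, where it is the zero space; inductions start there.\<close>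

definition low_degree :: "nat \<Rightarrow> real poly set" where
  "low_degree n = {r. \<forall>i\<ge>n. coeff r i = 0}"

definition unit_integral :: "real poly \<Rightarrow> real" where
  "unit_integral r = integral {0..1} (poly r)"

lemma low_degree_iff: "degree r \<le> n \<longleftrightarrow> r \<in> low_degree (Suc n)"
  unfolding low_degree_def by (auto simp: coeff_eq_0 intro: degree_le)

lemma low_degree_0: "r \<in> low_degree 0 \<longleftrightarrow> r = 0"
  unfolding low_degree_def by (auto simp: poly_eq_iff)

lemma low_degree_mono: "m \<le> n \<Longrightarrow> low_degree m \<subseteq> low_degree n"
  unfolding low_degree_def by auto

lemma low_degree_add: "r \<in> low_degree n \<Longrightarrow> s \<in> low_degree n \<Longrightarrow> r + s \<in> low_degree n"
  unfolding low_degree_def by auto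

lemma low_degree_smult: "r \<in> low_degree n \<Longrightarrow> smult c r \<in> low_degree n"
  unfolding low_degree_def by auto

lemma low_degree_pderiv: "r \<in> low_degree (Suc n) \<Longrightarrow> pderiv r \<in> low_degree n"
  unfolding low_degree_def by (auto simp: coeff_pderiv)

lemma integrable_poly [simp]: "(\<lambda>x. poly r x) integrable_on {a..b::real}"
  by (intro integrable_continuous_real continuous_intros)

lemma unit_integral_add: "unit_integral (r + s) = unit_integral r + unit_integral s"
  unfolding unit_integral_def by (subst integral_add[symmetric]) (auto intro!: integral_cong)

lemma unit_integral_smult: "unit_integral (smult c r) = c * unit_integral r"
proof -
  have "poly (smult c r) = (\<lambda>x. c * poly r x)" by auto
  thus ?thesis unfolding unit_integral_def by (simp only: integral_mult_right)
qed

lemma unit_integral_diff: "unit_integral (r - s) = unit_integral r - unit_integral s"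
  unfolding unit_integral_def by (subst integral_diff[symmetric]) (auto intro!: integral_cong)

lemma unit_integral_0 [simp]: "unit_integral 0 = 0"
  using unit_integral_smult[of 0 0] by simp

lemmas unit_integral_linear = unit_integral_add unit_integral_diff unit_integral_smult

lemma unit_integral_mono: "(\<And>x. poly r x \<le> poly s x) \<Longrightarrow> unit_integral r \<le> unit_integral s"
  unfolding unit_integral_def by (intro integral_le) auto

lemma unit_integral_square_nonneg: "0 \<le> unit_integral (r * r)"
  using unit_integral_mono[of 0 "r * r"] by simp

lemma unit_integral_square_eq_0: "unit_integral (r * r) = 0 \<Longrightarrow> r = 0"
proof -
  assume "unit_integral (r * r) = 0"
  hence "((poly (r * r)) has_integral 0) (cbox 0 1)"
    using integrable_integral[OF integrable_poly[of "r * r" 0 1]]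
    by (simp del: poly_mult add: unit_integral_def)
  hence "\<And>x. x \<in> cbox 0 1 \<Longrightarrow> poly (r * r) x = 0"
    by (intro has_integral_0_cbox_imp_0[where f = "poly (r * r)"]) (auto intro!: continuous_intros)
  hence "{0..1} \<subseteq> {x. poly r x = 0}" by auto
  hence "infinite {x. poly r x = 0}"
    using infinite_super[OF _ infinite_Icc[of 0 "1::real"]] by simp
  thus "r = 0" using poly_roots_finite[of r] by blast
qed

lemma unit_integral_pderiv: "unit_integral (pderiv r) = poly r 1 - poly r 0"
proof -
  have "(poly (pderiv r) has_integral poly r 1 - poly r 0) {0..1}"
    by (rule fundamental_theorem_of_calculus)
       (simp_all add: has_real_derivative_iff_has_vector_derivative[symmetric]
          DERIV_subset[OF poly_DERIV])
  thus ?thesis unfolding unit_integral_def by (rule integral_unique)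
qed

lemma low_degree_decompose:
  assumes e: "e \<in> low_degree (Suc n)" "coeff e n = 1" and r: "r \<in> low_degree (Suc n)"
  shows "r - smult (coeff r n) e \<in> low_degree n"
  unfolding low_degree_def
proof (intro CollectI allI impI)
  fix i assume "i \<ge> n"
  then consider "i = n" | "i \<ge> Suc n" by linarith
  thus "coeff (r - smult (coeff r n) e) i = 0"
  proof cases
    case 1
    thus ?thesis using e(2) by simp
  next
    case 2
    hence "coeff r i = 0" "coeff e i = 0" using e(1) r by (auto simp: low_degree_def)
    thus ?thesis by simp
  qed
qed

text \<open>Gram--Schmidt: the projection onto degree less than \<open>n + 1\<close> corrects the one onto degree less than
\<open>n\<close> by the component along \<open>x\<^sup>n\<close> minus its own projection.\<close>

lemma orthogonal_projection:
  "\<exists>g\<in>low_degree n. \<forall>r\<in>low_degree n. unit_integral ((f - g) * r) = 0"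
proof (induction n arbitrary: f)
  case 0
  thus ?case by (auto simp: low_degree_0)
next
  case (Suc n)
  obtain g0 where g0: "g0 \<in> low_degree n"
    "\<And>r. r \<in> low_degree n \<Longrightarrow> unit_integral ((monom 1 n - g0) * r) = 0"
    using Suc[of "monom 1 n"] by blast
  define e where "e = monom 1 n - g0"
  have ce: "coeff e n = 1" using g0(1) by (auto simp: e_def low_degree_def)
  have e: "e \<in> low_degree (Suc n)" using g0(1) by (auto simp: e_def low_degree_def)
  have e_orth: "unit_integral (e * r) = 0" if "r \<in> low_degree n" for r
    using g0(2)[OF that] by (simp add: e_def)
  have pos: "unit_integral (e * e) \<noteq> 0" using unit_integral_square_eq_0[of e] ce by auto
  obtain g where g: "g \<in> low_degree n" "\<And>r. r \<in> low_degree n \<Longrightarrow> unit_integral ((f - g) * r) = 0"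
    using Suc[of f] by blast
  define c where "c = unit_integral ((f - g) * e) / unit_integral (e * e)"
  show ?case
  proof (intro bexI ballI)
    show "g + smult c e \<in> low_degree (Suc n)"
      using g(1) e low_degree_mono[of n "Suc n"] by (intro low_degree_add low_degree_smult) auto
    fix r assume r: "r \<in> low_degree (Suc n)"
    define a s where "a = coeff r n" and "s = r - smult a e"
    have s: "s \<in> low_degree n" unfolding s_def a_def by (intro low_degree_decompose e ce r)
    have rs: "r = smult a e + s" by (simp add: s_def)
    have "(f - (g + smult c e)) * r = smult a ((f - g) * e) + (f - g) * s - smult (c * a) (e * e) - smult c (e * s)"
      unfolding rs by (simp add: algebra_simps smult_add_right smult_diff_right)
    also have "unit_integral \<dots> = 0"
      using g(2)[OF s] e_orth[OF s] pos by (simp add: unit_integral_linear c_def)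
    finally show "unit_integral ((f - (g + smult c e)) * r) = 0" .
  qed
qed

lemma legendre_exists:
  obtains e where "e \<in> low_degree (Suc n)" "coeff e n = 1"
    "\<And>r. r \<in> low_degree n \<Longrightarrow> unit_integral (e * r) = 0"
proof -
  obtain g where g: "g \<in> low_degree n"
    "\<And>r. r \<in> low_degree n \<Longrightarrow> unit_integral ((monom 1 n - g) * r) = 0"
    using orthogonal_projection[of n "monom 1 n"] by blast
  have "monom 1 n - g \<in> low_degree (Suc n)" "coeff (monom 1 n - g) n = 1"
    using g(1) by (auto simp: low_degree_def)
  thus thesis using g(2) by (rule that)
qed

text \<open>The polynomial \<open>x e' - n e\<close> has degree less than \<open>n\<close>, because differentiation and multiplication by \<open>x\<close>
reproduce the leading coefficient up to the factor \<open>n\<close>. Hence \<open>(x e\<^sup>2)' = e\<^sup>2 + 2 e (x e')\<close>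
integrates to \<open>(2 n + 1) \<integral> e\<^sup>2\<close>. With \<open>x - 1\<close> in place of \<open>x\<close> the same holds at the other endpoint.\<close>

lemma legendre_endpoint:
  assumes e: "e \<in> low_degree (Suc n)" "coeff e n = 1"
    and orth: "\<And>r. r \<in> low_degree n \<Longrightarrow> unit_integral (e * r) = 0"
    and z: "z = 0 \<or> z = 1"
  shows "(poly e z)^2 = (2 * real n + 1) * unit_integral (e * e)"
proof -
  define l :: "real poly" where "l = [:z - 1, 1:]"
  define s where "s = l * pderiv e - smult (real n) e"
  have ls: "l * pderiv e = smult (z - 1) (pderiv e) + pCons 0 (pderiv e)"
    by (simp add: l_def)
  have "coeff s i = 0" if i: "i \<ge> n" for i
  proof (cases i)
    case 0
    thus ?thesis using e(1) i by (simp add: s_def ls low_degree_def coeff_pderiv)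
  next
    case (Suc m)
    hence "coeff s i = (real i - real n) * coeff e i"
      using e(1) i by (simp add: s_def ls low_degree_def coeff_pderiv algebra_simps)
    also have "\<dots> = 0" using e(1) i by (cases "i = n") (auto simp: low_degree_def)
    finally show ?thesis .
  qed
  hence s: "s \<in> low_degree n" by (auto simp: low_degree_def)
  have "pderiv (l * e * e) = smult (2 * real n + 1) (e * e) + smult 2 (e * s)"
  proof (rule poly_ext)
    fix x
    have pl: "pderiv l = 1" by (simp add: l_def pderiv_pCons)
    have "poly (pderiv (l * e * e)) x
        = poly e x * poly e x + 2 * (poly l x * poly e x * poly (pderiv e) x)"
      by (simp only: pderiv_mult pl poly_add poly_mult poly_1) algebra
    also have "\<dots> = poly (smult (2 * real n + 1) (e * e) + smult 2 (e * s)) x"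
      by (simp only: s_def poly_add poly_diff poly_mult poly_smult) algebra
    finally show "poly (pderiv (l * e * e)) x = poly (smult (2 * real n + 1) (e * e) + smult 2 (e * s)) x" .
  qed
  hence "unit_integral (pderiv (l * e * e)) = (2 * real n + 1) * unit_integral (e * e)"
    using orth[OF s] by (simp add: unit_integral_linear)
  moreover have "poly (l * e * e) 1 - poly (l * e * e) 0 = (poly e z)^2"
    using z by (auto simp: l_def power2_eq_square)
  ultimately show ?thesis by (simp add: unit_integral_pderiv)
qed

lemma unit_integral_orth_split:
  assumes "unit_integral (e * r) = 0"
  shows "unit_integral ((smult a e + r) * (smult a e + r)) = a^2 * unit_integral (e * e) + unit_integral (r * r)"
proof -
  have "(smult a e + r) * (smult a e + r) = smult (a^2) (e * e) + smult (2*a) (e * r) + r * r"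
    by (rule poly_ext) (simp add: algebra_simps power2_eq_square)
  thus ?thesis using assms by (simp add: unit_integral_linear)
qed

text \<open>The weights are chosen so that \<open>n\<close> and \<open>c\<close> each become \<open>n + c\<close>. The inductions below use it with
\<open>n\<^sup>2 + (2 n + 1) = (n + 1)\<^sup>2\<close>, which makes the sharp powers of \<open>n\<close> reproduce themselves.\<close>

lemma young_square:
  fixes x y :: real assumes "n > 0" "c > 0"
  shows "(x + y)^2 \<le> (n + c) / c * x^2 + (n + c) / n * y^2"
proof -
  have "0 \<le> (n * x - c * y)^2 / (n * c)" using assms by simp
  also have "\<dots> = (n + c) / c * x^2 + (n + c) / n * y^2 - (x + y)^2"
    using assms by (simp add: field_simps power2_eq_square)
  finally show ?thesis by simp
qed

text \<open>Splitting off the component of top degree costs the factor \<open>2 n + 1\<close> of \<open>legendre_endpoint\<close>, and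
\<open>n\<^sup>2 + (2 n + 1) = (n + 1)\<^sup>2\<close>.\<close>

lemma endpoint_bound:
  assumes z: "z = 0 \<or> z = 1"
  shows "r \<in> low_degree n \<Longrightarrow> (poly r z)^2 \<le> (real n)^2 * unit_integral (r * r)"
proof (induction n arbitrary: r)
  case 0
  thus ?case by (simp add: low_degree_0)
next
  case (Suc n)
  obtain e where e: "e \<in> low_degree (Suc n)" "coeff e n = 1"
    "\<And>r. r \<in> low_degree n \<Longrightarrow> unit_integral (e * r) = 0" using legendre_exists[of n] by metis
  define a s where "a = coeff r n" and "s = r - smult a e"
  have s: "s \<in> low_degree n" unfolding s_def a_def by (intro low_degree_decompose e Suc.prems)
  have rs: "r = smult a e + s" by (simp add: s_def)
  have split: "unit_integral (r * r) = a^2 * unit_integral (e * e) + unit_integral (s * s)"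
    unfolding rs by (intro unit_integral_orth_split e s)
  have pe: "(poly e z)^2 = (2 * real n + 1) * unit_integral (e * e)"
    by (rule legendre_endpoint[OF e z])
  show ?case
  proof (cases "n = 0")
    case True
    hence "s = 0" using s by (simp add: low_degree_0)
    thus ?thesis using True pe split by (simp add: rs power_mult_distrib)
  next
    case False
    have "(poly r z)^2 = (a * poly e z + poly s z)^2" by (simp add: rs)
    also have "\<dots> \<le> ((real n)^2 + (2 * real n + 1)) / (2 * real n + 1) * (a * poly e z)^2
                 + ((real n)^2 + (2 * real n + 1)) / (real n)^2 * (poly s z)^2"
      using False by (intro young_square) auto
    also have "\<dots> \<le> ((real n)^2 + (2 * real n + 1)) / (2 * real n + 1) * (a^2 * ((2 * real n + 1) * unit_integral (e * e)))
                 + ((real n)^2 + (2 * real n + 1)) / (real n)^2 * ((real n)^2 * unit_integral (s * s))"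
      unfolding power_mult_distrib pe by (intro add_mono mult_left_mono Suc.IH s order.refl) auto
    also have "\<dots> = (real (Suc n))^2 * unit_integral (r * r)"
    proof -
      have "2 * real n + 1 > 0" "(real n)^2 > 0" using False by auto
      thus ?thesis unfolding split
        by (simp only: times_divide_eq_left nonzero_mult_div_cancel_left mult.assoc)
           (simp add: divide_simps, simp add: algebra_simps power2_eq_square)
    qed
    finally show ?thesis .
  qed
qed

text \<open>Integration by parts gives \<open>\<integral> e'\<^sup>2 = [e e']\<close>, since \<open>e''\<close> has lower degree and is orthogonal to
\<open>e\<close>. The endpoint values of \<open>e\<close> are known, and those of \<open>e'\<close> are bounded by \<open>\<integral> e'\<^sup>2\<close>
again; one factor of its square root cancels.\<close>

lemma legendre_deriv_bound:
  assumes e: "e \<in> low_degree (Suc n)" "coeff e n = 1"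
    and orth: "\<And>r. r \<in> low_degree n \<Longrightarrow> unit_integral (e * r) = 0"
  shows "unit_integral (pderiv e * pderiv e) \<le> 4 * (2 * real n + 1) * (real n)^2 * unit_integral (e * e)"
proof -
  define d where "d = pderiv e"
  define D E where "D = unit_integral (d * d)" and "E = unit_integral (e * e)"
  have D0: "D \<ge> 0" and E0: "E \<ge> 0" by (auto simp: D_def E_def unit_integral_square_nonneg)
  have d: "d \<in> low_degree n" unfolding d_def by (intro low_degree_pderiv e)
  have d': "pderiv d \<in> low_degree n"
    using low_degree_pderiv[of d "n - 1"] d low_degree_mono[of "n - 1" n]
    by (cases n) (auto simp: low_degree_0)
  have "pderiv (e * d) = d * d + e * pderiv d" by (simp add: pderiv_mult d_def algebra_simps)
  hence "D = unit_integral (pderiv (e * d))" using orth[OF d'] by (simp add: unit_integral_linear D_def)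
  also have "\<dots> = poly e 1 * poly d 1 - poly e 0 * poly d 0" by (simp add: unit_integral_pderiv)
  finally have Deq: "D = poly e 1 * poly d 1 - poly e 0 * poly d 0" .
  have b: "\<bar>poly e z * poly d z\<bar> \<le> sqrt ((2 * real n + 1) * E * ((real n)^2 * D))" if "z = 0 \<or> z = 1" for z
  proof (rule real_le_rsqrt)
    show "\<bar>poly e z * poly d z\<bar>^2 \<le> (2 * real n + 1) * E * ((real n)^2 * D)"
      unfolding power2_abs power_mult_distrib
      using legendre_endpoint[OF e orth that] endpoint_bound[OF that d] E0
      by (intro mult_mono) (auto simp: D_def E_def)
  qed
  have "D \<le> 2 * sqrt ((2 * real n + 1) * E * ((real n)^2 * D))"
    using b[of 0] b[of 1] Deq by linarith
  hence "D^2 \<le> (2 * sqrt ((2 * real n + 1) * E * ((real n)^2 * D)))^2"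
    using D0 by (intro power_mono) auto
  also have "\<dots> = 4 * ((2 * real n + 1) * E * ((real n)^2 * D))"
    using D0 E0 by (simp add: power_mult_distrib)
  finally have "D * D \<le> (4 * (2 * real n + 1) * (real n)^2 * E) * D"
    by (simp add: power2_eq_square mult_ac)
  hence "D \<le> 4 * (2 * real n + 1) * (real n)^2 * E"
    using D0 E0 by (cases "D = 0") (auto simp: mult_le_cancel_right)
  thus ?thesis by (simp add: D_def E_def d_def)
qed

lemma markov_low_degree:
  "r \<in> low_degree n \<Longrightarrow> unit_integral (pderiv r * pderiv r) \<le> 4 * (real n)^4 * unit_integral (r * r)"
proof (induction n arbitrary: r)
  case 0
  thus ?case by (simp add: low_degree_0)
next
  case (Suc n)
  obtain e where e: "e \<in> low_degree (Suc n)" "coeff e n = 1"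
    "\<And>r. r \<in> low_degree n \<Longrightarrow> unit_integral (e * r) = 0" using legendre_exists[of n] by metis
  define a s where "a = coeff r n" and "s = r - smult a e"
  have s: "s \<in> low_degree n" unfolding s_def a_def by (intro low_degree_decompose e Suc.prems)
  have rs: "r = smult a e + s" by (simp add: s_def)
  have split: "unit_integral (r * r) = a^2 * unit_integral (e * e) + unit_integral (s * s)"
    unfolding rs by (intro unit_integral_orth_split e s)
  show ?case
  proof (cases "n = 0")
    case True
    hence "pderiv r = 0" using low_degree_pderiv[OF Suc.prems] by (simp add: low_degree_0)
    thus ?thesis by (simp add: unit_integral_square_nonneg)
  next
    case False
    define u v where "u = ((real n)^2 + (2 * real n + 1)) / (2 * real n + 1)"
      and "v = ((real n)^2 + (2 * real n + 1)) / (real n)^2"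
    have "unit_integral (pderiv r * pderiv r)
      \<le> unit_integral (smult u (smult a (pderiv e) * smult a (pderiv e)) + smult v (pderiv s * pderiv s))"
    proof (rule unit_integral_mono)
      fix x
      show "poly (pderiv r * pderiv r) x
        \<le> poly (smult u (smult a (pderiv e) * smult a (pderiv e)) + smult v (pderiv s * pderiv s)) x"
        using young_square[of "(real n)^2" "2 * real n + 1" "a * poly (pderiv e) x" "poly (pderiv s) x"] False
        by (simp add: rs pderiv_add pderiv_smult u_def v_def power2_eq_square mult.assoc mult.left_commute)
    qed
    also have "\<dots> = u * (a^2 * unit_integral (pderiv e * pderiv e)) + v * unit_integral (pderiv s * pderiv s)"
      by (simp add: unit_integral_linear power2_eq_square)
    also have "\<dots> \<le> u * (a^2 * (4 * (2 * real n + 1) * (real n)^2 * unit_integral (e * e)))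
        + v * (4 * (real n)^4 * unit_integral (s * s))"
      by (intro add_mono mult_left_mono legendre_deriv_bound e Suc.IH s) (auto simp: u_def v_def)
    also have "\<dots> = 4 * (real n)^2 * (real (Suc n))^2 * unit_integral (r * r)"
    proof -
      have "u * (2 * real n + 1) = (real (Suc n))^2" "v * (real n)^2 = (real (Suc n))^2"
      proof -
        have "2 * real n + 1 \<noteq> 0" "(real n)^2 \<noteq> 0" using False by auto
        hence "u * (2 * real n + 1) = (real n)^2 + (2 * real n + 1)"
          "v * (real n)^2 = (real n)^2 + (2 * real n + 1)"
          by (simp_all only: u_def v_def nonzero_divide_eq_eq times_divide_eq_left nonzero_mult_div_cancel_right simp_thms not_False_eq_True)
        thus "u * (2 * real n + 1) = (real (Suc n))^2" "v * (real n)^2 = (real (Suc n))^2"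
          by (simp_all add: power2_eq_square algebra_simps)
      qed
      moreover have "u * (a^2 * (4 * (2 * real n + 1) * (real n)^2 * unit_integral (e * e)))
        = (u * (2 * real n + 1)) * (4 * (real n)^2 * (a^2 * unit_integral (e * e)))"
        "v * (4 * (real n)^4 * unit_integral (s * s)) = (v * (real n)^2) * (4 * (real n)^2 * unit_integral (s * s))"
        by (simp_all add: power2_eq_square power4_eq_xxxx mult_ac)
      ultimately show ?thesis unfolding split by (simp add: algebra_simps)
    qed
    also have "\<dots> \<le> 4 * (real (Suc n))^4 * unit_integral (r * r)"
    proof (rule mult_right_mono)
      have "(real n)^2 * (real (Suc n))^2 \<le> (real (Suc n))^2 * (real (Suc n))^2"
        by (intro mult_right_mono power_mono) auto
      thus "4 * (real n)^2 * (real (Suc n))^2 \<le> 4 * (real (Suc n))^4"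
        by (simp add: power2_eq_square power4_eq_xxxx)
    qed (rule unit_integral_square_nonneg)
    finally show ?thesis .
  qed
qed

lemma unit_integral_square: "unit_integral (r * r) = integral {0..1} (\<lambda>x. (poly r x)^2)"
proof -
  have "poly (r * r) = (\<lambda>x. (poly r x)^2)" by (auto simp: power2_eq_square)
  thus ?thesis unfolding unit_integral_def by (simp only:)
qed

lemma markov_L2:
  assumes "degree r \<le> p"
  shows "integral {0..1} (\<lambda>x. (poly (pderiv r) x)^2)
    \<le> 4 * (real p + 1)^4 * integral {0..1} (\<lambda>x. (poly r x)^2)"
  using markov_low_degree[of r "Suc p"] assms
  unfolding unit_integral_square by (simp add: low_degree_iff add.commute)

text \<open>The endpoint bound on \<open>[x, 1]\<close>, an interval of length at least one half, after rescaling.\<close>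

lemma nikolskii_interior:
  assumes r: "degree r \<le> p" and x: "0 \<le> x" "x \<le> 1/2"
  shows "(poly r x)^2 \<le> 2 * (real p + 1)^2 * integral {0..1} (\<lambda>x. (poly r x)^2)"
proof -
  define s where "s = r \<circ>\<^sub>p [:x, 1 - x:]"
  have ps: "poly s t = poly r ((1 - x) * t + x)" for t
    by (simp add: s_def poly_pcompose algebra_simps)
  have "degree s \<le> p" unfolding s_def using r x by (simp add: degree_pcompose)
  hence "(poly s 0)^2 \<le> (real (Suc p))^2 * unit_integral (s * s)"
    by (intro endpoint_bound) (auto simp: low_degree_iff)
  hence 1: "(poly r x)^2 \<le> (real p + 1)^2 * integral {0..1} (\<lambda>t. (poly r ((1 - x) * t + x))^2)"
    unfolding unit_integral_square ps by (simp add: add.commute)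
  have "((\<lambda>t. (poly r t)^2) has_integral integral {x..1} (\<lambda>t. (poly r t)^2)) (cbox x 1)"
    by (auto intro!: integrable_integral integrable_continuous_real continuous_intros)
  from has_integral_affinity[OF this, of "1 - x" x] x
  have "((\<lambda>t. (poly r ((1 - x) * t + x))^2) has_integral
      (1 / (1 - x)) * integral {x..1} (\<lambda>t. (poly r t)^2)) ((\<lambda>t. t / (1 - x) - x / (1 - x)) ` {x..1})"
    by simp
  moreover have "(\<lambda>t. t / (1 - x) - x / (1 - x)) ` {x..1} = {0..1}"
    using x image_affinity_atLeastAtMost_div_diff[of "1 - x" "x / (1 - x)" x 1]
    by (simp add: diff_divide_distrib[symmetric])
  ultimately have 2: "integral {0..1} (\<lambda>t. (poly r ((1 - x) * t + x))^2)
      = (1 / (1 - x)) * integral {x..1} (\<lambda>t. (poly r t)^2)" by (simp add: integral_unique)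
  have "(1 / (1 - x)) * integral {x..1} (\<lambda>t. (poly r t)^2) \<le> 2 * integral {0..1} (\<lambda>t. (poly r t)^2)"
  proof (intro mult_mono integral_subset_le)
    show "1 / (1 - x) \<le> 2" using x by (simp add: field_simps)
    show "0 \<le> integral {x..1} (\<lambda>t. (poly r t)\<^sup>2)" by (rule integral_nonneg)
      (auto intro!: integrable_continuous_real continuous_intros)
  qed (use x in \<open>auto intro!: integrable_continuous_real continuous_intros\<close>)
  hence "integral {0..1} (\<lambda>t. (poly r ((1 - x) * t + x))^2) \<le> 2 * integral {0..1} (\<lambda>t. (poly r t)^2)"
    unfolding 2 .
  hence "(real p + 1)^2 * integral {0..1} (\<lambda>t. (poly r ((1 - x) * t + x))^2)
      \<le> (real p + 1)^2 * (2 * integral {0..1} (\<lambda>t. (poly r t)^2))"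
    by (rule mult_left_mono) simp
  also have "\<dots> = 2 * (real p + 1)^2 * integral {0..1} (\<lambda>t. (poly r t)^2)" by (simp only: mult_ac)
  finally show ?thesis using 1 by (rule order.trans[rotated])
qed


section \<open>Integrals over parallelograms\<close>

lemma continuous_absolutely_integrable:
  fixes f :: "'a::euclidean_space \<Rightarrow> 'b::euclidean_space"
  assumes "continuous_on UNIV f" "bounded S" "S \<in> sets lebesgue"
  shows "f absolutely_integrable_on S"
proof -
  obtain a where a: "S \<subseteq> cbox (-a) a" using assms(2) bounded_subset_cbox_symmetric by metis
  have "f absolutely_integrable_on cbox (-a) a"
    by (intro absolutely_integrable_continuous continuous_on_subset[OF assms(1)]) auto
  thus ?thesis using a assms(3) set_integrable_subset by blast
qed

lemma continuous_integrable_on: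
  fixes f :: "'a::euclidean_space \<Rightarrow> 'b::euclidean_space"
  assumes "continuous_on UNIV f" "bounded S" "S \<in> sets lebesgue"
  shows "f integrable_on S"
  using continuous_absolutely_integrable[OF assms] by (rule set_lebesgue_integral_eq_integral(1))

definition cross2 :: "real^2 \<Rightarrow> real^2 \<Rightarrow> real" where
  "cross2 u v = u$1 * v$2 - u$2 * v$1"

definition parallelogram :: "real^2 \<Rightarrow> real^2 \<Rightarrow> real^2 \<Rightarrow> (real^2) set" where
  "parallelogram A u v = {A + s *\<^sub>R u + t *\<^sub>R v | s t. s \<in> {0..1} \<and> t \<in> {0..1}}"

lemma vector2_eq: "(x::real^2) = vector [x$1, x$2]"
  by (simp add: vec_eq_iff forall_2)

lemma vector2_basis: "(vector [s, t] :: real^2) = s *\<^sub>R axis 1 1 + t *\<^sub>R axis 2 1"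
  by (simp add: vec_eq_iff forall_2 axis_def)

lemma continuous_vector2 [continuous_intros]:
  assumes "continuous_on S f" "continuous_on S g"
  shows "continuous_on S (\<lambda>x. vector [f x, g x] :: real^2)"
  unfolding vector2_basis by (intro continuous_intros assms)

lemma cbox_vector2: "x \<in> cbox (a::real^2) b \<longleftrightarrow> a$1 \<le> x$1 \<and> x$1 \<le> b$1 \<and> a$2 \<le> x$2 \<and> x$2 \<le> b$2"
  by (auto simp: mem_box_cart forall_2)

lemma integral_real2:
  fixes f :: "real^2 \<Rightarrow> real"
  assumes f: "continuous_on UNIV f"
  shows "integral (cbox 0 1) f = integral {0..1} (\<lambda>s. integral {0..1} (\<lambda>t. f (vector [s, t])))"
proof -
  let ?g = "\<lambda>x::real^2. (x$1, x$2)" and ?h = "\<lambda>y. vector [fst y, snd y] :: real^2"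
  let ?F = "\<lambda>y. f (?h y)"
  have cont: "continuous_on UNIV ?F"
    by (intro continuous_on_compose2[OF f] continuous_intros) auto
  have int: "(?F has_integral integral (cbox (0,0) (1,1)) ?F) (cbox (0,0) (1,1))"
    by (intro integrable_integral integrable_continuous continuous_on_subset[OF cont]) auto
  have gb: "?g ` cbox u v = cbox (?g u) (?g v)" for u v
  proof -
    have "y \<in> ?g ` cbox u v \<longleftrightarrow> y \<in> cbox (?g u) (?g v)" for y
    proof
      assume "y \<in> cbox (?g u) (?g v)"
      hence "?h y \<in> cbox u v" by (cases y) (auto simp: cbox_vector2 cbox_Pair_eq)
      moreover have "y = ?g (?h y)" by simp
      ultimately show "y \<in> ?g ` cbox u v" by blast
    qed (auto simp: cbox_vector2 cbox_Pair_eq)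
    thus ?thesis by blast
  qed
  have hb: "?h ` cbox u v = cbox (?h u) (?h v)" for u v
  proof -
    have "y \<in> ?h ` cbox u v \<longleftrightarrow> y \<in> cbox (?h u) (?h v)" for y
    proof
      assume "y \<in> cbox (?h u) (?h v)"
      hence "?g y \<in> cbox u v" by (cases u; cases v) (auto simp: cbox_vector2 cbox_Pair_eq)
      moreover have "y = ?h (?g y)" by (simp add: vector2_eq[symmetric])
      ultimately show "y \<in> ?h ` cbox u v" by blast
    qed (cases u; cases v; auto simp: cbox_vector2 cbox_Pair_eq)
    thus ?thesis by blast
  qed
  have "((\<lambda>x. ?F (?g x)) has_integral (1 / 1) *\<^sub>R integral (cbox (0,0) (1,1)) ?F) (?h ` cbox (0,0) (1,1))"
  proof (rule has_integral_twiddle[OF zero_less_one])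
    show "?h (?g x) = x" for x by (simp add: vector2_eq[symmetric])
    show "?g (?h y) = y" for y by simp
    show "\<exists>w z. ?g ` cbox u v = cbox w z" for u v using gb by blast
    show "\<exists>w z. ?h ` cbox u v = cbox w z" for u v using hb by blast
    show "continuous (at x) ?g" for x :: "real^2" by (intro continuous_intros)
    show "measure lborel (?g ` cbox u v) = 1 * measure lborel (cbox u v)" for u v :: "real^2"
    proof (cases "u$1 \<le> v$1 \<and> u$2 \<le> v$2")
      case True
      thus ?thesis unfolding gb
        by (subst content_cbox_cart) (auto simp: content_Pair cbox_vector2 interval_ne_empty_cart forall_2 UNIV_2)
    next
      case False
      hence "cbox u v = {}" using cbox_vector2 order.trans by blast
      thus ?thesis by simp
    qed
    show "(?F has_integral integral (cbox (0,0) (1,1)) ?F) (cbox (0,0) (1,1))" by (rule int)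
  qed
  moreover have "?h ` cbox (0,0) (1,1) = cbox 0 1"
    unfolding hb by (auto simp: cbox_vector2)
  ultimately have "integral (cbox 0 1) f = integral (cbox (0,0) (1,1)) ?F"
    by (simp add: vector2_eq[symmetric] integral_unique)
  also have "\<dots> = integral (cbox 0 1) (\<lambda>s. integral (cbox 0 1) (\<lambda>t. ?F (s, t)))"
    by (intro integral_prod_continuous continuous_on_subset[OF cont]) auto
  finally show ?thesis by simp
qed

lemma parallelogram_image: "parallelogram A u v = (\<lambda>y::real^2. A + y$1 *\<^sub>R u + y$2 *\<^sub>R v) ` cbox 0 1"
proof -
  have "x \<in> parallelogram A u v \<longleftrightarrow> x \<in> (\<lambda>y::real^2. A + y$1 *\<^sub>R u + y$2 *\<^sub>R v) ` cbox 0 1" for x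
  proof
    assume "x \<in> parallelogram A u v"
    then obtain s t where "x = A + s *\<^sub>R u + t *\<^sub>R v" "s \<in> {0..1}" "t \<in> {0..1}"
      by (auto simp: parallelogram_def)
    thus "x \<in> (\<lambda>y::real^2. A + y$1 *\<^sub>R u + y$2 *\<^sub>R v) ` cbox 0 1"
      by (intro image_eqI[of _ _ "vector [s, t]"]) (auto simp: cbox_vector2)
  qed (force simp: parallelogram_def cbox_vector2)
  thus ?thesis by blast
qed

lemma compact_parallelogram: "compact (parallelogram A u v)"
  unfolding parallelogram_image by (intro compact_continuous_image continuous_intros) auto

lemma cross2_inject:
  assumes "cross2 u v \<noteq> 0" "s *\<^sub>R u + t *\<^sub>R v = s' *\<^sub>R u + t' *\<^sub>R v"
  shows "s = s' \<and> t = t'"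
proof -
  have 1: "(s - s') * u$1 + (t - t') * v$1 = 0" "(s - s') * u$2 + (t - t') * v$2 = 0"
    using assms(2) by (auto simp: vec_eq_iff forall_2 algebra_simps)
  have "(s - s') * cross2 u v = ((s - s') * u$1 + (t - t') * v$1) * v$2 - ((s - s') * u$2 + (t - t') * v$2) * v$1"
    "(t - t') * cross2 u v = ((s - s') * u$2 + (t - t') * v$2) * u$1 - ((s - s') * u$1 + (t - t') * v$1) * u$2"
    by (simp_all add: cross2_def algebra_simps)
  hence "(s - s') * cross2 u v = 0" "(t - t') * cross2 u v = 0" by (simp_all only: 1 mult_zero_left diff_0_right)
  thus ?thesis using assms(1) by simp
qed

text \<open>Affine change of variables to the unit square, followed by Fubini.\<close>

lemma integral_parallelogram:
  fixes f :: "real^2 \<Rightarrow> real"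
  assumes f: "continuous_on UNIV f" and D: "cross2 u v \<noteq> 0"
  shows "integral (parallelogram A u v) f
    = \<bar>cross2 u v\<bar> * integral {0..1} (\<lambda>s. integral {0..1} (\<lambda>t. f (A + s *\<^sub>R u + t *\<^sub>R v)))"
proof -
  let ?G = "\<lambda>y::real^2. A + y$1 *\<^sub>R u + y$2 *\<^sub>R v"
  let ?G' = "\<lambda>y::real^2. y$1 *\<^sub>R u + y$2 *\<^sub>R v"
  define F where "F = (\<lambda>x. vec (f x) :: real^1)"
  have F: "continuous_on UNIV F" unfolding F_def vec_def by (intro continuous_intros f)
  have G: "continuous_on UNIV ?G" by (intro continuous_intros)
  have der: "(?G has_derivative ?G') (at y within S)" for y S
    by (rule derivative_eq_intros bounded_linear.has_derivative[OF bounded_linear_vec_nth] refl | simp)+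
  have inj: "inj_on ?G (cbox 0 1)"
  proof (rule inj_onI)
    fix y z assume "?G y = ?G z"
    hence "?G' y = ?G' z" by simp
    from cross2_inject[OF D this] show "y = z" by (simp add: vec_eq_iff forall_2)
  qed
  have det: "det (matrix ?G') = cross2 u v"
    by (simp add: det_2 matrix_def cross2_def axis_def)
  have aF: "F absolutely_integrable_on (?G ` cbox 0 1)"
    unfolding parallelogram_image[symmetric] using compact_parallelogram
    by (intro continuous_absolutely_integrable F) (auto simp: compact_imp_bounded fmeasurableD lmeasurable_compact)
  have eq: "integral (?G ` cbox 0 1) F = integral (cbox 0 1) (\<lambda>x. \<bar>det (matrix ?G')\<bar> *\<^sub>R F (?G x))"
    by (rule integral_change_of_variables[OF _ der inj]) (use aF in auto)
  have "integral (parallelogram A u v) f = integral (parallelogram A u v) (\<lambda>x. F x $ 1)" by (simp add: F_def)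
  also have "\<dots> = integral (parallelogram A u v) F $ 1"
    using aF unfolding parallelogram_image by (intro integral_component_eq_cart set_lebesgue_integral_eq_integral(1))
  also have "\<dots> = (\<bar>cross2 u v\<bar> *\<^sub>R integral (cbox 0 1) (\<lambda>x. F (?G x))) $ 1"
    unfolding parallelogram_image eq det by simp
  also have "\<dots> = \<bar>cross2 u v\<bar> * integral (cbox 0 1) (\<lambda>x. F (?G x) $ 1)"
    by (subst integral_component_eq_cart)
       (auto intro!: integrable_continuous continuous_on_compose2[OF F] continuous_intros)
  also have "integral (cbox 0 1) (\<lambda>x. F (?G x) $ 1) = integral {0..1} (\<lambda>s. integral {0..1} (\<lambda>t. f (A + s *\<^sub>R u + t *\<^sub>R v)))"
    by (subst integral_real2) (auto simp: F_def intro!: continuous_on_compose2[OF f] continuous_intros)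
  finally show ?thesis .
qed

section \<open>A smooth cutoff function\<close>

text \<open>The functions \<open>P(1/t) exp(-1/t)\<close>, extended by 0 to \<open>t \<le> 0\<close>. Together they are closed under
differentiation, so no higher derivative has to be computed explicitly.\<close>

definition flat :: "real poly \<Rightarrow> real \<Rightarrow> real" where
  "flat P t = (if t \<le> 0 then 0 else poly P (1 / t) * exp (- (1 / t)))"

definition flat_deriv :: "real poly \<Rightarrow> real poly" where
  "flat_deriv P = [:0, 0, 1:] * (P - pderiv P)"

lemma poly_exp_tendsto_0: "((\<lambda>x. poly P x * exp (- x)) \<longlongrightarrow> 0) at_top" for P :: "real poly"
proof (induction P)
  case 0
  thus ?case by simp
next
  case (pCons a P)
  have "((\<lambda>x. a * exp (- x) + x * poly P x / exp x) \<longlongrightarrow> a * 0 + 0) at_top"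
  proof (intro tendsto_add tendsto_mult tendsto_const)
    show "((\<lambda>x::real. exp (- x)) \<longlongrightarrow> 0) at_top"
      by (intro filterlim_compose[OF exp_at_bot] filterlim_uminus_at_bot_at_top)
    have "((\<lambda>x. \<Sum>i\<le>degree (pCons 0 P). coeff (pCons 0 P) i * (x ^ i / exp x)) \<longlongrightarrow> (\<Sum>i\<le>degree (pCons 0 P). coeff (pCons 0 P) i * 0)) at_top"
      by (intro tendsto_sum tendsto_mult tendsto_const tendsto_power_div_exp_0)
    hence "((\<lambda>x. poly (pCons 0 P) x / exp x) \<longlongrightarrow> 0) at_top"
      by (simp add: poly_altdef sum_divide_distrib)
    thus "((\<lambda>x. x * poly P x / exp x) \<longlongrightarrow> 0) at_top" by simp
  qed
  thus ?case by (simp add: algebra_simps exp_minus divide_inverse)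
qed

lemma flat_has_derivative:
  "(flat P has_real_derivative flat (flat_deriv P) t) (at t)"
proof -
  consider "t < 0" | "t = 0" | "t > 0" by linarith
  thus ?thesis
  proof cases
    case 1
    have "((\<lambda>_. 0) has_real_derivative 0) (at t)" by simp
    hence "(flat P has_real_derivative 0) (at t)"
      by (rule has_field_derivative_transform_within_open[where S = "{..<0}"])
         (use 1 in \<open>auto simp: flat_def\<close>)
    thus ?thesis using 1 by (simp add: flat_def)
  next
    case 2
    have R: "((\<lambda>h. flat P h / h) \<longlongrightarrow> 0) (at_right 0)"
    proof -
      have "((\<lambda>h. poly ([:0, 1:] * P) (inverse h) * exp (- inverse h)) \<longlongrightarrow> 0) (at_right 0)"
        by (rule filterlim_compose[OF poly_exp_tendsto_0 filterlim_inverse_at_top_right])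
      moreover have "eventually (\<lambda>h. poly ([:0, 1:] * P) (inverse h) * exp (- inverse h) = flat P h / h) (at_right 0)"
        by (auto simp: eventually_at_right_field flat_def field_simps intro!: exI[of _ 1])
      ultimately show ?thesis by (rule Lim_transform_eventually)
    qed
    have L: "((\<lambda>h. flat P h / h) \<longlongrightarrow> 0) (at_left 0)"
      by (rule Lim_transform_eventually[OF tendsto_const])
         (auto simp: eventually_at_left_field flat_def intro!: exI[of _ "-1"])
    have "((\<lambda>h. flat P h / h) \<longlongrightarrow> 0) (at 0)"
      using L R filterlim_split_at by blast
    hence "(flat P has_real_derivative 0) (at 0)"
      by (simp add: DERIV_def flat_def)
    thus ?thesis using 2 by (simp add: flat_def)
  next
    case 3
    have "((\<lambda>t. poly P (1 / t) * exp (- (1 / t))) has_real_derivative flat (flat_deriv P) t) (at t)"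
      using 3 by (auto intro!: derivative_eq_intros DERIV_chain2[OF poly_DERIV]
          simp: flat_def flat_deriv_def field_simps power2_eq_square)
    thus ?thesis
      by (rule has_field_derivative_transform_within_open[where S = "{0<..}"])
         (use 3 in \<open>auto simp: flat_def\<close>)
  qed
qed

text \<open>An algebra of functions that contains all cutoffs and polynomials used below and is closed under
partial derivatives. Closure gives infinite differentiability without iterated derivatives of
compositions.\<close>

inductive smooth_alg :: "(real^'n::finite \<Rightarrow> real) \<Rightarrow> bool" where
  const: "smooth_alg (\<lambda>_. c)"
| inner: "smooth_alg (\<lambda>x. a \<bullet> x)"
| ridge: "smooth_alg (\<lambda>x. flat P (a \<bullet> x + b))"
| add: "smooth_alg f \<Longrightarrow> smooth_alg g \<Longrightarrow> smooth_alg (\<lambda>x. f x + g x)"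
| mult: "smooth_alg f \<Longrightarrow> smooth_alg g \<Longrightarrow> smooth_alg (\<lambda>x. f x * g x)"
| inverse: "smooth_alg f \<Longrightarrow> (\<And>x. f x \<noteq> 0) \<Longrightarrow> smooth_alg (\<lambda>x. inverse (f x))"

lemma inner_sum_axis: "(\<Sum>i\<in>UNIV. h$i * (c * a$i)) = c * (a \<bullet> h)" for a h :: "real^'n::finite"
  by (simp add: inner_vec_def sum_distrib_left mult_ac)

lemma smooth_alg_has_derivative:
  assumes "smooth_alg f"
  shows "\<exists>D. (\<forall>x. (f has_derivative (\<lambda>h. \<Sum>i\<in>UNIV. h$i * D i x)) (at x)) \<and> (\<forall>i. smooth_alg (D i))"
  using assms
proof induction
  case (const c)
  show ?case by (intro exI[of _ "\<lambda>_ _. 0"]) (auto intro: smooth_alg.const)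
next
  case (inner a)
  show ?case
  proof (intro exI[of _ "\<lambda>i _. a$i"] conjI allI)
    fix x
    have "((\<lambda>x. a \<bullet> x) has_derivative (\<lambda>h. a \<bullet> h)) (at x)" by (auto intro!: derivative_eq_intros)
    thus "((\<lambda>x. a \<bullet> x) has_derivative (\<lambda>h. \<Sum>i\<in>UNIV. h$i * a$i)) (at x)"
      using inner_sum_axis[of _ 1 a] by simp
  qed (rule smooth_alg.const)
next
  case (ridge P a b)
  show ?case
  proof (intro exI[of _ "\<lambda>i x. flat (flat_deriv P) (a \<bullet> x + b) * a$i"] conjI allI)
    fix x
    have 1: "((\<lambda>x. a \<bullet> x + b) has_derivative (\<lambda>h. a \<bullet> h)) (at x)"
      by (auto intro!: derivative_eq_intros)
    have "((\<lambda>x. flat P (a \<bullet> x + b)) has_derivative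
         (\<lambda>h. flat (flat_deriv P) (a \<bullet> x + b) * (a \<bullet> h))) (at x)"
      using has_derivative_compose[OF 1 flat_has_derivative[unfolded has_field_derivative_def]] by simp
    thus "((\<lambda>x. flat P (a \<bullet> x + b)) has_derivative
         (\<lambda>h. \<Sum>i\<in>UNIV. h$i * (flat (flat_deriv P) (a \<bullet> x + b) * a$i))) (at x)"
      unfolding inner_sum_axis .
  next
    fix i
    show "smooth_alg (\<lambda>x. flat (flat_deriv P) (a \<bullet> x + b) * a$i)"
      by (intro smooth_alg.mult smooth_alg.ridge smooth_alg.const)
  qed
next
  case (add f g)
  from add.IH(1) obtain D where "(\<forall>x. (f has_derivative (\<lambda>h. \<Sum>i\<in>UNIV. h$i * D i x)) (at x)) \<and> (\<forall>i. smooth_alg (D i))" ..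
  hence D: "\<And>x. (f has_derivative (\<lambda>h. \<Sum>i\<in>UNIV. h$i * D i x)) (at x)" "\<And>i. smooth_alg (D i)" by blast+
  from add.IH(2) obtain E where "(\<forall>x. (g has_derivative (\<lambda>h. \<Sum>i\<in>UNIV. h$i * E i x)) (at x)) \<and> (\<forall>i. smooth_alg (E i))" ..
  hence E: "\<And>x. (g has_derivative (\<lambda>h. \<Sum>i\<in>UNIV. h$i * E i x)) (at x)" "\<And>i. smooth_alg (E i)" by blast+
  show ?case
  proof (intro exI[of _ "\<lambda>i x. D i x + E i x"] conjI allI)
    show "((\<lambda>x. f x + g x) has_derivative (\<lambda>h. \<Sum>i\<in>UNIV. h$i * (D i x + E i x))) (at x)" for x
      using has_derivative_add[OF D(1)[of x] E(1)[of x]] by (simp add: algebra_simps sum.distrib)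
  qed (intro smooth_alg.add D E)
next
  case (mult f g)
  from mult.IH(1) obtain D where "(\<forall>x. (f has_derivative (\<lambda>h. \<Sum>i\<in>UNIV. h$i * D i x)) (at x)) \<and> (\<forall>i. smooth_alg (D i))" ..
  hence D: "\<And>x. (f has_derivative (\<lambda>h. \<Sum>i\<in>UNIV. h$i * D i x)) (at x)" "\<And>i. smooth_alg (D i)" by blast+
  from mult.IH(2) obtain E where "(\<forall>x. (g has_derivative (\<lambda>h. \<Sum>i\<in>UNIV. h$i * E i x)) (at x)) \<and> (\<forall>i. smooth_alg (E i))" ..
  hence E: "\<And>x. (g has_derivative (\<lambda>h. \<Sum>i\<in>UNIV. h$i * E i x)) (at x)" "\<And>i. smooth_alg (E i)" by blast+
  show ?case
  proof (intro exI[of _ "\<lambda>i x. f x * E i x + D i x * g x"] conjI allI)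
    show "((\<lambda>x. f x * g x) has_derivative (\<lambda>h. \<Sum>i\<in>UNIV. h$i * (f x * E i x + D i x * g x))) (at x)" for x
      using has_derivative_mult[OF D(1)[of x] E(1)[of x]]
      by (simp add: algebra_simps sum.distrib sum_distrib_left sum_distrib_right)
  qed (intro smooth_alg.add smooth_alg.mult D E mult.hyps)
next
  case (inverse f)
  from inverse.IH obtain D where "(\<forall>x. (f has_derivative (\<lambda>h. \<Sum>i\<in>UNIV. h$i * D i x)) (at x)) \<and> (\<forall>i. smooth_alg (D i))" ..
  hence D: "\<And>x. (f has_derivative (\<lambda>h. \<Sum>i\<in>UNIV. h$i * D i x)) (at x)" "\<And>i. smooth_alg (D i)" by blast+
  show ?case
  proof (intro exI[of _ "\<lambda>i x. (- 1) * (inverse (f x) * D i x * inverse (f x))"] conjI allI)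
    show "((\<lambda>x. inverse (f x)) has_derivative (\<lambda>h. \<Sum>i\<in>UNIV. h$i * ((- 1) * (inverse (f x) * D i x * inverse (f x))))) (at x)" for x
      using Deriv.has_derivative_inverse[OF inverse.hyps(2) D(1)[of x]]
      by (simp add: sum_distrib_left sum_distrib_right sum_negf mult_ac)
  qed (intro smooth_alg.mult smooth_alg.const smooth_alg.inverse D inverse.hyps)
qed

lemma partial_deriv_eq:
  assumes "(f has_derivative (\<lambda>h. \<Sum>i\<in>UNIV. h$i * D i)) (at x)"
  shows "partial_deriv i f x = D i"
proof -
  have "frechet_derivative f (at x) = (\<lambda>h. \<Sum>i\<in>UNIV. h$i * D i)"
    using frechet_derivative_at[OF assms] by simp
  thus ?thesis by (simp add: partial_deriv_def axis_def if_distrib[of "\<lambda>x. x * _"] cong: if_cong)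
qed

definition grad :: "(real^'n::finite \<Rightarrow> real) \<Rightarrow> real^'n \<Rightarrow> real^'n" where
  "grad f x = (\<chi> i. partial_deriv i f x)"

lemma smooth_alg_grad:
  assumes "smooth_alg f"
  shows "(f has_derivative (\<lambda>h. grad f x \<bullet> h)) (at x)" "smooth_alg (\<lambda>x. grad f x $ i)"
    "smooth_alg (partial_deriv i f)"
proof -
  from smooth_alg_has_derivative[OF assms] obtain D where "(\<forall>x. (f has_derivative (\<lambda>h. \<Sum>i\<in>UNIV. h$i * D i x)) (at x)) \<and> (\<forall>i. smooth_alg (D i))" ..
  hence D: "\<And>x. (f has_derivative (\<lambda>h. \<Sum>i\<in>UNIV. h$i * D i x)) (at x)" "\<And>i. smooth_alg (D i)" by blast+
  have pd: "partial_deriv i f x = D i x" for i x by (rule partial_deriv_eq[OF D(1)])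
  show "(f has_derivative (\<lambda>h. grad f x \<bullet> h)) (at x)"
    using D(1)[of x] by (simp add: grad_def pd inner_vec_def mult.commute)
  have "partial_deriv i f = D i" using pd by blast
  thus "smooth_alg (\<lambda>x. grad f x $ i)" "smooth_alg (partial_deriv i f)"
    using D(2)[of i] by (auto simp: grad_def pd)
qed

lemma smooth_alg_continuous: "smooth_alg f \<Longrightarrow> continuous_on S f"
  using smooth_alg_grad(1)[of f] has_derivative_continuous
  by (blast intro: continuous_at_imp_continuous_on)

lemma smooth_alg_continuous_grad: "smooth_alg f \<Longrightarrow> continuous_on S (grad f)"
  unfolding grad_def by (intro continuous_on_vec_lambda smooth_alg_continuous smooth_alg_grad(3))

lemma smooth_alg_Ck: "smooth_alg f \<Longrightarrow> Ck k f"
proof (induction k arbitrary: f)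
  case 0
  thus ?case by (simp add: smooth_alg_continuous)
next
  case (Suc k)
  thus ?case using smooth_alg_grad[OF Suc.prems] by (auto simp: differentiable_def)
qed

text \<open>The usual smooth transition from 0 for \<open>t \<le> 0\<close> to 1 for \<open>t \<ge> 1\<close>.\<close>

definition smooth_step :: "real \<Rightarrow> real" where
  "smooth_step t = flat 1 t * inverse (flat 1 t + flat 1 (1 - t))"

lemma flat_1_nonneg: "0 \<le> flat 1 t" and flat_1_pos: "0 < t \<Longrightarrow> 0 < flat 1 t"
  by (auto simp: flat_def)

lemma flat_1_denominator_pos: "0 < flat 1 t + flat 1 (1 - t)"
  using flat_1_nonneg[of t] flat_1_nonneg[of "1 - t"] flat_1_pos[of t] flat_1_pos[of "1 - t"]
  by (cases "t > 0") auto

lemma smooth_step_bounds: "0 \<le> smooth_step t" "smooth_step t \<le> 1"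
  using flat_1_nonneg[of t] flat_1_nonneg[of "1 - t"] flat_1_denominator_pos[of t]
  by (auto simp: smooth_step_def field_simps)

lemma smooth_step_eq_0: "t \<le> 0 \<Longrightarrow> smooth_step t = 0"
  by (simp add: smooth_step_def flat_def)

lemma smooth_step_eq_1: "t \<ge> 1 \<Longrightarrow> smooth_step t = 1"
  by (simp add: smooth_step_def flat_def)

lemma smooth_alg_smooth_step: "smooth_alg (\<lambda>x. smooth_step (a \<bullet> x + b))"
proof -
  have "smooth_alg (\<lambda>x. flat 1 (a \<bullet> x + b) * inverse (flat 1 (a \<bullet> x + b) + flat 1 ((- a) \<bullet> x + (1 - b))))"
  proof (intro smooth_alg.mult smooth_alg.inverse smooth_alg.add smooth_alg.ridge)
    show "flat 1 (a \<bullet> x + b) + flat 1 ((- a) \<bullet> x + (1 - b)) \<noteq> 0" for x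
      using flat_1_denominator_pos[of "a \<bullet> x + b"] by (simp add: algebra_simps)
  qed
  thus ?thesis by (simp add: smooth_step_def algebra_simps)
qed

lemma smooth_step_deriv_bound:
  obtains S' M where "M > 0" "\<And>t. (smooth_step has_real_derivative S' t) (at t)" "\<And>t. \<bar>S' t\<bar> \<le> M"
proof -
  let ?f = "flat 1" and ?f' = "flat (flat_deriv 1)"
  let ?d = "\<lambda>t. ?f t + ?f (1 - t)"
  define S' where "S' = (\<lambda>t. ?f t * (- (inverse (?d t) * (?f' t - ?f' (1 - t)) * inverse (?d t))) + ?f' t * inverse (?d t))"
  have nz: "?d t \<noteq> 0" for t using flat_1_denominator_pos[of t] by simp
  have f1: "((\<lambda>t. flat P (1 - t)) has_real_derivative - flat (flat_deriv P) (1 - t)) (at t)" for P t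
  proof -
    have "((\<lambda>t::real. 1 - t) has_real_derivative - 1) (at t)" by (auto intro!: derivative_eq_intros)
    from DERIV_chain2[OF flat_has_derivative this] show ?thesis by simp
  qed
  have der: "(smooth_step has_real_derivative S' t) (at t)" for t
    unfolding smooth_step_def[abs_def] S'_def
    by (rule derivative_eq_intros flat_has_derivative f1 nz refl | simp add: algebra_simps)+
  have cf: "continuous_on UNIV (flat P)" for P
    using flat_has_derivative DERIV_isCont by (blast intro: continuous_at_imp_continuous_on)
  have "continuous_on {0..1} S'"
    unfolding S'_def by (intro continuous_intros continuous_on_compose2[OF cf]) (use nz in auto)
  hence "bounded (S' ` {0..1})" by (intro compact_imp_bounded compact_continuous_image) auto
  then obtain M where M: "M > 0" "\<And>t. t \<in> {0..1} \<Longrightarrow> \<bar>S' t\<bar> \<le> M"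
    unfolding bounded_pos by auto
  have "S' t = 0" if "t < 0" for t
  proof -
    have "((\<lambda>_. 0) has_real_derivative 0) (at t)" by simp
    hence "(smooth_step has_real_derivative 0) (at t)"
      by (rule has_field_derivative_transform_within_open[where S = "{..<0}"])
         (use that in \<open>auto simp: smooth_step_eq_0\<close>)
    thus ?thesis using der DERIV_unique by blast
  qed
  moreover have "S' t = 0" if "t > 1" for t
  proof -
    have "((\<lambda>_. 1) has_real_derivative 0) (at t)" by simp
    hence "(smooth_step has_real_derivative 0) (at t)"
      by (rule has_field_derivative_transform_within_open[where S = "{1<..}"])
         (use that in \<open>auto simp: smooth_step_eq_1\<close>)
    thus ?thesis using der DERIV_unique by blast
  qed
  ultimately have "\<bar>S' t\<bar> \<le> M" for t
    using M by (cases "t \<in> {0..1}") (auto simp: not_le)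
  thus thesis using that M(1) der by blast
qed

section \<open>Weak gradients of test functions\<close>

lemma continuous_integral_lebesgue_on:
  fixes g :: "'a::euclidean_space \<Rightarrow> real"
  assumes "continuous_on UNIV g" "bounded S" "S \<in> sets lebesgue"
  shows "integrable (lebesgue_on S) g" "(LINT x|lebesgue_on S. g x) = integral S g"
proof -
  have "g absolutely_integrable_on S" by (rule continuous_absolutely_integrable[OF assms])
  thus i: "integrable (lebesgue_on S) g"
    using assms(3) by (simp add: integrable_restrict_space set_integrable_def)
  show "(LINT x|lebesgue_on S. g x) = integral S g"
    by (rule lebesgue_integral_eq_integral[OF i assms(3)])
qed

lemma differentiable_has_grad:
  assumes "f differentiable (at x)"
  shows "(f has_derivative (\<lambda>h. grad f x \<bullet> h)) (at x)"
proof -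
  let ?D = "frechet_derivative f (at x)"
  have D: "(f has_derivative ?D) (at x)" using assms frechet_derivative_works by blast
  have "?D h = grad f x \<bullet> h" for h
  proof -
    interpret linear ?D using D has_derivative_linear by blast
    have "?D h = ?D (\<Sum>i\<in>UNIV. h$i *\<^sub>R axis i 1)"
      using basis_expansion[of h] by (simp add: scalar_mult_eq_scaleR)
    also have "\<dots> = (\<Sum>i\<in>UNIV. h$i * ?D (axis i 1))" by (simp add: sum scale)
    also have "\<dots> = grad f x \<bullet> h" by (simp add: grad_def inner_vec_def partial_deriv_def mult.commute)
    finally show ?thesis .
  qed
  hence "?D = (\<lambda>h. grad f x \<bullet> h)" by blast
  thus ?thesis using D by simp
qed

lemma grad_unique:
  assumes "(f has_derivative (\<lambda>h. g \<bullet> h)) (at x)"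
  shows "grad f x = g"
proof -
  have "frechet_derivative f (at x) = (\<lambda>h. g \<bullet> h)" using frechet_derivative_at[OF assms] by simp
  thus ?thesis by (simp add: grad_def partial_deriv_def vec_eq_iff inner_axis)
qed

lemma partial_deriv_grad: "partial_deriv i f x = grad f x $ i"
  by (simp add: grad_def)

lemma grad_zero_outside:
  assumes "x \<notin> closure {x. f x \<noteq> 0}"
  shows "grad f x = 0"
proof (rule grad_unique)
  have "((\<lambda>x. 0) has_derivative (\<lambda>h. 0 \<bullet> h)) (at x)" by simp
  thus "(f has_derivative (\<lambda>h. 0 \<bullet> h)) (at x)"
  proof (rule has_derivative_transform_within_open)
    show "open (- closure {x. f x \<noteq> 0})" "x \<in> - closure {x. f x \<noteq> 0}" using assms by auto
    show "0 = f y" if "y \<in> - closure {x. f x \<noteq> 0}" for y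
      using that closure_subset[of "{x. f x \<noteq> 0}"] by auto
  qed
qed

lemma grad_mult:
  assumes "f differentiable (at x)" "g differentiable (at x)"
  shows "grad (\<lambda>x. f x * g x) x = f x *\<^sub>R grad g x + g x *\<^sub>R grad f x"
  by (rule grad_unique)
     (use has_derivative_mult[OF differentiable_has_grad differentiable_has_grad, OF assms]
      in \<open>simp add: algebra_simps inner_add_left\<close>)

lemma test_functionD:
  assumes "\<phi> \<in> test_functions \<Omega>"
  shows "\<phi> differentiable (at x)" "continuous_on S \<phi>" "continuous_on S (\<lambda>x. grad \<phi> x $ i)"
    "continuous_on S (grad \<phi>)" "compact (closure {x. \<phi> x \<noteq> 0})" "closure {x. \<phi> x \<noteq> 0} \<subseteq> \<Omega>"
proof -
  have "Ck 0 \<phi>" "Ck (Suc 0) \<phi>" using assms unfolding test_functions_def by blast+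
  thus "\<phi> differentiable (at x)" "continuous_on S \<phi>"
    and c: "continuous_on S (\<lambda>x. grad \<phi> x $ i)" for i
    by (auto simp: grad_def intro: continuous_on_subset)
  show "continuous_on S (grad \<phi>)"
    using continuous_on_vec_lambda[of S "\<lambda>i x. grad \<phi> x $ i"] c by simp
  show "compact (closure {x. \<phi> x \<noteq> 0})" "closure {x. \<phi> x \<noteq> 0} \<subseteq> \<Omega>"
    using assms unfolding test_functions_def by blast+
qed

lemma test_functionI:
  assumes "smooth_alg f" "{x. f x \<noteq> 0} \<subseteq> C" "compact C" "C \<subseteq> \<Omega>"
  shows "f \<in> test_functions \<Omega>"
proof -
  have "closure {x. f x \<noteq> 0} \<subseteq> C"
    by (intro closure_minimal assms compact_imp_closed)
  moreover from this have "compact (closure {x. f x \<noteq> 0})"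
    using compact_Int_closed[OF assms(3) closed_closure] by (metis inf.absorb_iff2)
  ultimately show ?thesis
    using assms smooth_alg_Ck by (auto simp: test_functions_def)
qed

lemma smooth_alg_prod:
  assumes "finite I" "\<And>i. i \<in> I \<Longrightarrow> smooth_alg (f i)"
  shows "smooth_alg (\<lambda>x. \<Prod>i\<in>I. f i x)"
  using assms by (induction I rule: finite_induct) (auto intro: smooth_alg.const smooth_alg.mult)

lemma smooth_alg_sum:
  assumes "finite I" "\<And>i. i \<in> I \<Longrightarrow> smooth_alg (f i)"
  shows "smooth_alg (\<lambda>x. \<Sum>i\<in>I. f i x)"
  using assms by (induction I rule: finite_induct) (auto intro: smooth_alg.const smooth_alg.add)

lemma deriv_along_line:
  fixes f :: "real^'n::finite \<Rightarrow> real"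
  assumes "\<And>x. f differentiable (at x)"
  shows "((\<lambda>t. f (B + t *\<^sub>R v)) has_real_derivative grad f (B + t *\<^sub>R v) \<bullet> v) (at t)"
proof -
  have 1: "((\<lambda>t. B + t *\<^sub>R v) has_derivative (\<lambda>h. h *\<^sub>R v)) (at t)"
    by (auto intro!: derivative_eq_intros)
  have 2: "((\<lambda>t. f (B + t *\<^sub>R v)) has_derivative (\<lambda>h. grad f (B + t *\<^sub>R v) \<bullet> (h *\<^sub>R v))) (at t)"
    by (rule has_derivative_compose[OF 1 differentiable_has_grad[OF assms]])
  have "(\<lambda>h. grad f (B + t *\<^sub>R v) \<bullet> (h *\<^sub>R v)) = (*) (grad f (B + t *\<^sub>R v) \<bullet> v)"
    by (simp add: fun_eq_iff mult.commute)
  thus ?thesis using 2 unfolding has_field_derivative_def by (simp only:)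
qed

lemma integral_along_line:
  fixes f :: "real^'n::finite \<Rightarrow> real"
  assumes "\<And>x. f differentiable (at x)"
  shows "((\<lambda>t. grad f (B + t *\<^sub>R v) \<bullet> v) has_integral f (B + v) - f B) {0..1}"
proof -
  have "((\<lambda>t. f (B + t *\<^sub>R v)) has_vector_derivative grad f (B + t *\<^sub>R v) \<bullet> v) (at t within {0..1})" for t
    using deriv_along_line[OF assms, of B v t]
    unfolding has_real_derivative_iff_has_vector_derivative by (rule has_vector_derivative_at_within)
  from fundamental_theorem_of_calculus[OF zero_le_one this] show ?thesis by simp
qed

text \<open>After enclosing the support in a square, Fubini reduces this to the fundamental theorem of calculus along
lines in direction \<open>i\<close>, with vanishing endpoint values.\<close>

lemma integral_grad_zero:
  fixes f :: "real^2 \<Rightarrow> real"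
  assumes diff: "\<And>x. f differentiable (at x)" and cont: "continuous_on UNIV (\<lambda>x. grad f x $ i)"
    and supp: "closure {x. f x \<noteq> 0} \<subseteq> S" "bounded S"
  shows "integral S (\<lambda>x. grad f x $ i) = 0"
proof -
  obtain R where R0: "R > 0" "\<forall>x\<in>S. norm x < R"
    using supp(2) unfolding bounded_pos_less by auto
  hence R: "R > 0" "\<And>x. x \<in> S \<Longrightarrow> norm x < R" by auto
  have zero: "f x = 0" if "\<bar>x $ k\<bar> \<ge> R" for x k
  proof (rule ccontr)
    assume "f x \<noteq> 0"
    hence "x \<in> S" using supp(1) closure_subset[of "{x. f x \<noteq> 0}"] by auto
    thus False using R(2)[of x] component_le_norm_cart[of x k] that by simp
  qed
  define j :: 2 where "j = (if i = 1 then 2 else 1)"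
  have ij: "i = 1 \<and> j = 2 \<or> i = 2 \<and> j = 1" using exhaust_2[of i] by (auto simp: j_def)
  hence j: "j \<noteq> i" "i \<noteq> j" by auto
  \<comment> \<open>the square of side \<open>2 R\<close> around the origin, with \<open>i\<close> as the direction of the inner integral\<close>
  define A u v :: "real^2" where "A = (\<chi> k. - R)" and "u = (2 * R) *\<^sub>R axis j 1" and "v = (2 * R) *\<^sub>R axis i 1"
  have c: "cross2 u v \<noteq> 0"
    using ij R(1) by (auto simp: cross2_def u_def v_def axis_def)
  have "x \<in> parallelogram A u v" if "x \<in> S" for x
    unfolding parallelogram_def
  proof (intro CollectI exI conjI)
    have b: "\<bar>x $ k\<bar> < R" for k using R(2)[OF that] component_le_norm_cart[of x k] by linarith
    show "x = A + ((x $ j + R) / (2 * R)) *\<^sub>R u + ((x $ i + R) / (2 * R)) *\<^sub>R v"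
    proof (subst vec_eq_iff, intro allI)
      fix k
      have "k = i \<or> k = j" using exhaust_2[of k] ij by auto
      thus "x $ k = (A + ((x $ j + R) / (2 * R)) *\<^sub>R u + ((x $ i + R) / (2 * R)) *\<^sub>R v) $ k"
        using R(1) j by (auto simp: A_def u_def v_def axis_def)
    qed
    show "(x $ j + R) / (2 * R) \<in> {0..1}" "(x $ i + R) / (2 * R) \<in> {0..1}"
      using b[of i] b[of j] R(1) by (auto simp: field_simps)
  qed
  hence "S \<subseteq> parallelogram A u v" by blast
  have "integral S (\<lambda>x. grad f x $ i) = integral UNIV (\<lambda>x. if x \<in> S then grad f x $ i else 0)"
    by (simp add: integral_restrict_UNIV)
  also have "(\<lambda>x. if x \<in> S then grad f x $ i else 0) = (\<lambda>x. if x \<in> parallelogram A u v then grad f x $ i else 0)"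
  proof
    fix x
    have "grad f x = 0" if "x \<notin> S"
      using that supp(1) by (intro grad_zero_outside notI) (rule notE, assumption, erule subsetD)
    thus "(if x \<in> S then grad f x $ i else 0) = (if x \<in> parallelogram A u v then grad f x $ i else 0)"
      using \<open>S \<subseteq> parallelogram A u v\<close> by auto
  qed
  also have "integral UNIV \<dots> = integral (parallelogram A u v) (\<lambda>x. grad f x $ i)"
    by (simp add: integral_restrict_UNIV)
  also have "\<dots> = \<bar>cross2 u v\<bar> * integral {0..1} (\<lambda>s. integral {0..1} (\<lambda>t. grad f (A + s *\<^sub>R u + t *\<^sub>R v) $ i))"
    by (rule integral_parallelogram[OF cont c])
  also have "(\<lambda>s. integral {0..1} (\<lambda>t. grad f (A + s *\<^sub>R u + t *\<^sub>R v) $ i)) = (\<lambda>s. 0)"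
  proof (rule ext, rule integral_unique)
    fix s
    let ?B = "A + s *\<^sub>R u"
    have "(?B + v) $ i = R" "?B $ i = - R" using j by (simp_all add: A_def u_def v_def axis_def)
    hence "f (?B + v) = 0" "f ?B = 0" using zero[of "?B + v" i] zero[of "?B" i] by simp_all
    hence "((\<lambda>t. grad f (?B + t *\<^sub>R v) \<bullet> v) has_integral 0) {0..1}"
      using integral_along_line[OF diff, of ?B v] by simp
    from has_integral_mult_right[OF this, of "1 / (2 * R)"]
    show "((\<lambda>t. grad f (?B + t *\<^sub>R v) $ i) has_integral 0) {0..1}"
      using R(1) by (simp add: v_def inner_axis)
  qed
  finally show ?thesis by simp
qed

lemma continuous_l2_space:
  fixes f :: "'a::euclidean_space \<Rightarrow> real"
  assumes "continuous_on UNIV f" "bounded S" "S \<in> sets lebesgue"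
  shows "f \<in> l2_space S"
proof -
  have "continuous_on UNIV (\<lambda>x. (f x)^2)" by (intro continuous_intros assms)
  thus ?thesis
    using continuous_integral_lebesgue_on(1)[OF _ assms(2,3)] assms
    by (auto simp: l2_space_def)
qed

lemma test_function_weak_gradient:
  fixes \<Phi> :: "real^2 \<Rightarrow> real"
  assumes S: "open S" "bounded S" and \<Phi>: "\<Phi> \<in> test_functions S"
  shows "has_weak_gradient S \<Phi> (grad \<Phi>)"
  unfolding has_weak_gradient_def
proof (intro conjI allI ballI)
  have Sm: "S \<in> sets lebesgue" using S(1) by auto
  show "\<Phi> \<in> l2_space S" "(\<lambda>x. grad \<Phi> x $ i) \<in> l2_space S" for i
    by (rule continuous_l2_space[OF _ S(2) Sm], rule test_functionD[OF \<Phi>])+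
  fix \<phi> i assume \<phi>: "\<phi> \<in> test_functions S"
  note d = test_functionD(1-3)[OF \<Phi>] test_functionD(1-3)[OF \<phi>]
  let ?f = "\<lambda>x. \<Phi> x * \<phi> x"
  have g: "grad ?f x $ i = \<Phi> x * grad \<phi> x $ i + grad \<Phi> x $ i * \<phi> x" for x
    by (simp add: grad_mult d)
  have "integral S (\<lambda>x. grad ?f x $ i) = 0"
  proof (rule integral_grad_zero)
    show "?f differentiable (at x)" for x by (intro differentiable_mult d)
    show "continuous_on UNIV (\<lambda>x. grad ?f x $ i)" unfolding g by (intro continuous_intros d)
    have "closure {x. ?f x \<noteq> 0} \<subseteq> closure {x. \<Phi> x \<noteq> 0}" by (intro closure_mono) auto
    also have "\<dots> \<subseteq> S" by (rule test_functionD(6)[OF \<Phi>])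
    finally show "closure {x. ?f x \<noteq> 0} \<subseteq> S" .
  qed (rule S)
  moreover have "integral S (\<lambda>x. grad ?f x $ i)
      = integral S (\<lambda>x. \<Phi> x * grad \<phi> x $ i) + integral S (\<lambda>x. grad \<Phi> x $ i * \<phi> x)"
    unfolding g by (intro integral_add continuous_integrable_on continuous_intros d S Sm)
  moreover have "l2_inner S \<Phi> (partial_deriv i \<phi>) = integral S (\<lambda>x. \<Phi> x * grad \<phi> x $ i)"
    unfolding l2_inner_def partial_deriv_grad
    by (intro continuous_integral_lebesgue_on continuous_intros d S Sm)
  moreover have "l2_inner S (\<lambda>x. grad \<Phi> x $ i) \<phi> = integral S (\<lambda>x. grad \<Phi> x $ i * \<phi> x)"
    unfolding l2_inner_def
    by (intro continuous_integral_lebesgue_on continuous_intros d S Sm)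
  ultimately show "l2_inner S \<Phi> (partial_deriv i \<phi>) = - l2_inner S (\<lambda>x. grad \<Phi> x $ i) \<phi>"
    by simp
qed

text \<open>Smooth functions approximating the indicator of a box: products over the coordinates of steps that
become steeper at both faces.\<close>

lemma box_bump:
  fixes a b :: "real^'n::finite"
  obtains \<phi> :: "nat \<Rightarrow> real^'n \<Rightarrow> real" where "\<And>n. smooth_alg (\<phi> n)"
    "\<And>n x. 0 \<le> \<phi> n x" "\<And>n x. \<phi> n x \<le> 1" "\<And>n x. x \<notin> box a b \<Longrightarrow> \<phi> n x = 0"
    "\<And>x. (\<lambda>n. \<phi> n x) \<longlonglongrightarrow> indicator (box a b) x"
proof -
  define \<phi> :: "nat \<Rightarrow> real^'n \<Rightarrow> real" where "\<phi> n x = (\<Prod>i\<in>UNIV.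
      smooth_step (real n * (x$i - a$i)) * smooth_step (real n * (b$i - x$i)))" for n x
  show thesis
  proof (rule that[of \<phi>])
    fix n
    have 1: "smooth_alg (\<lambda>x. smooth_step (real n * (x$i - a$i)))" for i
      using smooth_alg_smooth_step[of "real n *\<^sub>R axis i 1" "- (real n * a$i)"]
      by (simp add: inner_axis' algebra_simps)
    have 2: "smooth_alg (\<lambda>x. smooth_step (real n * (b$i - x$i)))" for i
      using smooth_alg_smooth_step[of "(- real n) *\<^sub>R axis i 1" "real n * b$i"]
      by (simp add: inner_axis' algebra_simps)
    show "smooth_alg (\<phi> n)" unfolding \<phi>_def by (intro smooth_alg_prod smooth_alg.mult 1 2) auto
  next
    fix n x
    show "0 \<le> \<phi> n x" unfolding \<phi>_def by (intro prod_nonneg mult_nonneg_nonneg ballI smooth_step_bounds)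
    show "\<phi> n x \<le> 1" unfolding \<phi>_def
      by (intro prod_le_1 conjI mult_nonneg_nonneg mult_le_one smooth_step_bounds)
  next
    fix n x assume "x \<notin> box a b"
    then obtain i where "x$i \<le> a$i \<or> b$i \<le> x$i" by (auto simp: mem_box_cart not_less)
    hence "smooth_step (real n * (x$i - a$i)) * smooth_step (real n * (b$i - x$i)) = 0"
      by (auto simp: smooth_step_eq_0 mult_nonneg_nonpos)
    thus "\<phi> n x = 0" unfolding \<phi>_def by (intro prod_zero bexI[of _ i]) auto
  next
    fix x
    have lim: "(\<lambda>n. smooth_step (real n * c)) \<longlonglongrightarrow> (if c > 0 then 1 else 0)" for c :: real
    proof (cases "c > 0")
      case True
      obtain N :: nat where N: "1 / c < real N" using reals_Archimedean2 by blast
      have "smooth_step (real n * c) = 1" if "n \<ge> N" for n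
      proof (rule smooth_step_eq_1)
        have "1 = 1 / c * c" using True by simp
        also have "\<dots> \<le> real n * c" using N that True by (intro mult_right_mono) auto
        finally show "1 \<le> real n * c" .
      qed
      hence "eventually (\<lambda>n. smooth_step (real n * c) = 1) sequentially"
        using eventually_sequentially by blast
      thus ?thesis using True by (simp add: tendsto_eventually)
    next
      case False
      thus ?thesis by (simp add: smooth_step_eq_0 mult_nonneg_nonpos)
    qed
    have "(\<lambda>n. \<phi> n x) \<longlonglongrightarrow> (\<Prod>i\<in>UNIV. (if x$i - a$i > 0 then 1 else 0) * (if b$i - x$i > 0 then 1 else 0))"
      unfolding \<phi>_def by (intro tendsto_prod tendsto_mult lim)
    also have "(\<Prod>i\<in>UNIV. (if x$i - a$i > 0 then 1 else 0) * (if b$i - x$i > 0 then 1 else 0)) = (indicator (box a b) x :: real)"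
    proof (cases "x \<in> box a b")
      case True
      thus ?thesis by (simp add: mem_box_cart)
    next
      case False
      then obtain i where "x$i \<le> a$i \<or> b$i \<le> x$i" by (auto simp: mem_box_cart not_less)
      hence "(if x$i - a$i > 0 then 1 else 0) * (if b$i - x$i > 0 then 1 else 0) = (0::real)" by auto
      hence "(\<Prod>i\<in>UNIV. (if x$i - a$i > 0 then 1 else 0) * (if b$i - x$i > 0 then 1 else 0)) = (0::real)"
        by (intro prod_zero bexI[of _ i]) auto
      thus ?thesis using False by simp
    qed
    finally show "(\<lambda>n. \<phi> n x) \<longlonglongrightarrow> indicator (box a b) x" .
  qed
qed

text \<open>Testing with \<open>box_bump\<close> shows that the integral of \<open>h\<close> over every closed box inside \<open>S\<close> vanishes, and
almost every value of \<open>h\<close> is the limit of its averages over shrinking boxes.\<close>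

lemma fundamental_lemma_variations:
  fixes h :: "real^'n::finite \<Rightarrow> real"
  assumes S: "open S" and h: "integrable (lebesgue_on S) h"
    and orth: "\<And>\<phi>. \<phi> \<in> test_functions S \<Longrightarrow> (LINT x|lebesgue_on S. h x * \<phi> x) = 0"
  shows "AE x in lebesgue_on S. h x = 0"
proof -
  have Sm: "S \<in> sets lebesgue" using S by auto
  define H where "H = (\<lambda>x. if x \<in> S then h x else 0)"
  have "h absolutely_integrable_on S"
    using h Sm by (simp add: integrable_restrict_space set_integrable_def)
  hence "H absolutely_integrable_on UNIV"
    unfolding H_def by (simp add: absolutely_integrable_restrict_UNIV)
  hence H: "H integrable_on cbox a b" for a b
    using set_lebesgue_integral_eq_integral(1) integrable_on_subcbox by blast
  have zero: "integral (cbox a b) H = 0" if ab: "cbox a b \<subseteq> S" for a b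
  proof -
    obtain \<phi> :: "nat \<Rightarrow> real^'n \<Rightarrow> real" where \<phi>: "\<And>n. smooth_alg (\<phi> n)"
      "\<And>n x. 0 \<le> \<phi> n x" "\<And>n x. \<phi> n x \<le> 1" "\<And>n x. x \<notin> box a b \<Longrightarrow> \<phi> n x = 0"
      "\<And>x. (\<lambda>n. \<phi> n x) \<longlonglongrightarrow> indicator (box a b) x" using box_bump[of a b] by metis
    have test: "\<phi> n \<in> test_functions S" for n
      by (rule test_functionI[OF \<phi>(1) _ compact_cbox ab]) (use \<phi>(4) box_subset_cbox in blast)
    have m: "\<phi> n \<in> borel_measurable (lebesgue_on S)" for n
      by (intro continuous_imp_measurable_on_sets_lebesgue smooth_alg_continuous \<phi> Sm)
    have hm: "h \<in> borel_measurable (lebesgue_on S)" using h by auto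
    have "(\<lambda>n. LINT x|lebesgue_on S. h x * \<phi> n x) \<longlonglongrightarrow> (LINT x|lebesgue_on S. h x * indicator (box a b) x)"
    proof (rule integral_dominated_convergence)
      show "integrable (lebesgue_on S) (\<lambda>x. \<bar>h x\<bar>)" using h by simp
      show "(\<lambda>x. h x * \<phi> n x) \<in> borel_measurable (lebesgue_on S)" for n using m hm by measurable
      show "AE x in lebesgue_on S. (\<lambda>n. h x * \<phi> n x) \<longlonglongrightarrow> h x * indicator (box a b) x"
        by (intro AE_I2 tendsto_mult tendsto_const \<phi>(5))
      show "AE x in lebesgue_on S. norm (h x * \<phi> n x) \<le> \<bar>h x\<bar>" for n
        using \<phi>(2,3) by (auto simp: abs_mult mult_left_le)
      show "(\<lambda>x. h x * indicator (box a b) x) \<in> borel_measurable (lebesgue_on S)"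
      proof (intro borel_measurable_times hm borel_measurable_indicator)
        have "S \<inter> box a b \<in> sets (lebesgue_on S)"
          unfolding sets_restrict_space by (rule imageI) auto
        moreover have "S \<inter> box a b = box a b" using ab box_subset_cbox[of a b] by auto
        ultimately show "box a b \<in> sets (lebesgue_on S)" by (simp only:)
      qed
    qed
    hence "(\<lambda>n::nat. 0) \<longlonglongrightarrow> (LINT x|lebesgue_on S. h x * indicator (box a b) x)"
      unfolding orth[OF test] .
    hence L: "(LINT x|lebesgue_on S. h x * indicator (box a b) x) = 0"
      by (rule LIMSEQ_unique[OF _ tendsto_const])
    have "(LINT x|lebesgue_on S. h x * indicator (box a b) x)
        = (LINT x|lebesgue. indicator S x *\<^sub>R (h x * indicator (box a b) x))"
      using Sm by (intro integral_restrict_space) auto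
    also have "\<dots> = (LINT x|lebesgue. indicator (box a b) x *\<^sub>R H x)"
    proof (rule Bochner_Integration.integral_cong[OF refl])
      fix x
      have "x \<in> S" if "x \<in> box a b" using that ab box_subset_cbox by blast
      thus "indicator S x *\<^sub>R (h x * indicator (box a b) x) = indicator (box a b) x *\<^sub>R H x"
        by (auto simp: H_def indicator_def)
    qed
    also have "\<dots> = integral (box a b) H"
    proof -
      have "set_integrable lebesgue (box a b) H"
        using \<open>H absolutely_integrable_on UNIV\<close> by (rule set_integrable_subset) auto
      from set_lebesgue_integral_eq_integral(2)[OF this] show ?thesis
        by (simp add: set_lebesgue_integral_def)
    qed
    finally show ?thesis using L integral_open_interval[of a b H] by simp
  qed
  obtain N where N: "negligible N" "\<And>x e. \<lbrakk>x \<notin> N; 0 < e\<rbrakk> \<Longrightarrow> \<exists>d>0. \<forall>t. 0 < t \<and> t < d \<longrightarrow>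
      norm (integral (cbox x (x + t *\<^sub>R One)) H /\<^sub>R t ^ DIM(real^'n) - H x) < e"
    using integrable_ccontinuous_explicit[OF H] by metis
  have "h x = 0" if x: "x \<in> S" "x \<notin> N" for x
  proof (rule ccontr)
    assume nz: "h x \<noteq> 0"
    obtain d where d: "d > 0" "\<And>t. 0 < t \<and> t < d \<Longrightarrow>
      norm (integral (cbox x (x + t *\<^sub>R One)) H /\<^sub>R t ^ DIM(real^'n) - H x) < \<bar>h x\<bar>"
      using N(2)[OF x(2), of "\<bar>h x\<bar>"] nz by auto
    obtain r where r: "r > 0" "ball x r \<subseteq> S" using S x(1) open_contains_ball by blast
    define K where "K = norm (One :: real^'n) + 1"
    have K: "K > 0" unfolding K_def by (simp add: add_nonneg_pos)
    \<comment> \<open>small enough for the differentiation estimate and for the box of side \<open>t\<close> to stay inside \<open>S\<close>\<close>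
    define t where "t = min (d / 2) (r / (2 * K))"
    have t: "0 < t" "t < d" "t * K < r"
    proof -
      show "0 < t" "t < d" using d(1) r(1) K by (auto simp: t_def)
      have "t * K \<le> r / (2 * K) * K" using K by (intro mult_right_mono) (auto simp: t_def)
      thus "t * K < r" using K r(1) by simp
    qed
    have "cbox x (x + t *\<^sub>R One) \<subseteq> ball x r"
    proof
      fix y assume y: "y \<in> cbox x (x + t *\<^sub>R One)"
      have "norm (y - x) \<le> norm (t *\<^sub>R One :: real^'n)"
        by (rule norm_le_componentwise) (use y t(1) in \<open>auto simp: mem_box inner_diff_left inner_add_left\<close>)
      also have "\<dots> \<le> t * K" using t(1) by (simp add: K_def)
      finally show "y \<in> ball x r" using t(3) by (simp add: dist_norm norm_minus_commute)
    qed
    hence "integral (cbox x (x + t *\<^sub>R One)) H = 0" using r(2) by (intro zero) blast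
    thus False using d(2)[of t] t x(1) by (simp add: H_def)
  qed
  moreover have "N \<in> null_sets lebesgue" using N(1) negligible_iff_null_sets by blast
  ultimately have "AE x in lebesgue. x \<in> S \<longrightarrow> h x = 0"
    by (intro AE_I'[of N]) auto
  thus ?thesis using Sm by (simp add: AE_restrict_space_iff)
qed

lemma l2_space_integrable:
  assumes f: "f \<in> l2_space S" and S: "bounded S" "S \<in> sets lebesgue"
  shows "integrable (lebesgue_on S) f"
proof (rule Bochner_Integration.integrable_bound)
  have "integrable (lebesgue_on S) (\<lambda>x. 1 :: real)"
    by (intro continuous_integral_lebesgue_on(1) S continuous_intros)
  moreover have "integrable (lebesgue_on S) (\<lambda>x. (f x)^2)" using f by (simp add: l2_space_def)
  ultimately show "integrable (lebesgue_on S) (\<lambda>x. 1 + (f x)^2)"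
    by (rule Bochner_Integration.integrable_add)
  show "f \<in> borel_measurable (lebesgue_on S)" using f by (simp add: l2_space_def)
  have "\<bar>y\<bar> \<le> 1 + y^2" for y :: real
  proof -
    have "0 \<le> (\<bar>y\<bar> - 1)^2" by simp
    hence "2 * \<bar>y\<bar> \<le> 1 + y^2" by (simp add: power2_diff)
    thus ?thesis using abs_ge_zero[of y] by linarith
  qed
  thus "AE x in lebesgue_on S. norm (f x) \<le> norm (1 + (f x)^2)" by (auto simp: abs_of_nonneg)
qed

lemma weak_gradient_test_function:
  fixes \<Phi> :: "real^2 \<Rightarrow> real"
  assumes S: "open S" "bounded S" and \<Phi>: "\<Phi> \<in> test_functions S"
    and g: "has_weak_gradient S \<Phi> g"
  shows "AE x in lebesgue_on S. g x = grad \<Phi> x"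
proof -
  have Sm: "S \<in> sets lebesgue" using S(1) by auto
  note w = test_function_weak_gradient[OF S \<Phi>]
  have "AE x in lebesgue_on S. g x $ i - grad \<Phi> x $ i = 0" for i
  proof (rule fundamental_lemma_variations[OF S(1)])
    have gi: "integrable (lebesgue_on S) (\<lambda>x. g x $ i)"
      by (rule l2_space_integrable[OF _ S(2) Sm]) (use g in \<open>simp add: has_weak_gradient_def\<close>)
    have pi: "integrable (lebesgue_on S) (\<lambda>x. grad \<Phi> x $ i)"
      by (rule l2_space_integrable[OF _ S(2) Sm]) (use w in \<open>simp add: has_weak_gradient_def\<close>)
    show "integrable (lebesgue_on S) (\<lambda>x. g x $ i - grad \<Phi> x $ i)"
      by (rule Bochner_Integration.integrable_diff[OF gi pi])
    fix \<phi> assume \<phi>: "\<phi> \<in> test_functions S"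
    have "compact (\<phi> ` closure {x. \<phi> x \<noteq> 0})"
      by (intro compact_continuous_image test_functionD[OF \<phi>])
    hence "bounded (\<phi> ` closure {x. \<phi> x \<noteq> 0})" by (rule compact_imp_bounded)
    then obtain B where B: "B > 0" "\<forall>y\<in>\<phi> ` closure {x. \<phi> x \<noteq> 0}. norm y \<le> B"
      unfolding bounded_pos by auto
    have b: "\<bar>\<phi> x\<bar> \<le> B" for x
      using B closure_subset[of "{x. \<phi> x \<noteq> 0}"] by (cases "\<phi> x = 0") auto
    have m: "\<phi> \<in> borel_measurable (lebesgue_on S)"
      by (rule continuous_imp_measurable_on_sets_lebesgue[OF test_functionD(2)[OF \<phi>] Sm])
    have prod: "integrable (lebesgue_on S) (\<lambda>x. h x * \<phi> x)" if h: "integrable (lebesgue_on S) h" for h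
    proof (rule Bochner_Integration.integrable_bound)
      show "integrable (lebesgue_on S) (\<lambda>x. B * h x)" using h by simp
      show "(\<lambda>x. h x * \<phi> x) \<in> borel_measurable (lebesgue_on S)" using h m by measurable
      show "AE x in lebesgue_on S. norm (h x * \<phi> x) \<le> norm (B * h x)"
        using b B(1) by (auto simp: abs_mult mult.commute intro!: mult_right_mono)
    qed
    have "l2_inner S (\<lambda>x. g x $ i) \<phi> = l2_inner S (\<lambda>x. grad \<Phi> x $ i) \<phi>"
      using g w \<phi> unfolding has_weak_gradient_def by (metis minus_equation_iff)
    thus "(LINT x|lebesgue_on S. (g x $ i - grad \<Phi> x $ i) * \<phi> x) = 0"
      using prod[OF gi] prod[OF pi] by (simp add: l2_inner_def left_diff_distrib)
  qed
  hence "AE x in lebesgue_on S. \<forall>i\<in>UNIV. g x $ i - grad \<Phi> x $ i = 0"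
    by (intro AE_finite_allI) auto
  thus ?thesis by (rule AE_mp) (auto simp: vec_eq_iff)
qed

text \<open>The seminorm is defined through an arbitrarily chosen weak gradient; for a test function it can be
computed with the classical one.\<close>

lemma h1_seminorm_test_function:
  fixes \<Phi> :: "real^2 \<Rightarrow> real"
  assumes S: "open S" "bounded S" and \<Phi>: "\<Phi> \<in> test_functions S"
  shows "h1_seminorm S \<Phi> = sqrt (integral S (\<lambda>x. (norm (grad \<Phi> x))^2))"
proof -
  have Sm: "S \<in> sets lebesgue" using S(1) by auto
  let ?g = "weak_gradient S \<Phi>"
  have g: "has_weak_gradient S \<Phi> ?g"
    unfolding weak_gradient_def by (rule someI[of _ "grad \<Phi>"]) (rule test_function_weak_gradient[OF S \<Phi>])
  have cont: "continuous_on UNIV (\<lambda>x. (norm (grad \<Phi> x))^2)"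
    by (intro continuous_intros test_functionD[OF \<Phi>])
  have [measurable]: "(\<lambda>x. ?g x $ i) \<in> borel_measurable (lebesgue_on S)" for i
    using g by (simp add: has_weak_gradient_def l2_space_def)
  have "(\<lambda>x. norm (?g x) * norm (?g x)) = (\<lambda>x. \<Sum>i\<in>UNIV. ?g x $ i * ?g x $ i)"
    by (simp add: power2_eq_square[symmetric] power2_norm_eq_inner inner_vec_def)
  hence m: "(\<lambda>x. norm (?g x) * norm (?g x)) \<in> borel_measurable (lebesgue_on S)" by simp
  have "l2_inner S (\<lambda>x. norm (?g x)) (\<lambda>x. norm (?g x)) = (LINT x|lebesgue_on S. (norm (grad \<Phi> x))^2)"
    unfolding l2_inner_def
  proof (rule integral_cong_AE[OF m])
    show "(\<lambda>x. (norm (grad \<Phi> x))^2) \<in> borel_measurable (lebesgue_on S)"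
      by (rule continuous_imp_measurable_on_sets_lebesgue[OF continuous_on_subset[OF cont] Sm]) auto
    show "AE x in lebesgue_on S. norm (?g x) * norm (?g x) = (norm (grad \<Phi> x))^2"
      using weak_gradient_test_function[OF S \<Phi> g] by (rule AE_mp) (auto simp: power2_eq_square)
  qed
  thus ?thesis
    using continuous_integral_lebesgue_on(2)[OF cont S(2) Sm] by (simp add: h1_seminorm_def l2_norm_def)
qed

lemma test_function_h10:
  fixes \<Phi> :: "real^2 \<Rightarrow> real"
  assumes S: "open S" "bounded S" and \<Phi>: "\<Phi> \<in> test_functions S"
  shows "\<Phi> \<in> h10_space S"
proof -
  have 0: "(\<lambda>x. 0) \<in> test_functions S"
    by (rule test_functionI[OF smooth_alg.const[of 0], of "{}"]) auto
  have "grad (\<lambda>x. 0) x = (0 :: real^2)" for x by (rule grad_zero_outside) simp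
  hence "h1_seminorm S (\<lambda>x. 0) = 0" using h1_seminorm_test_function[OF S 0] by simp
  hence "h1_norm S (\<lambda>x. \<Phi> x - \<Phi> x) = 0"
    by (simp add: h1_norm_def l2_norm_def l2_inner_def)
  thus ?thesis
    using \<Phi> test_function_weak_gradient[OF S \<Phi>] unfolding h10_space_def h1_space_def
    by (auto simp del: diff_self cancel_comm_monoid_add_class.diff_cancel intro!: bexI[of _ \<Phi>])
qed

section \<open>Polygons and their triangulations\<close>

text \<open>The last inclusion excludes slits: every point of the curve is a limit of points of the outside, so it
is not interior to the closure of the inside. This is where the Jordan curve theorem is needed.\<close>

lemma polygon_topology:
  assumes "polygon K"
  shows "open K" "bounded K" "K \<noteq> {}" "interior (closure K) \<subseteq> K"
proof -
  obtain vs where vs: "simple_path (polygonal_path vs)"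
    "pathfinish (polygonal_path vs) = pathstart (polygonal_path vs)"
    and K: "K = inside (path_image (polygonal_path vs))"
    using assms unfolding polygon_def by blast
  define C where "C = path_image (polygonal_path vs)"
  have comp: "compact C" unfolding C_def using vs(1) by (rule compact_simple_path_image)
  have "C homeomorphic sphere (0::complex) 1"
    unfolding C_def by (rule homeomorphic_simple_path_image_circle[OF vs zero_less_one])
  moreover have "sphere (0::complex) 1 homeomorphic sphere (0::real^2) 1"
    by (rule homeomorphic_spheres_gen) auto
  ultimately have hom: "C homeomorphic sphere (0::real^2) 1" by (rule homeomorphic_trans)
  show "open K" unfolding K by (intro open_inside) (use comp C_def compact_imp_closed in auto)
  show "bounded K" unfolding K by (intro bounded_inside) (use comp C_def compact_imp_bounded in auto)
  have cl: "closed C" and bd: "bounded C" using comp compact_imp_closed compact_imp_bounded by auto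
  have "outside C \<noteq> {}" using unbounded_outside[OF bd] bounded_empty by metis
  hence out: "outside C \<in> components (- C)"
    by (simp add: outside_in_components connected_outside[OF bd])
  have fr: "frontier (outside C) = C"
    by (rule Jordan_Brouwer_frontier[OF hom out]) simp
  show "K \<noteq> {}"
  proof
    assume "K = {}"
    hence "- C = outside C" using union_with_inside[of C] inside_Un_outside[of C] unfolding K C_def by auto
    hence "connected (- C)" using connected_outside[OF bd] by simp
    thus False using Jordan_Brouwer_separation[OF hom zero_less_one] by simp
  qed
  show "interior (closure K) \<subseteq> K"
  proof
    fix x assume x: "x \<in> interior (closure K)"
    show "x \<in> K"
    proof (rule ccontr)
      assume "x \<notin> K"
      have disj: "closure K \<inter> outside C = {}"
      proof -
        have "K \<inter> outside C = {}" unfolding K C_def by (simp add: inside_Int_outside)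
        thus ?thesis using open_Int_closure_eq_empty[OF open_outside[OF cl]] by (simp add: Int_commute)
      qed
      have "x \<in> closure K" using x interior_subset by blast
      moreover have "K \<union> outside C = - C" unfolding K C_def by (rule inside_Un_outside)
      ultimately have "x \<in> C" using disj \<open>x \<notin> K\<close> by blast
      hence "x \<in> closure (outside C)" using fr unfolding frontier_def by auto
      hence "interior (closure K) \<inter> outside C \<noteq> {}"
        using x open_Int_closure_eq_empty[OF open_interior] by blast
      thus False using disj interior_subset by blast
    qed
  qed
qed

lemma polygon_diameter_pos:
  assumes "polygon K" shows "diameter K > 0"
proof -
  obtain x where x: "x \<in> K" using polygon_topology(3)[OF assms] by blast
  obtain r where r: "r > 0" "ball x r \<subseteq> K" using polygon_topology(1)[OF assms] x open_contains_ball by blast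
  define y where "y = x + (r/2) *\<^sub>R axis 1 1"
  have d: "dist x y = r / 2" using r(1) by (simp add: y_def dist_norm)
  hence "y \<in> K" using r by auto
  hence "dist x y \<le> diameter K" using x diameter_bounded_bound[OF polygon_topology(2)[OF assms]] by blast
  thus ?thesis using d r(1) by simp
qed

lemma subtriangulation_facts:
  assumes K: "polygon K" and T: "subtriangulation \<T> K"
  shows "finite \<T>" "\<And>T. T \<in> \<T> \<Longrightarrow> 2 simplex T" "\<And>T. T \<in> \<T> \<Longrightarrow> compact T" "\<And>T. T \<in> \<T> \<Longrightarrow> convex T"
    "\<And>T. T \<in> \<T> \<Longrightarrow> interior T \<subseteq> K"
    "\<And>T T'. T \<in> \<T> \<Longrightarrow> T' \<in> \<T> \<Longrightarrow> T \<noteq> T' \<Longrightarrow> T' \<inter> interior T = {}"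
proof -
  have tri: "triangulation \<T>" and U: "\<Union>\<T> = closure K" and S: "\<And>T. T \<in> \<T> \<Longrightarrow> 2 simplex T"
    using T unfolding subtriangulation_def by blast+
  show "finite \<T>" using tri unfolding triangulation_def by blast
  show S': "\<And>T. T \<in> \<T> \<Longrightarrow> 2 simplex T" by (rule S)
  show comp: "compact T" if "T \<in> \<T>" for T using compact_simplex[OF S[OF that]] .
  show conv: "convex T" if "T \<in> \<T>" for T using convex_simplex[OF S[OF that]] .
  show "interior T \<subseteq> K" if "T \<in> \<T>" for T
  proof -
    have "T \<subseteq> closure K" using that U by blast
    thus ?thesis using interior_mono polygon_topology(4)[OF K] by blast
  qed
  show "T' \<inter> interior T = {}" if "T \<in> \<T>" "T' \<in> \<T>" "T \<noteq> T'" for T T'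
  proof (rule ccontr)
    assume a: "T' \<inter> interior T \<noteq> {}"
    have f: "(T \<inter> T') face_of T" "(T \<inter> T') face_of T'"
      using tri that unfolding triangulation_def by (blast, metis Int_commute)
    have "T \<inter> T' = T"
    proof (rule ccontr)
      assume "T \<inter> T' \<noteq> T"
      from face_of_disjoint_interior[OF f(1) this] a interior_subset show False by blast
    qed
    hence "T face_of T'" "T \<subseteq> T'" using f(2) by auto
    hence "aff_dim T < aff_dim T'"
      using face_of_aff_dim_lt[OF conv[OF that(2)]] that(3) by blast
    thus False using aff_dim_simplex[OF S[OF that(1)]] aff_dim_simplex[OF S[OF that(2)]] by simp
  qed
qed

text \<open>The triangles overlap in null sets, and the part of the closure missing from \<open>K\<close> lies in
their frontiers.\<close>

lemma integral_subtriangulation: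
  fixes f :: "real^2 \<Rightarrow> real"
  assumes K: "polygon K" and T: "subtriangulation \<T> K" and f: "continuous_on UNIV f"
  shows "integral K f = (\<Sum>T\<in>\<T>. integral T f)"
proof -
  note F = subtriangulation_facts[OF K T]
  have U: "\<Union>\<T> = closure K" using T unfolding subtriangulation_def by blast
  have neg: "negligible (T - interior T)" if "T \<in> \<T>" for T
  proof -
    have "T - interior T \<subseteq> frontier T" using closure_subset by (auto simp: frontier_def)
    thus ?thesis using negligible_convex_frontier[OF F(4)[OF that]] negligible_subset by blast
  qed
  have "(f has_integral (\<Sum>T\<in>\<T>. integral T f)) (\<Union>\<T>)"
  proof (rule has_integral_Union[OF F(1)])
    fix T assume "T \<in> \<T>"
    hence "compact T" by (rule F(3))
    thus "(f has_integral integral T f) T"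
      by (intro integrable_integral continuous_integrable_on f)
         (auto simp: compact_imp_bounded lmeasurable_compact fmeasurableD)
  next
    show "pairwise (\<lambda>S S'. negligible (S \<inter> S')) \<T>"
    proof (rule pairwiseI)
      fix S S' assume S: "S \<in> \<T>" "S' \<in> \<T>" "S \<noteq> S'"
      have "S \<inter> S' \<subseteq> S - interior S" using F(6)[OF S] by blast
      thus "negligible (S \<inter> S')" using neg[OF S(1)] negligible_subset by blast
    qed
  qed
  hence 1: "integral (closure K) f = (\<Sum>T\<in>\<T>. integral T f)" using U by (simp add: integral_unique)
  have "closure K - K \<subseteq> (\<Union>T\<in>\<T>. T - interior T)"
  proof
    fix x assume x: "x \<in> closure K - K"
    then obtain T where T: "T \<in> \<T>" "x \<in> T" using U by blast
    thus "x \<in> (\<Union>T\<in>\<T>. T - interior T)" using F(5)[OF T(1)] x by blast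
  qed
  moreover have "negligible (\<Union>T\<in>\<T>. T - interior T)"
    by (intro negligible_Union finite_imageI F(1)) (use neg in auto)
  ultimately have "negligible (closure K - K)" by (rule negligible_subset[rotated])
  hence "integral (closure K) f = integral K f"
    using closure_subset[of K] by (intro integral_spike_set) (auto elim: negligible_subset)
  thus ?thesis using 1 by simp
qed

section \<open>Polynomials on a triangle\<close>

lemma smooth_alg_component: "smooth_alg (\<lambda>x. x $ i)"
  using smooth_alg.inner[of "axis i 1"] by (simp add: inner_axis')

lemma smooth_alg_power: "smooth_alg f \<Longrightarrow> smooth_alg (\<lambda>x. f x ^ k)"
  by (induction k) (auto intro: smooth_alg.const smooth_alg.mult)

lemma poly_space_smooth:
  assumes "P \<in> poly_space p UNIV" shows "smooth_alg P"
proof -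
  obtain a :: "nat \<Rightarrow> nat \<Rightarrow> real" where a: "\<And>x. P x = (\<Sum>i\<le>p. \<Sum>j\<le>p - i. a i j * (x$1)^i * (x$2)^j)"
    using assms unfolding poly_space_def by auto
  have "P = (\<lambda>x. \<Sum>i\<le>p. \<Sum>j\<le>p - i. a i j * (x$1)^i * (x$2)^j)" using a by blast
  thus ?thesis
    by (simp only:) (intro smooth_alg_sum smooth_alg.mult smooth_alg.const smooth_alg_power smooth_alg_component; simp)
qed

lemma poly_space_line:
  assumes "P \<in> poly_space p UNIV"
  obtains r where "degree r \<le> p" "\<And>t. P (B + t *\<^sub>R v) = poly r t"
proof -
  obtain a :: "nat \<Rightarrow> nat \<Rightarrow> real" where a: "\<And>x. P x = (\<Sum>i\<le>p. \<Sum>j\<le>p - i. a i j * (x$1)^i * (x$2)^j)"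
    using assms unfolding poly_space_def by auto
  define r where "r = (\<Sum>i\<le>p. \<Sum>j\<le>p - i. smult (a i j) ([:B$1, v$1:]^i * [:B$2, v$2:]^j))"
  have deg: "degree ([:b, c:] ^ i) \<le> i" for b c :: real and i
    by (rule order.trans[OF degree_power_le]) simp
  have "degree r \<le> p" unfolding r_def
  proof (intro degree_sum_le finite_atMost)
    fix i j assume "i \<in> {..p}" "j \<in> {..p - i}"
    hence ij: "i + j \<le> p" by auto
    have "degree (smult (a i j) ([:B$1, v$1:]^i * [:B$2, v$2:]^j)) \<le> degree ([:B$1, v$1:]^i * [:B$2, v$2:]^j)"
      by (rule degree_smult_le)
    also have "\<dots> \<le> degree ([:B$1, v$1:]^i) + degree ([:B$2, v$2:]^j)" by (rule degree_mult_le)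
    also have "\<dots> \<le> i + j" by (intro add_mono deg)
    finally show "degree (smult (a i j) ([:B$1, v$1:]^i * [:B$2, v$2:]^j)) \<le> p" using ij by simp
  qed
  moreover have "P (B + t *\<^sub>R v) = poly r t" for t
    by (simp add: a r_def poly_sum mult_ac)
  ultimately show thesis by (rule that)
qed

definition parallelogram_integral :: "(real^2 \<Rightarrow> real) \<Rightarrow> real^2 \<Rightarrow> real^2 \<Rightarrow> real^2 \<Rightarrow> real" where
  "parallelogram_integral f A u v = integral {0..1} (\<lambda>s. integral {0..1} (\<lambda>t. f (A + s *\<^sub>R u + t *\<^sub>R v)))"

lemma parallelogram_integral_mono:
  assumes f: "continuous_on UNIV f" and g: "continuous_on UNIV g"
    and le: "\<And>s. integral {0..1} (\<lambda>t. f (A + s *\<^sub>R u + t *\<^sub>R v)) \<le> c * integral {0..1} (\<lambda>t. g (A + s *\<^sub>R u + t *\<^sub>R w))"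
  shows "parallelogram_integral f A u v \<le> c * parallelogram_integral g A u w"
proof -
  have int: "(\<lambda>s. integral {0..1} (\<lambda>t. h (A + s *\<^sub>R u + t *\<^sub>R v))) integrable_on {0..1}"
    if h: "continuous_on UNIV h" for h :: "real^2 \<Rightarrow> real" and v
  proof (rule integrable_continuous_real)
    have "continuous_on ({0..1} \<times> cbox 0 1) (\<lambda>(s::real, t::real). h (A + s *\<^sub>R u + t *\<^sub>R v))"
      unfolding case_prod_unfold by (intro continuous_on_compose2[OF h] continuous_intros) auto
    from integral_continuous_on_param[OF this]
    show "continuous_on {0..1} (\<lambda>s. integral {0..1} (\<lambda>t. h (A + s *\<^sub>R u + t *\<^sub>R v)))" by simp
  qed
  have "parallelogram_integral f A u v \<le> integral {0..1} (\<lambda>s. c * integral {0..1} (\<lambda>t. g (A + s *\<^sub>R u + t *\<^sub>R w)))"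
    unfolding parallelogram_integral_def
    by (intro integral_le int f integrable_on_mult_right g le)
  also have "\<dots> = c * parallelogram_integral g A u w" unfolding parallelogram_integral_def by simp
  finally show ?thesis .
qed

text \<open>On each line in direction \<open>v\<close> the restriction of \<open>P\<close> is a polynomial in one variable, whose square is
bounded by \<open>2 (p + 1)\<^sup>2\<close> times its mean on the first half of the segment.\<close>

lemma strip_parallelogram:
  assumes P: "P \<in> poly_space p UNIV" and D: "cross2 u v \<noteq> 0" and d: "0 < d" "d \<le> 1/2"
  shows "integral (parallelogram A u (d *\<^sub>R v)) (\<lambda>x. (P x)^2) \<le> 2 * d * (real p + 1)^2 * integral (parallelogram A u v) (\<lambda>x. (P x)^2)"
proof -
  have cP: "continuous_on UNIV (\<lambda>x. (P x)^2)"
    by (intro continuous_intros smooth_alg_continuous poly_space_smooth[OF P])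
  have cr: "cross2 u (d *\<^sub>R v) = d * cross2 u v" by (simp add: cross2_def algebra_simps)
  have "parallelogram_integral (\<lambda>x. (P x)^2) A u (d *\<^sub>R v) \<le> (2 * (real p + 1)^2) * parallelogram_integral (\<lambda>x. (P x)^2) A u v"
  proof (rule parallelogram_integral_mono[OF cP cP])
    fix s
    obtain r where r: "degree r \<le> p" "\<And>t. P (A + s *\<^sub>R u + t *\<^sub>R v) = poly r t"
      using poly_space_line[OF P] by metis
    have "integral {0..1} (\<lambda>t. (P (A + s *\<^sub>R u + t *\<^sub>R (d *\<^sub>R v)))^2) = integral {0..1} (\<lambda>t. (poly r (t * d))^2)"
      by (simp add: r(2))
    also have "\<dots> \<le> integral {0..1} (\<lambda>t::real. 2 * (real p + 1)^2 * integral {0..1} (\<lambda>x. (poly r x)^2))"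
    proof (rule integral_le)
      fix t :: real assume t: "t \<in> {0..1}"
      have 1: "0 \<le> t * d" using t d by simp
      have "t * d \<le> 1 * d" using t d by (intro mult_right_mono) auto
      hence 2: "t * d \<le> 1 / 2" using d by linarith
      show "(poly r (t * d))^2 \<le> 2 * (real p + 1)^2 * integral {0..1} (\<lambda>x. (poly r x)^2)"
        by (rule nikolskii_interior[OF r(1) 1 2])
    qed (intro integrable_continuous_real continuous_intros)+
    also have "\<dots> = 2 * (real p + 1)^2 * integral {0..1} (\<lambda>x. (poly r x)^2)" by simp
    finally show "integral {0..1} (\<lambda>t. (P (A + s *\<^sub>R u + t *\<^sub>R (d *\<^sub>R v)))^2)
        \<le> (2 * (real p + 1)^2) * integral {0..1} (\<lambda>t. (P (A + s *\<^sub>R u + t *\<^sub>R v))^2)" by (simp only: r(2))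
  qed
  hence "(d * \<bar>cross2 u v\<bar>) * parallelogram_integral (\<lambda>x. (P x)^2) A u (d *\<^sub>R v)
      \<le> (d * \<bar>cross2 u v\<bar>) * ((2 * (real p + 1)^2) * parallelogram_integral (\<lambda>x. (P x)^2) A u v)"
    using d by (intro mult_left_mono) auto
  thus ?thesis
    using integral_parallelogram[OF cP, of u "d *\<^sub>R v" A] integral_parallelogram[OF cP D, of A] D d
    by (simp add: cr abs_mult parallelogram_integral_def mult_ac)
qed

lemma markov_parallelogram:
  assumes P: "P \<in> poly_space p UNIV" and D: "cross2 u v \<noteq> 0"
  shows "integral (parallelogram A u v) (\<lambda>x. (grad P x \<bullet> v)^2) \<le> 4 * (real p + 1)^4 * integral (parallelogram A u v) (\<lambda>x. (P x)^2)"
proof -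
  note sm = poly_space_smooth[OF P]
  have cP: "continuous_on UNIV (\<lambda>x. (P x)^2)" by (intro continuous_intros smooth_alg_continuous sm)
  have cG: "continuous_on UNIV (\<lambda>x. (grad P x \<bullet> v)^2)"
    by (intro continuous_intros smooth_alg_continuous_grad sm)
  have diff: "P differentiable (at x)" for x using smooth_alg_grad(1)[OF sm] by (auto simp: differentiable_def)
  have "parallelogram_integral (\<lambda>x. (grad P x \<bullet> v)^2) A u v \<le> (4 * (real p + 1)^4) * parallelogram_integral (\<lambda>x. (P x)^2) A u v"
  proof (rule parallelogram_integral_mono[OF cG cP])
    fix s
    obtain r where r: "degree r \<le> p" "\<And>t. P (A + s *\<^sub>R u + t *\<^sub>R v) = poly r t"
      using poly_space_line[OF P] by metis
    have "grad P (A + s *\<^sub>R u + t *\<^sub>R v) \<bullet> v = poly (pderiv r) t" for t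
      using deriv_along_line[OF diff, of "A + s *\<^sub>R u" v t] poly_DERIV[of r t] DERIV_unique
      unfolding r(2) by blast
    thus "integral {0..1} (\<lambda>t. (grad P (A + s *\<^sub>R u + t *\<^sub>R v) \<bullet> v)^2)
        \<le> (4 * (real p + 1)^4) * integral {0..1} (\<lambda>t. (P (A + s *\<^sub>R u + t *\<^sub>R v))^2)"
      using markov_L2[OF r(1)] by (simp only: r(2))
  qed
  hence "\<bar>cross2 u v\<bar> * parallelogram_integral (\<lambda>x. (grad P x \<bullet> v)^2) A u v
      \<le> \<bar>cross2 u v\<bar> * ((4 * (real p + 1)^4) * parallelogram_integral (\<lambda>x. (P x)^2) A u v)"
    by (intro mult_left_mono) auto
  thus ?thesis
    using integral_parallelogram[OF cG D, of A] integral_parallelogram[OF cP D, of A]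
    by (simp add: parallelogram_integral_def mult_ac)
qed

lemma parallelogram_swap: "parallelogram A u v = parallelogram A v u"
proof -
  have "parallelogram A u v \<subseteq> parallelogram A v u" for u v
  proof
    fix x assume "x \<in> parallelogram A u v"
    then obtain s t where "x = A + s *\<^sub>R u + t *\<^sub>R v" "s \<in> {0..1}" "t \<in> {0..1}" by (auto simp: parallelogram_def)
    thus "x \<in> parallelogram A v u" unfolding parallelogram_def by (intro CollectI exI[of _ t] exI[of _ s]) (simp add: algebra_simps)
  qed
  thus ?thesis by blast
qed

lemma cross2_swap: "cross2 v u = - cross2 u v"
  by (simp add: cross2_def)

text \<open>The barycentric coordinate that belongs to the vertex \<open>A\<close>, as a quotient of signed areas; \<open>bary_normal\<close>
is its constant gradient.\<close>

definition bary :: "real^2 \<Rightarrow> real^2 \<Rightarrow> real^2 \<Rightarrow> real^2 \<Rightarrow> real" where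
  "bary A B C x = cross2 (B - x) (C - x) / cross2 (B - A) (C - A)"

definition bary_normal :: "real^2 \<Rightarrow> real^2 \<Rightarrow> real^2 \<Rightarrow> real^2" where
  "bary_normal A B C = (1 / cross2 (B - A) (C - A)) *\<^sub>R vector [B$2 - C$2, C$1 - B$1]"

lemma inner_real2: "(x::real^2) \<bullet> y = x$1 * y$1 + x$2 * y$2"
  by (simp add: inner_vec_def UNIV_2)

lemma bary_affine: "bary A B C x = bary_normal A B C \<bullet> x + bary A B C 0"
proof -
  have "cross2 (B - x) (C - x) = (B$2 - C$2) * x$1 + (C$1 - B$1) * x$2 + cross2 B C"
    by (simp add: cross2_def algebra_simps)
  thus ?thesis by (simp add: bary_def bary_normal_def inner_real2 add_divide_distrib)
qed

lemma bary_swap: "bary A C B = bary A B C"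
  by (rule ext) (simp add: bary_def cross2_swap[of "C - _"])

lemma bary_point:
  assumes D: "cross2 (B - A) (C - A) \<noteq> 0" and x: "x = A + s *\<^sub>R (B - A) + t *\<^sub>R (C - A)"
  shows "bary A B C x = 1 - s - t" "bary B A C x = s" "bary C A B x = t"
proof -
  have "cross2 (B - x) (C - x) = (1 - s - t) * cross2 (B - A) (C - A)"
    "cross2 (A - x) (C - x) = s * cross2 (A - B) (C - B)"
    "cross2 (A - x) (B - x) = t * cross2 (A - C) (B - C)"
    by (simp_all add: x cross2_def algebra_simps)
  moreover have "cross2 (A - B) (C - B) = - cross2 (B - A) (C - A)"
    "cross2 (A - C) (B - C) = cross2 (B - A) (C - A)" by (simp_all add: cross2_def algebra_simps)
  ultimately show "bary A B C x = 1 - s - t" "bary B A C x = s" "bary C A B x = t"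
    using D by (simp_all add: bary_def)
qed

lemma bary_expand:
  assumes D: "cross2 (B - A) (C - A) \<noteq> 0"
  shows "x = A + bary B A C x *\<^sub>R (B - A) + bary C A B x *\<^sub>R (C - A)"
proof -
  let ?D = "cross2 (B - A) (C - A)"
  have 1: "cross2 (A - B) (C - B) = - ?D" "cross2 (A - C) (B - C) = ?D" by (simp_all add: cross2_def algebra_simps)
  have "?D * (x - A)$k = - cross2 (A - x) (C - x) * (B - A)$k + cross2 (A - x) (B - x) * (C - A)$k" for k
    using exhaust_2[of k] by (auto simp: cross2_def algebra_simps)
  hence "(x - A)$k = (- cross2 (A - x) (C - x) * (B - A)$k + cross2 (A - x) (B - x) * (C - A)$k) / ?D" for k
    using D by (metis nonzero_mult_div_cancel_left)
  hence "(x - A)$k = (- cross2 (A - x) (C - x) / ?D) * (B - A)$k + (cross2 (A - x) (B - x) / ?D) * (C - A)$k" for k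
    by (simp add: add_divide_distrib diff_divide_distrib)
  hence "x - A = (- cross2 (A - x) (C - x) / ?D) *\<^sub>R (B - A) + (cross2 (A - x) (B - x) / ?D) *\<^sub>R (C - A)"
    by (simp add: vec_eq_iff)
  thus ?thesis by (simp add: bary_def 1 algebra_simps)
qed

lemma bary_sum:
  assumes D: "cross2 (B - A) (C - A) \<noteq> 0"
  shows "bary A B C x + bary B A C x + bary C A B x = 1"
  using bary_point(1)[OF D bary_expand[OF D]] by simp

lemma triangle_bary:
  assumes D: "cross2 (B - A) (C - A) \<noteq> 0"
  shows "x \<in> convex hull {A, B, C} \<longleftrightarrow> 0 \<le> bary A B C x \<and> 0 \<le> bary B A C x \<and> 0 \<le> bary C A B x"
proof
  assume "x \<in> convex hull {A, B, C}"
  then obtain s t where st: "x = A + s *\<^sub>R (B - A) + t *\<^sub>R (C - A)" "0 \<le> s" "0 \<le> t" "s + t \<le> 1"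
    unfolding convex_hull_3_alt by blast
  thus "0 \<le> bary A B C x \<and> 0 \<le> bary B A C x \<and> 0 \<le> bary C A B x"
    using bary_point[OF D st(1)] by simp
next
  assume "0 \<le> bary A B C x \<and> 0 \<le> bary B A C x \<and> 0 \<le> bary C A B x"
  thus "x \<in> convex hull {A, B, C}"
    unfolding convex_hull_3_alt using bary_expand[OF D, of x] bary_sum[OF D, of x]
    by (intro CollectI exI conjI) auto
qed

lemma parallelogram_mem:
  assumes D: "cross2 (B - A) (C - A) \<noteq> 0"
    and "a > 0" "b > 0" "0 \<le> bary B A C x" "bary B A C x \<le> a" "0 \<le> bary C A B x" "bary C A B x \<le> b"
  shows "x \<in> parallelogram A (a *\<^sub>R (B - A)) (b *\<^sub>R (C - A))"
  unfolding parallelogram_def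
proof (intro CollectI exI conjI)
  show "x = A + (bary B A C x / a) *\<^sub>R (a *\<^sub>R (B - A)) + (bary C A B x / b) *\<^sub>R (b *\<^sub>R (C - A))"
    using bary_expand[OF D, of x] assms by simp
qed (use assms in \<open>auto simp: field_simps\<close>)

lemma parallelogram_subset_triangle:
  assumes "0 \<le> a" "0 \<le> b" "a + b \<le> 1"
  shows "parallelogram A (a *\<^sub>R (B - A)) (b *\<^sub>R (C - A)) \<subseteq> convex hull {A, B, C}"
proof
  fix x assume "x \<in> parallelogram A (a *\<^sub>R (B - A)) (b *\<^sub>R (C - A))"
  then obtain s t where st: "x = A + s *\<^sub>R (a *\<^sub>R (B - A)) + t *\<^sub>R (b *\<^sub>R (C - A))" "s \<in> {0..1}" "t \<in> {0..1}"
    by (auto simp: parallelogram_def)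
  have "s * a \<le> 1 * a" "t * b \<le> 1 * b" using st assms by (intro mult_right_mono; simp)+
  hence "s * a + t * b \<le> 1" using assms by simp
  thus "x \<in> convex hull {A, B, C}"
    unfolding convex_hull_3_alt using st assms
    by (intro CollectI exI[of _ "s * a"] exI[of _ "t * b"]) auto
qed

text \<open>Two situations are covered at once: \<open>g = f\<close> on a set that is covered completely, and a \<open>g\<close> that is positive
only on a covered part.\<close>

lemma integral_cover_le:
  fixes f g :: "'a::euclidean_space \<Rightarrow> real"
  assumes f: "continuous_on UNIV f" and g: "continuous_on UNIV g"
    and S: "compact S" and I: "finite I" and C: "\<And>i. i \<in> I \<Longrightarrow> compact (C i)"
    and nonneg: "\<And>x. 0 \<le> f x"
    and le: "\<And>x. x \<in> S \<Longrightarrow> g x \<le> 0 \<or> g x \<le> f x \<and> (\<exists>i\<in>I. x \<in> C i)"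
  shows "integral S g \<le> (\<Sum>i\<in>I. integral (C i) f)"
proof -
  have int: "h integrable_on S" if "compact S" "continuous_on UNIV h" for h :: "'a \<Rightarrow> real" and S
    using that by (intro continuous_integrable_on) (auto simp: compact_imp_bounded lmeasurable_compact fmeasurableD)
  have "integral S g = integral UNIV (\<lambda>x. if x \<in> S then g x else 0)"
    by (simp add: integral_restrict_UNIV)
  also have "\<dots> \<le> integral UNIV (\<lambda>x. \<Sum>i\<in>I. if x \<in> C i then f x else 0)"
  proof (rule integral_le)
    show "(\<lambda>x. if x \<in> S then g x else 0) integrable_on UNIV"
      using int[OF S g] by (simp add: integrable_restrict_UNIV)
    show "(\<lambda>x. \<Sum>i\<in>I. if x \<in> C i then f x else 0) integrable_on UNIV"
      using int[OF C f] I by (intro integrable_sum) (auto simp: integrable_restrict_UNIV)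
    fix x
    have nn: "0 \<le> (\<Sum>i\<in>I. if x \<in> C i then f x else 0)" using nonneg by (intro sum_nonneg) auto
    show "(if x \<in> S then g x else 0) \<le> (\<Sum>i\<in>I. if x \<in> C i then f x else 0)"
    proof (cases "x \<in> S \<and> \<not> g x \<le> 0")
      case True
      then obtain i where i: "g x \<le> f x" "i \<in> I" "x \<in> C i" using le by blast
      have "(if x \<in> C i then f x else 0) \<le> (\<Sum>i\<in>I. if x \<in> C i then f x else 0)"
        using nonneg I i by (intro member_le_sum) auto
      thus ?thesis using True i by simp
    qed (use nn in auto)
  qed
  also have "\<dots> = (\<Sum>i\<in>I. integral UNIV (\<lambda>x. if x \<in> C i then f x else 0))"
    using int[OF C f] I by (intro integral_sum) (auto simp: integrable_restrict_UNIV)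
  also have "\<dots> = (\<Sum>i\<in>I. integral (C i) f)" by (simp add: integral_restrict_UNIV)
  finally show ?thesis .
qed

lemma compact_triangle: "compact (convex hull {A, B, C :: real^2})"
  by (intro compact_convex_hull finite_imp_compact) auto

lemma integral_mono_compact:
  fixes f :: "'a::euclidean_space \<Rightarrow> real"
  assumes "continuous_on UNIV f" "compact S" "compact T" "S \<subseteq> T" "\<And>x. 0 \<le> f x"
  shows "integral S f \<le> integral T f"
  using assms
  by (intro integral_subset_le continuous_integrable_on)
     (auto simp: compact_imp_bounded lmeasurable_compact fmeasurableD)

lemma integrable_compact:
  fixes f :: "'a::euclidean_space \<Rightarrow> real"
  assumes "continuous_on UNIV f" "compact S"
  shows "f integrable_on S"
  using assms
  by (intro continuous_integrable_on) (auto simp: compact_imp_bounded lmeasurable_compact fmeasurableD)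

lemma strip_triangle:
  assumes P: "P \<in> poly_space p UNIV" and D: "cross2 (B - A) (C - A) \<noteq> 0" and e: "0 < e" "e \<le> 1/4"
  shows "integral (parallelogram A ((1/2) *\<^sub>R (B - A)) (e *\<^sub>R (C - A))) (\<lambda>x. (P x)^2)
    \<le> 4 * e * (real p + 1)^2 * integral (convex hull {A, B, C}) (\<lambda>x. (P x)^2)"
proof -
  have cP: "continuous_on UNIV (\<lambda>x. (P x)^2)"
    by (intro continuous_intros smooth_alg_continuous poly_space_smooth[OF P])
  have D': "cross2 ((1/2) *\<^sub>R (B - A)) ((1/2) *\<^sub>R (C - A)) \<noteq> 0"
    using D by (simp add: cross2_def algebra_simps)
  have "integral (parallelogram A ((1/2) *\<^sub>R (B - A)) ((2 * e) *\<^sub>R ((1/2) *\<^sub>R (C - A)))) (\<lambda>x. (P x)^2)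
    \<le> 2 * (2 * e) * (real p + 1)^2 * integral (parallelogram A ((1/2) *\<^sub>R (B - A)) ((1/2) *\<^sub>R (C - A))) (\<lambda>x. (P x)^2)"
    using e by (intro strip_parallelogram P D') auto
  also have "\<dots> \<le> 2 * (2 * e) * (real p + 1)^2 * integral (convex hull {A, B, C}) (\<lambda>x. (P x)^2)"
    using e by (intro mult_left_mono integral_mono_compact cP compact_parallelogram compact_triangle parallelogram_subset_triangle) auto
  finally show ?thesis by simp
qed

text \<open>The gradients of two barycentric coordinates form the basis dual to the two edges.\<close>

lemma dual_basis_expand:
  assumes D: "cross2 (B - A) (C - A) \<noteq> 0"
  shows "g = (g \<bullet> (B - A)) *\<^sub>R bary_normal B C A + (g \<bullet> (C - A)) *\<^sub>R bary_normal C A B"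
proof -
  let ?D = "cross2 (B - A) (C - A)"
  have 1: "cross2 (C - B) (A - B) = ?D" "cross2 (A - C) (B - C) = ?D" by (simp_all add: cross2_def algebra_simps)
  have "?D * g$1 = (g \<bullet> (B - A)) * (C$2 - A$2) + (g \<bullet> (C - A)) * (A$2 - B$2)"
    "?D * g$2 = (g \<bullet> (B - A)) * (A$1 - C$1) + (g \<bullet> (C - A)) * (B$1 - A$1)"
    by (simp_all add: cross2_def inner_real2 algebra_simps)
  hence "g$1 = ((g \<bullet> (B - A)) * (C$2 - A$2) + (g \<bullet> (C - A)) * (A$2 - B$2)) / ?D"
    "g$2 = ((g \<bullet> (B - A)) * (A$1 - C$1) + (g \<bullet> (C - A)) * (B$1 - A$1)) / ?D"
    using D by (metis nonzero_mult_div_cancel_left)+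
  thus ?thesis
    by (simp add: vec_eq_iff forall_2 bary_normal_def 1 add_divide_distrib)
qed

lemma vertex_gradient:
  assumes P: "P \<in> poly_space p UNIV" and D: "cross2 (B - A) (C - A) \<noteq> 0"
    and N: "norm (bary_normal B C A) \<le> N" "norm (bary_normal C A B) \<le> N"
  shows "integral (parallelogram A ((1/2) *\<^sub>R (B - A)) ((1/2) *\<^sub>R (C - A))) (\<lambda>x. (norm (grad P x))^2)
    \<le> 64 * N^2 * (real p + 1)^4 * integral (convex hull {A, B, C}) (\<lambda>x. (P x)^2)"
proof -
  define u v where "u = (1/2) *\<^sub>R (B - A)" and "v = (1/2) *\<^sub>R (C - A)"
  let ?S = "parallelogram A u v"
  note sm = poly_space_smooth[OF P]
  have cP: "continuous_on UNIV (\<lambda>x. (P x)^2)" by (intro continuous_intros smooth_alg_continuous sm)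
  have cG: "continuous_on UNIV (\<lambda>x. (grad P x \<bullet> w)^2)" for w
    by (intro continuous_intros smooth_alg_continuous_grad sm)
  have cN: "continuous_on UNIV (\<lambda>x. (norm (grad P x))^2)"
    by (intro continuous_intros smooth_alg_continuous_grad sm)
  have D': "cross2 u v \<noteq> 0" using D by (simp add: u_def v_def cross2_def algebra_simps)
  hence D'': "cross2 v u \<noteq> 0" by (simp add: cross2_swap[of v])
  have N0: "0 \<le> N" using N(1) norm_ge_zero order.trans by blast
  have pt: "(norm g)^2 \<le> 8 * N^2 * ((g \<bullet> u)^2 + (g \<bullet> v)^2)" for g
  proof -
    define a b where "a = g \<bullet> u" and "b = g \<bullet> v"
    have ab: "g \<bullet> (B - A) = 2 * a" "g \<bullet> (C - A) = 2 * b" by (simp_all add: a_def b_def u_def v_def)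
    have "norm g = norm ((2 * a) *\<^sub>R bary_normal B C A + (2 * b) *\<^sub>R bary_normal C A B)"
      using dual_basis_expand[OF D, of g] unfolding ab by simp
    also have "\<dots> \<le> \<bar>2 * a\<bar> * norm (bary_normal B C A) + \<bar>2 * b\<bar> * norm (bary_normal C A B)"
      by (rule order.trans[OF norm_triangle_ineq]) simp
    also have "\<dots> \<le> \<bar>2 * a\<bar> * N + \<bar>2 * b\<bar> * N" by (intro add_mono mult_left_mono N) auto
    finally have "norm g \<le> 2 * N * (\<bar>a\<bar> + \<bar>b\<bar>)" by (simp add: algebra_simps)
    hence "(norm g)^2 \<le> (2 * N * (\<bar>a\<bar> + \<bar>b\<bar>))^2" by (intro power_mono) auto
    also have "\<dots> = 4 * N^2 * (\<bar>a\<bar> + \<bar>b\<bar>)^2" by (simp add: power_mult_distrib)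
    also have "\<dots> \<le> 4 * N^2 * (2 * (a^2 + b^2))"
    proof (rule mult_left_mono)
      have "0 \<le> (\<bar>a\<bar> - \<bar>b\<bar>)^2" by simp
      thus "(\<bar>a\<bar> + \<bar>b\<bar>)^2 \<le> 2 * (a^2 + b^2)" by (simp add: power2_diff power2_sum)
    qed simp
    also have "\<dots> = 8 * N^2 * (a^2 + b^2)" by (simp add: algebra_simps)
    finally show ?thesis by (simp only: a_def b_def)
  qed
  have "integral ?S (\<lambda>x. (norm (grad P x))^2) \<le> integral ?S (\<lambda>x. 8 * N^2 * ((grad P x \<bullet> u)^2 + (grad P x \<bullet> v)^2))"
    by (intro integral_le integrable_compact continuous_intros cG cN compact_parallelogram pt)
  also have "\<dots> = 8 * N^2 * (integral ?S (\<lambda>x. (grad P x \<bullet> u)^2) + integral ?S (\<lambda>x. (grad P x \<bullet> v)^2))"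
    by (simp add: integral_add integrable_compact[OF cG compact_parallelogram])
  also have "\<dots> \<le> 8 * N^2 * (4 * (real p + 1)^4 * integral ?S (\<lambda>x. (P x)^2) + 4 * (real p + 1)^4 * integral ?S (\<lambda>x. (P x)^2))"
    using markov_parallelogram[OF P D'', of A] by (intro mult_left_mono add_mono markov_parallelogram P D') (simp_all add: parallelogram_swap[of A v])
  also have "\<dots> = (64 * N^2 * (real p + 1)^4) * integral ?S (\<lambda>x. (P x)^2)" by (simp add: algebra_simps)
  also have "\<dots> \<le> (64 * N^2 * (real p + 1)^4) * integral (convex hull {A, B, C}) (\<lambda>x. (P x)^2)"
    unfolding u_def v_def
    by (intro mult_left_mono integral_mono_compact cP compact_parallelogram compact_triangle parallelogram_subset_triangle) auto
  finally show ?thesis by (simp add: u_def v_def)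
qed

text \<open>At most one barycentric coordinate exceeds one half, so the three parallelograms at the vertices cover
the triangle.\<close>

lemma triangle_gradient:
  assumes P: "P \<in> poly_space p UNIV" and D: "cross2 (B - A) (C - A) \<noteq> 0"
    and N: "norm (bary_normal A B C) \<le> N" "norm (bary_normal B C A) \<le> N" "norm (bary_normal C A B) \<le> N"
  shows "integral (convex hull {A, B, C}) (\<lambda>x. (norm (grad P x))^2)
    \<le> 192 * N^2 * (real p + 1)^4 * integral (convex hull {A, B, C}) (\<lambda>x. (P x)^2)"
proof -
  let ?parallelogram = "\<lambda>A B C. parallelogram A ((1/2) *\<^sub>R (B - A)) ((1/2) *\<^sub>R (C - A))"
  let ?T = "convex hull {A, B, C}"
  have D2: "cross2 (C - B) (A - B) \<noteq> 0" "cross2 (A - C) (B - C) \<noteq> 0"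
    using D by (simp_all add: cross2_def algebra_simps)
  have T: "convex hull {B, C, A} = ?T" "convex hull {C, A, B} = ?T" by (simp_all add: insert_commute)
  have cN: "continuous_on UNIV (\<lambda>x. (norm (grad P x))^2)"
    by (intro continuous_intros smooth_alg_continuous_grad poly_space_smooth[OF P])
  have "integral ?T (\<lambda>x. (norm (grad P x))^2)
    \<le> (\<Sum>i\<in>{0, 1, 2::nat}. integral ([?parallelogram A B C, ?parallelogram B C A, ?parallelogram C A B] ! i) (\<lambda>x. (norm (grad P x))^2))"
  proof (rule integral_cover_le[OF cN cN compact_triangle])
    fix x assume x: "x \<in> ?T"
    have b: "0 \<le> bary A B C x" "0 \<le> bary B C A x" "0 \<le> bary C A B x"
      using x triangle_bary[OF D, of x] by (auto simp: bary_swap[of B])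
    have s: "bary A B C x + bary B C A x + bary C A B x = 1"
      using bary_sum[OF D, of x] by (simp add: bary_swap[of B])
    have "x \<in> ?parallelogram A B C" if "bary B C A x \<le> 1/2" "bary C A B x \<le> 1/2"
      using that b by (intro parallelogram_mem D) (simp_all add: bary_swap[of B])
    moreover have "x \<in> ?parallelogram B C A" if "bary C A B x \<le> 1/2" "bary A B C x \<le> 1/2"
      using that b by (intro parallelogram_mem D2) (simp_all add: bary_swap[of C B])
    moreover have "x \<in> ?parallelogram C A B" if "bary A B C x \<le> 1/2" "bary B C A x \<le> 1/2"
      using that b by (intro parallelogram_mem D2) (simp_all add: bary_swap[of A C])
    moreover have "bary B C A x \<le> 1/2 \<and> bary C A B x \<le> 1/2 \<or> bary C A B x \<le> 1/2 \<and> bary A B C x \<le> 1/2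
        \<or> bary A B C x \<le> 1/2 \<and> bary B C A x \<le> 1/2"
      using b s by argo
    ultimately show "(norm (grad P x))^2 \<le> 0 \<or> (norm (grad P x))^2 \<le> (norm (grad P x))^2 \<and>
        (\<exists>i\<in>{0, 1, 2::nat}. x \<in> [?parallelogram A B C, ?parallelogram B C A, ?parallelogram C A B] ! i)"
      by auto
  qed (auto simp: compact_parallelogram)
  also have "\<dots> = integral (?parallelogram A B C) (\<lambda>x. (norm (grad P x))^2)
      + integral (?parallelogram B C A) (\<lambda>x. (norm (grad P x))^2) + integral (?parallelogram C A B) (\<lambda>x. (norm (grad P x))^2)"
    by simp
  also have "\<dots> \<le> 192 * N^2 * (real p + 1)^4 * integral ?T (\<lambda>x. (P x)^2)"
    using vertex_gradient[OF P D N(2,3)] vertex_gradient[OF P D2(1) N(3,1)] vertex_gradient[OF P D2(2) N(1,2)]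
    unfolding T by linarith
  finally show ?thesis .
qed

text \<open>Six strips cover the boundary layer: each edge contributes one half-length strip at either of its end
points. Each strip lies along a side of one of the parallelograms at the vertices.\<close>

lemma triangle_boundary_layer:
  assumes P: "P \<in> poly_space p UNIV" and D: "cross2 (B - A) (C - A) \<noteq> 0" and e: "0 < e" "e \<le> 1/4"
    and g: "continuous_on UNIV g" "\<And>x. g x \<le> (P x)^2"
      "\<And>x. e \<le> bary A B C x \<Longrightarrow> e \<le> bary B C A x \<Longrightarrow> e \<le> bary C A B x \<Longrightarrow> g x \<le> 0"
  shows "integral (convex hull {A, B, C}) g \<le> 24 * e * (real p + 1)^2 * integral (convex hull {A, B, C}) (\<lambda>x. (P x)^2)"
proof -
  let ?s = "\<lambda>A B C. parallelogram A ((1/2) *\<^sub>R (B - A)) (e *\<^sub>R (C - A))"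
  let ?T = "convex hull {A, B, C}"
  let ?L = "[?s A B C, ?s A C B, ?s B C A, ?s B A C, ?s C A B, ?s C B A]"
  have D2: "cross2 (C - B) (A - B) \<noteq> 0" "cross2 (A - C) (B - C) \<noteq> 0" "cross2 (C - A) (B - A) \<noteq> 0"
    "cross2 (A - B) (C - B) \<noteq> 0" "cross2 (B - C) (A - C) \<noteq> 0"
    using D by (simp_all add: cross2_def algebra_simps)
  have T: "convex hull {A, C, B} = ?T" "convex hull {B, C, A} = ?T" "convex hull {B, A, C} = ?T"
    "convex hull {C, A, B} = ?T" "convex hull {C, B, A} = ?T" by (simp_all add: insert_commute)
  have cP: "continuous_on UNIV (\<lambda>x. (P x)^2)"
    by (intro continuous_intros smooth_alg_continuous poly_space_smooth[OF P])
  have "integral ?T g \<le> (\<Sum>i\<in>{0, 1, 2, 3, 4, 5::nat}. integral (?L ! i) (\<lambda>x. (P x)^2))"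
  proof (rule integral_cover_le[OF cP g(1) compact_triangle])
    fix x assume x: "x \<in> ?T"
    have b: "0 \<le> bary A B C x" "0 \<le> bary B C A x" "0 \<le> bary C A B x"
      using x triangle_bary[OF D, of x] by (auto simp: bary_swap[of B])
    have s: "bary A B C x + bary B C A x + bary C A B x = 1"
      using bary_sum[OF D, of x] by (simp add: bary_swap[of B])
    have sw: "bary A C B = bary A B C" "bary B A C = bary B C A" "bary C B A = bary C A B"
      by (rule bary_swap)+
    note pm = parallelogram_mem[where a = "1/2" and b = e and x = x]
    have c1: "x \<in> ?s A B C" if "bary B C A x \<le> 1/2" "bary C A B x \<le> e"
      using that b e by (intro pm D) (simp_all add: sw)
    have c2: "x \<in> ?s A C B" if "bary C A B x \<le> 1/2" "bary B C A x \<le> e"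
      using that b e by (intro pm D2) (simp_all add: sw)
    have c3: "x \<in> ?s B C A" if "bary C A B x \<le> 1/2" "bary A B C x \<le> e"
      using that b e by (intro pm D2) (simp_all add: sw)
    have c4: "x \<in> ?s B A C" if "bary A B C x \<le> 1/2" "bary C A B x \<le> e"
      using that b e by (intro pm D2) (simp_all add: sw)
    have c5: "x \<in> ?s C A B" if "bary A B C x \<le> 1/2" "bary B C A x \<le> e"
      using that b e by (intro pm D2) (simp_all add: sw)
    have c6: "x \<in> ?s C B A" if "bary B C A x \<le> 1/2" "bary A B C x \<le> e"
      using that b e by (intro pm D2) (simp_all add: sw)
    have "g x \<le> 0 \<or> bary A B C x \<le> e \<or> bary B C A x \<le> e \<or> bary C A B x \<le> e"
      using g(3)[of x] by linarith
    moreover have "bary A B C x \<le> 1/2 \<or> bary B C A x \<le> 1/2" "bary B C A x \<le> 1/2 \<or> bary C A B x \<le> 1/2"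
      "bary A B C x \<le> 1/2 \<or> bary C A B x \<le> 1/2" using b s by argo+
    ultimately show "g x \<le> 0 \<or> g x \<le> (P x)^2 \<and> (\<exists>i\<in>{0, 1, 2, 3, 4, 5::nat}. x \<in> ?L ! i)"
      using c1 c2 c3 c4 c5 c6 g(2)[of x] by auto
  qed (auto simp: compact_parallelogram)
  also have "\<dots> = integral (?s A B C) (\<lambda>x. (P x)^2) + integral (?s A C B) (\<lambda>x. (P x)^2)
     + integral (?s B C A) (\<lambda>x. (P x)^2) + integral (?s B A C) (\<lambda>x. (P x)^2)
     + integral (?s C A B) (\<lambda>x. (P x)^2) + integral (?s C B A) (\<lambda>x. (P x)^2)"
    by simp
  also have "\<dots> \<le> 24 * e * (real p + 1)^2 * integral ?T (\<lambda>x. (P x)^2)"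
    using strip_triangle[OF P D e] strip_triangle[OF P D2(3) e] strip_triangle[OF P D2(1) e]
      strip_triangle[OF P D2(4) e] strip_triangle[OF P D2(2) e] strip_triangle[OF P D2(5) e]
    unfolding T by linarith
  finally show ?thesis .
qed

section \<open>The test function and the inverse estimate\<close>

lemma grad_smooth_step:
  fixes n :: "real^'n::finite"
  assumes "\<And>t. (smooth_step has_real_derivative S' t) (at t)"
  shows "grad (\<lambda>x. smooth_step (n \<bullet> x + b)) x = S' (n \<bullet> x + b) *\<^sub>R n"
proof (rule grad_unique)
  have 1: "((\<lambda>x. n \<bullet> x + b) has_derivative (\<lambda>h. n \<bullet> h)) (at x)" by (auto intro!: derivative_eq_intros)
  show "((\<lambda>x. smooth_step (n \<bullet> x + b)) has_derivative (\<lambda>h. (S' (n \<bullet> x + b) *\<^sub>R n) \<bullet> h)) (at x)"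
    using has_derivative_compose[OF 1 assms[unfolded has_field_derivative_def]] by simp
qed

lemma smooth_alg_differentiable: "smooth_alg f \<Longrightarrow> f differentiable (at x)"
  using smooth_alg_grad(1) by (auto simp: differentiable_def)

lemma norm_unit_scale:
  fixes a :: "'a::real_normed_vector"
  assumes "0 \<le> s" "s \<le> 1" shows "norm (s *\<^sub>R a) \<le> norm a"
  using assms mult_right_mono[of s 1 "norm a"] by simp

text \<open>The product of three smooth steps in the barycentric coordinates; each step rises from 0 at \<open>e / 2\<close>
to 1 at \<open>e\<close>.\<close>

lemma triangle_cutoff:
  obtains M :: real where "M > 0"
    "\<And>A B C N e. cross2 (B - A) (C - A) \<noteq> 0 \<Longrightarrow> 0 < e \<Longrightarrow>
      norm (bary_normal A B C) \<le> N \<Longrightarrow> norm (bary_normal B C A) \<le> N \<Longrightarrow> norm (bary_normal C A B) \<le> N \<Longrightarrow>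
      \<exists>\<eta>. smooth_alg \<eta> \<and> (\<forall>x. 0 \<le> \<eta> x \<and> \<eta> x \<le> 1) \<and>
        (\<exists>S. compact S \<and> {x. \<eta> x \<noteq> 0} \<subseteq> S \<and> S \<subseteq> interior (convex hull {A, B, C})) \<and>
        (\<forall>x. e \<le> bary A B C x \<longrightarrow> e \<le> bary B C A x \<longrightarrow> e \<le> bary C A B x \<longrightarrow> \<eta> x = 1) \<and>
        (\<forall>x. norm (grad \<eta> x) \<le> M * N / e)"
proof -
  obtain S' M where M: "M > 0" "\<And>t. (smooth_step has_real_derivative S' t) (at t)" "\<And>t. \<bar>S' t\<bar> \<le> M"
    using smooth_step_deriv_bound by metis
  show thesis
  proof (rule that[of "6 * M"])
    show "6 * M > 0" using M by simp
  next
    fix A B C :: "real^2" and N e :: real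
    assume D: "cross2 (B - A) (C - A) \<noteq> 0" and e: "0 < e" and
      N: "norm (bary_normal A B C) \<le> N" "norm (bary_normal B C A) \<le> N" "norm (bary_normal C A B) \<le> N"
    let ?T = "convex hull {A, B, C}"
    define r where "r X Y Z x = smooth_step (((2 / e) *\<^sub>R bary_normal X Y Z) \<bullet> x + (2 / e * bary X Y Z 0 - 1))" for X Y Z x
    have r_eq: "r X Y Z x = smooth_step (2 / e * bary X Y Z x - 1)" for X Y Z x
      unfolding r_def bary_affine[of X Y Z x] by (simp add: algebra_simps)
    have r_sm: "smooth_alg (r X Y Z)" for X Y Z unfolding r_def by (rule smooth_alg_smooth_step)
    have r_grad: "norm (grad (r X Y Z) x) \<le> M * (2 / e * N)" if "norm (bary_normal X Y Z) \<le> N" for X Y Z x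
    proof -
      have "norm (grad (r X Y Z) x) = \<bar>S' (((2 / e) *\<^sub>R bary_normal X Y Z) \<bullet> x + (2 / e * bary X Y Z 0 - 1))\<bar> * (2 / e * norm (bary_normal X Y Z))"
        unfolding r_def grad_smooth_step[OF M(2)] norm_scaleR using e by (simp only: abs_of_pos divide_pos_pos zero_less_numeral)
      also have "\<dots> \<le> M * (2 / e * N)"
        using M e that by (intro mult_mono mult_left_mono) auto
      finally show ?thesis .
    qed
    have r01: "0 \<le> r X Y Z x" "r X Y Z x \<le> 1" for X Y Z x unfolding r_eq by (rule smooth_step_bounds)+
    have r0: "e / 2 \<le> bary X Y Z x" if "r X Y Z x \<noteq> 0" for X Y Z x
    proof (rule ccontr)
      assume "\<not> e / 2 \<le> bary X Y Z x"
      hence "2 / e * bary X Y Z x - 1 \<le> 0" using e by (simp add: field_simps)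
      thus False using that smooth_step_eq_0 unfolding r_eq by blast
    qed
    have r1: "r X Y Z x = 1" if "e \<le> bary X Y Z x" for X Y Z x
      unfolding r_eq using e that by (intro smooth_step_eq_1) (simp add: field_simps)
    define \<eta> where "\<eta> x = r A B C x * (r B C A x * r C A B x)" for x
    have cont: "continuous_on UNIV (bary X Y Z)" for X Y Z
    proof -
      have "bary X Y Z = (\<lambda>x. bary_normal X Y Z \<bullet> x + bary X Y Z 0)" by (rule ext, rule bary_affine)
      moreover have "continuous_on UNIV (\<lambda>x. bary_normal X Y Z \<bullet> x + bary X Y Z 0)"
        by (intro continuous_intros)
      ultimately show ?thesis by (simp only:)
    qed
    define S where "S = ?T \<inter> {x. e / 2 \<le> bary A B C x} \<inter> {x. e / 2 \<le> bary B C A x} \<inter> {x. e / 2 \<le> bary C A B x}"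
    have tri: "x \<in> ?T \<longleftrightarrow> 0 \<le> bary A B C x \<and> 0 \<le> bary B C A x \<and> 0 \<le> bary C A B x" for x
      using triangle_bary[OF D, of x] by (simp add: bary_swap[of B])
    show "\<exists>\<eta>. smooth_alg \<eta> \<and> (\<forall>x. 0 \<le> \<eta> x \<and> \<eta> x \<le> 1) \<and>
        (\<exists>S. compact S \<and> {x. \<eta> x \<noteq> 0} \<subseteq> S \<and> S \<subseteq> interior ?T) \<and>
        (\<forall>x. e \<le> bary A B C x \<longrightarrow> e \<le> bary B C A x \<longrightarrow> e \<le> bary C A B x \<longrightarrow> \<eta> x = 1) \<and>
        (\<forall>x. norm (grad \<eta> x) \<le> 6 * M * N / e)"
    proof (intro exI[of _ \<eta>] exI[of _ S] conjI allI impI)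
      show "smooth_alg \<eta>" unfolding \<eta>_def by (intro smooth_alg.mult r_sm)
      show "0 \<le> \<eta> x" for x unfolding \<eta>_def by (intro mult_nonneg_nonneg r01)
      show "\<eta> x \<le> 1" for x unfolding \<eta>_def by (intro mult_le_one mult_nonneg_nonneg r01)
      show "compact S"
        unfolding S_def by (intro compact_Int_closed compact_triangle closed_Collect_le cont continuous_on_const)
      show "{x. \<eta> x \<noteq> 0} \<subseteq> S"
      proof
        fix x assume "x \<in> {x. \<eta> x \<noteq> 0}"
        hence "r A B C x \<noteq> 0" "r B C A x \<noteq> 0" "r C A B x \<noteq> 0" by (auto simp: \<eta>_def)
        hence "e / 2 \<le> bary A B C x" "e / 2 \<le> bary B C A x" "e / 2 \<le> bary C A B x"
          using r0[of A B C x] r0[of B C A x] r0[of C A B x] by blast+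
        moreover from this have "x \<in> ?T" unfolding tri using e by linarith
        ultimately show "x \<in> S" unfolding S_def by simp
      qed
      let ?U = "{x. 0 < bary A B C x} \<inter> {x. 0 < bary B C A x} \<inter> {x. 0 < bary C A B x}"
      have "open ?U" by (intro open_Int open_Collect_less cont continuous_on_const)
      moreover have "?U \<subseteq> ?T"
      proof
        fix x assume "x \<in> ?U"
        thus "x \<in> ?T" unfolding tri by simp
      qed
      ultimately have U: "?U \<subseteq> interior ?T" by (rule interior_maximal[rotated])
      have "S \<subseteq> ?U"
      proof
        fix x assume "x \<in> S"
        hence "e / 2 \<le> bary A B C x" "e / 2 \<le> bary B C A x" "e / 2 \<le> bary C A B x" by (simp_all add: S_def)
        hence "0 < bary A B C x" "0 < bary B C A x" "0 < bary C A B x" using e by linarith+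
        thus "x \<in> ?U" by simp
      qed
      thus "S \<subseteq> interior ?T" using U by (rule subset_trans)
      show "\<eta> x = 1" if "e \<le> bary A B C x" "e \<le> bary B C A x" "e \<le> bary C A B x" for x
        using that by (simp add: \<eta>_def r1)
      show "norm (grad \<eta> x) \<le> 6 * M * N / e" for x
      proof -
        note d = smooth_alg_differentiable[OF r_sm]
        have g2: "grad (\<lambda>x. r B C A x * r C A B x) x
            = r B C A x *\<^sub>R grad (r C A B) x + r C A B x *\<^sub>R grad (r B C A) x"
          by (rule grad_mult[OF d d])
        have "grad \<eta> x = r A B C x *\<^sub>R (r B C A x *\<^sub>R grad (r C A B) x + r C A B x *\<^sub>R grad (r B C A) x)
            + (r B C A x * r C A B x) *\<^sub>R grad (r A B C) x"
          unfolding \<eta>_def g2[symmetric] by (rule grad_mult[OF d differentiable_mult[OF d d]])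
        hence "norm (grad \<eta> x) \<le> norm (r A B C x *\<^sub>R (r B C A x *\<^sub>R grad (r C A B) x + r C A B x *\<^sub>R grad (r B C A) x))
            + norm ((r B C A x * r C A B x) *\<^sub>R grad (r A B C) x)"
          by (simp only: norm_triangle_ineq)
        also have "\<dots> \<le> norm (r B C A x *\<^sub>R grad (r C A B) x + r C A B x *\<^sub>R grad (r B C A) x) + norm (grad (r A B C) x)"
          by (intro add_mono norm_unit_scale mult_nonneg_nonneg mult_le_one r01)
        also have "\<dots> \<le> norm (r B C A x *\<^sub>R grad (r C A B) x) + norm (r C A B x *\<^sub>R grad (r B C A) x) + norm (grad (r A B C) x)"
          by (intro add_right_mono norm_triangle_ineq)
        also have "\<dots> \<le> norm (grad (r C A B) x) + norm (grad (r B C A) x) + norm (grad (r A B C) x)"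
          by (intro add_mono norm_unit_scale order.refl r01)
        also have "\<dots> \<le> 3 * (M * (2 / e * N))"
          using r_grad[OF N(1), of x] r_grad[OF N(2), of x] r_grad[OF N(3), of x] by linarith
        also have "\<dots> = 6 * M * N / e" by simp
        finally show ?thesis .
      qed
    qed
  qed
qed

text \<open>What one triangle has to provide: a cutoff supported in a compact subset \<open>S\<close> of the interior that keeps
half of the mass of \<open>P\<close> while the energy of \<open>\<eta> P\<close> stays below \<open>k\<close> times this mass.\<close>

definition interior_cutoff :: "real \<Rightarrow> (real^2 \<Rightarrow> real) \<Rightarrow> (real^2) set \<Rightarrow> (real^2 \<Rightarrow> real) \<Rightarrow> (real^2) set \<Rightarrow> bool" where
  "interior_cutoff k P T \<eta> S \<longleftrightarrow>
     smooth_alg \<eta> \<and> compact S \<and> {x. \<eta> x \<noteq> 0} \<subseteq> S \<and> S \<subseteq> interior T \<and>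
     integral T (\<lambda>x. (P x)^2) \<le> 2 * integral T (\<lambda>x. \<eta> x * (P x)^2) \<and>
     integral T (\<lambda>x. (norm (grad (\<lambda>x. \<eta> x * P x) x))^2) \<le> k * integral T (\<lambda>x. (P x)^2)"

lemma triangle_test_factor:
  obtains c :: real where "c > 0"
    "\<And>A B C N p P. cross2 (B - A) (C - A) \<noteq> 0 \<Longrightarrow> P \<in> poly_space p UNIV \<Longrightarrow>
      norm (bary_normal A B C) \<le> N \<Longrightarrow> norm (bary_normal B C A) \<le> N \<Longrightarrow> norm (bary_normal C A B) \<le> N \<Longrightarrow>
      \<exists>\<eta> S. interior_cutoff (c * N^2 * (real p + 1)^4) P (convex hull {A, B, C}) \<eta> S"
proof -
  obtain M where M: "M > 0"
    "\<And>A B C N e. cross2 (B - A) (C - A) \<noteq> 0 \<Longrightarrow> 0 < e \<Longrightarrow>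
      norm (bary_normal A B C) \<le> N \<Longrightarrow> norm (bary_normal B C A) \<le> N \<Longrightarrow> norm (bary_normal C A B) \<le> N \<Longrightarrow>
      \<exists>\<eta>. smooth_alg \<eta> \<and> (\<forall>x. 0 \<le> \<eta> x \<and> \<eta> x \<le> 1) \<and>
        (\<exists>S. compact S \<and> {x. \<eta> x \<noteq> 0} \<subseteq> S \<and> S \<subseteq> interior (convex hull {A, B, C})) \<and>
        (\<forall>x. e \<le> bary A B C x \<longrightarrow> e \<le> bary B C A x \<longrightarrow> e \<le> bary C A B x \<longrightarrow> \<eta> x = 1) \<and>
        (\<forall>x. norm (grad \<eta> x) \<le> M * N / e)"
    using triangle_cutoff by blast
  \<comment> \<open>twice the Markov constant 192, plus the contribution of the gradient of the cutoff\<close>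
  define c where "c = 384 + 2 * (48 * M)^2"
  show thesis
  proof (rule that[of c])
    show "c > 0" unfolding c_def by (simp add: add_pos_nonneg)
  next
    fix A B C :: "real^2" and N :: real and p :: nat and P :: "real^2 \<Rightarrow> real"
    assume D: "cross2 (B - A) (C - A) \<noteq> 0" and P: "P \<in> poly_space p UNIV" and
      N: "norm (bary_normal A B C) \<le> N" "norm (bary_normal B C A) \<le> N" "norm (bary_normal C A B) \<le> N"
    let ?T = "convex hull {A, B, C}"
    \<comment> \<open>the width for which the bound of the boundary layer is exactly one half\<close>
    define e where "e = 1 / (48 * (real p + 1)^2)"
    have p1: "1 \<le> (real p + 1)^2" by simp
    have "e \<le> 1 / (48 * 1)" unfolding e_def using p1 by (intro divide_left_mono mult_left_mono) auto
    hence e4: "e \<le> 1/4" by simp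
    have "(real p + 1)^2 > 0" by simp
    hence e0: "0 < e" and ep: "24 * e * (real p + 1)^2 = 1/2" by (simp_all add: e_def)
    note e = e0 e4
    obtain \<eta> S where \<eta>: "smooth_alg \<eta>" "\<forall>x. 0 \<le> \<eta> x \<and> \<eta> x \<le> 1"
        "compact S" "{x. \<eta> x \<noteq> 0} \<subseteq> S" "S \<subseteq> interior ?T"
        "\<forall>x. e \<le> bary A B C x \<longrightarrow> e \<le> bary B C A x \<longrightarrow> e \<le> bary C A B x \<longrightarrow> \<eta> x = 1"
        "\<forall>x. norm (grad \<eta> x) \<le> M * N / e"
      using M(2)[OF D e(1) N] by blast
    note sm = poly_space_smooth[OF P]
    have cP: "continuous_on UNIV (\<lambda>x. (P x)^2)" by (intro continuous_intros smooth_alg_continuous sm)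
    have c\<eta>: "continuous_on UNIV (\<lambda>x. \<eta> x * (P x)^2)"
      by (intro continuous_intros smooth_alg_continuous sm \<eta>)
    have cG: "continuous_on UNIV (\<lambda>x. (norm (grad P x))^2)"
      by (intro continuous_intros smooth_alg_continuous_grad sm)
    have c\<Phi>: "continuous_on UNIV (\<lambda>x. (norm (grad (\<lambda>x. \<eta> x * P x) x))^2)"
      by (intro continuous_intros smooth_alg_continuous_grad smooth_alg.mult sm \<eta>)
    define I where "I = integral ?T (\<lambda>x. (P x)^2)"
    have I0: "0 \<le> I" unfolding I_def by (intro integral_nonneg integrable_compact cP compact_triangle) auto
    have "integral ?T (\<lambda>x. (P x)^2 - \<eta> x * (P x)^2) \<le> 24 * e * (real p + 1)^2 * I"
      unfolding I_def
    proof (rule triangle_boundary_layer[OF P D e])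
      show "continuous_on UNIV (\<lambda>x. (P x)^2 - \<eta> x * (P x)^2)" by (intro continuous_intros cP c\<eta>)
      show "(P x)^2 - \<eta> x * (P x)^2 \<le> (P x)^2" for x using \<eta>(2) by simp
      show "(P x)^2 - \<eta> x * (P x)^2 \<le> 0" if "e \<le> bary A B C x" "e \<le> bary B C A x" "e \<le> bary C A B x" for x
        using that \<eta>(6) by simp
    qed
    also have "integral ?T (\<lambda>x. (P x)^2 - \<eta> x * (P x)^2) = I - integral ?T (\<lambda>x. \<eta> x * (P x)^2)"
      unfolding I_def by (intro integral_diff integrable_compact cP c\<eta> compact_triangle)
    finally have mass: "I \<le> 2 * integral ?T (\<lambda>x. \<eta> x * (P x)^2)" unfolding ep by linarith
    define m where "m = M * N / e"
    have m: "m = 48 * M * N * (real p + 1)^2" by (simp add: m_def e_def)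
    have pt: "(norm (grad (\<lambda>x. \<eta> x * P x) x))^2 \<le> 2 * (norm (grad P x))^2 + 2 * m^2 * (P x)^2" for x
    proof -
      have "grad (\<lambda>x. \<eta> x * P x) x = \<eta> x *\<^sub>R grad P x + P x *\<^sub>R grad \<eta> x"
        by (intro grad_mult smooth_alg_differentiable sm \<eta>)
      also have "norm \<dots> \<le> \<bar>\<eta> x\<bar> * norm (grad P x) + \<bar>P x\<bar> * norm (grad \<eta> x)"
        by (rule order.trans[OF norm_triangle_ineq]) simp
      also have "\<dots> \<le> 1 * norm (grad P x) + \<bar>P x\<bar> * m"
        using \<eta>(2,7) by (intro add_mono mult_right_mono mult_left_mono) (auto simp: m_def)
      finally have "(norm (grad (\<lambda>x. \<eta> x * P x) x))^2 \<le> (norm (grad P x) + \<bar>P x\<bar> * m)^2"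
        by (intro power_mono) auto
      also have "\<dots> \<le> 2 * (norm (grad P x))^2 + 2 * (\<bar>P x\<bar> * m)^2"
        using young_square[of 1 1 "norm (grad P x)" "\<bar>P x\<bar> * m"] by simp
      finally show ?thesis by (simp add: power_mult_distrib mult_ac)
    qed
    have "integral ?T (\<lambda>x. (norm (grad (\<lambda>x. \<eta> x * P x) x))^2)
        \<le> integral ?T (\<lambda>x. 2 * (norm (grad P x))^2 + 2 * m^2 * (P x)^2)"
      by (intro integral_le integrable_compact c\<Phi> compact_triangle pt continuous_intros cG cP)
    also have "\<dots> = 2 * integral ?T (\<lambda>x. (norm (grad P x))^2) + 2 * m^2 * I"
      unfolding I_def
      by (subst integral_add) (auto intro!: integrable_compact compact_triangle continuous_intros cG cP)
    also have "\<dots> \<le> 2 * (192 * N^2 * (real p + 1)^4 * I) + 2 * m^2 * I"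
      using triangle_gradient[OF P D N] unfolding I_def by simp
    also have "\<dots> = c * N^2 * (real p + 1)^4 * I"
    proof -
      have "m^2 = (48 * M)^2 * (N^2 * (real p + 1)^4)" unfolding m by (simp add: power_mult_distrib)
      thus ?thesis unfolding c_def by (simp add: algebra_simps)
    qed
    finally have energy: "integral ?T (\<lambda>x. (norm (grad (\<lambda>x. \<eta> x * P x) x))^2) \<le> c * N^2 * (real p + 1)^4 * I" .
    have "interior_cutoff (c * N^2 * (real p + 1)^4) P ?T \<eta> S"
      unfolding interior_cutoff_def
      by (intro conjI \<eta>(1,3,4,5) mass[unfolded I_def] energy[unfolded I_def])
    thus "\<exists>\<eta> S. interior_cutoff (c * N^2 * (real p + 1)^4) P ?T \<eta> S" by blast
  qed
qed

lemma cross2_zero_parallel: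
  assumes "cross2 u v = 0" "u \<noteq> 0"
  shows "\<exists>c. v = c *\<^sub>R u"
proof (cases "u$1 = 0")
  case False
  have "u$1 * v$2 = u$2 * v$1" using assms(1) by (simp add: cross2_def)
  hence "v = (v$1 / u$1) *\<^sub>R u" using False by (simp add: vec_eq_iff forall_2 field_simps)
  thus ?thesis by blast
next
  case True
  hence 2: "u$2 \<noteq> 0" using assms(2) by (auto simp: vec_eq_iff forall_2)
  have "v$1 = 0" using assms(1) True 2 by (simp add: cross2_def)
  hence "v = (v$2 / u$2) *\<^sub>R u" using True 2 by (simp add: vec_eq_iff forall_2)
  thus ?thesis by blast
qed

lemma simplex_triangle:
  assumes "2 simplex (T :: (real^2) set)"
  obtains A B C where "T = convex hull {A, B, C}" "cross2 (B - A) (C - A) \<noteq> 0"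
proof -
  obtain V where V: "\<not> affine_dependent V" "int (card V) = 2 + 1" "T = convex hull V"
    using assms unfolding simplex_def by blast
  hence "card V = 3" by simp
  then obtain A B C where ABC: "V = {A, B, C}" "A \<noteq> B" "A \<noteq> C" "B \<noteq> C" unfolding card_3_iff by blast
  have "\<not> collinear {A, B, C}" using V(1) ABC collinear_3_eq_affine_dependent[of A B C] by simp
  hence nc: "\<not> collinear {0, B - A, C - A}"
    using collinear_3[of B A C] by (simp add: insert_commute)
  have "cross2 (B - A) (C - A) \<noteq> 0"
  proof
    assume z: "cross2 (B - A) (C - A) = 0"
    have "\<exists>c. C - A = c *\<^sub>R (B - A)" using cross2_zero_parallel[OF z] ABC(2) by simp
    thus False using nc unfolding collinear_lemma by simp
  qed
  thus thesis using V(3) ABC(1) by (intro that[of A B C]) simp_all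
qed

text \<open>Moving across a ball inside the triangle in the direction of the gradient changes the coordinate, which has
values in \<open>[0, 1]\<close>, by at most 1.\<close>

lemma bary_normal_bound:
  assumes D: "cross2 (B - A) (C - A) \<noteq> 0" and r: "r > 0" "ball z r \<subseteq> convex hull {A, B, C}"
  shows "norm (bary_normal A B C) \<le> 1 / r"
proof (cases "bary_normal A B C = 0")
  case True
  thus ?thesis using r by simp
next
  case False
  define n where "n = bary_normal A B C"
  have n: "n \<noteq> 0" using False by (simp add: n_def)
  define w where "w = (r / 2 / norm n) *\<^sub>R n"
  have "norm w = r / 2" using n r by (simp add: w_def)
  hence "z + w \<in> ball z r" "z - w \<in> ball z r" using r by (simp_all add: dist_norm)
  hence "z + w \<in> convex hull {A, B, C}" "z - w \<in> convex hull {A, B, C}" using r(2) by blast+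
  hence "0 \<le> bary B A C (z + w)" "0 \<le> bary C A B (z + w)" and lo: "0 \<le> bary A B C (z - w)"
    unfolding triangle_bary[OF D] by blast+
  hence up: "bary A B C (z + w) \<le> 1" using bary_sum[OF D, of "z + w"] by linarith
  have "bary A B C (z + w) = n \<bullet> z + n \<bullet> w + bary A B C 0"
    unfolding n_def by (subst bary_affine) (simp only: inner_add_right)
  moreover have "bary A B C (z - w) = n \<bullet> z - n \<bullet> w + bary A B C 0"
    unfolding n_def by (subst bary_affine) (simp only: inner_diff_right)
  moreover have "n \<bullet> w = r / 2 * norm n"
  proof -
    have "n \<bullet> w = r / 2 / norm n * (norm n * norm n)"
      unfolding w_def inner_scaleR_right by (simp only: dot_square_norm power2_eq_square)
    thus ?thesis using n by simp
  qed
  ultimately have "r * norm n \<le> 1" using up lo by simp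
  thus ?thesis using r(1) by (simp add: n_def field_simps)
qed

lemma open_integral_zero:
  fixes f :: "'a::euclidean_space \<Rightarrow> real"
  assumes S: "open S" "bounded S" and f: "continuous_on UNIV f" "\<And>x. 0 \<le> f x"
    and z: "integral S f = 0" and x: "x \<in> S"
  shows "f x = 0"
proof -
  obtain a b where ab': "cbox a b \<subseteq> S" "x \<in> box a b" by (rule open_contains_cbox[OF S(1) x])
  note ab = ab'(2,1)
  have Sm: "S \<in> sets lebesgue" using S(1) by auto
  note fb = integrable_compact[OF f(1) compact_cbox[of a b]]
  have "integral (cbox a b) f \<le> integral S f"
    by (rule integral_subset_le[OF ab(2) fb continuous_integrable_on[OF f(1) S(2) Sm]]) (simp add: f(2))
  moreover have "0 \<le> integral (cbox a b) f" by (rule integral_nonneg[OF fb f(2)])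
  ultimately have "integral (cbox a b) f = 0" unfolding z by linarith
  hence i: "(f has_integral 0) (cbox a b)" using integrable_integral[OF fb] by (simp only:)
  have "box a b \<noteq> {}" using ab(1) by blast
  show ?thesis
    by (rule has_integral_0_cbox_imp_0[OF continuous_on_subset[OF f(1) subset_UNIV] f(2) i \<open>box a b \<noteq> {}\<close>])
       (rule subsetD[OF box_subset_cbox ab(1)])
qed

text \<open>A test function with zero gradient is constant, and it vanishes outside the bounded set \<open>S\<close>.
Positivity is needed because the quotient in \<open>hm1_norm\<close> would be 0 for a vanishing seminorm.\<close>

lemma test_function_seminorm_pos:
  fixes \<Phi> :: "real^2 \<Rightarrow> real"
  assumes S: "open S" "bounded S" and \<Phi>: "\<Phi> \<in> test_functions S" and z: "\<Phi> x0 \<noteq> 0"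
  shows "h1_seminorm S \<Phi> > 0"
proof -
  have c: "continuous_on UNIV (\<lambda>x. (norm (grad \<Phi> x))^2)"
    by (intro continuous_intros test_functionD[OF \<Phi>])
  have "integral S (\<lambda>x. (norm (grad \<Phi> x))^2) \<ge> 0"
    using S by (intro integral_nonneg continuous_integrable_on c) auto
  moreover have "integral S (\<lambda>x. (norm (grad \<Phi> x))^2) \<noteq> 0"
  proof
    assume i: "integral S (\<lambda>x. (norm (grad \<Phi> x))^2) = 0"
    have "grad \<Phi> x = 0" for x
    proof (cases "x \<in> S")
      case True
      thus ?thesis using open_integral_zero[OF S c _ i True] by simp
    next
      case False
      thus ?thesis using test_functionD(6)[OF \<Phi>] by (intro grad_zero_outside) blast
    qed
    hence "(\<Phi> has_derivative (\<lambda>h. 0)) (at x)" for x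
      using differentiable_has_grad[OF test_functionD(1)[OF \<Phi>], of x] by simp
    hence "\<exists>c. \<forall>x\<in>UNIV. \<Phi> x = c" by (intro has_derivative_zero_constant[OF convex_UNIV]) simp
    then obtain c where c: "\<And>x. \<Phi> x = c" by blast
    have "S \<noteq> UNIV" using S(2) not_bounded_UNIV by auto
    then obtain y where "y \<notin> S" by blast
    hence "\<Phi> y = 0" using test_functionD(6)[OF \<Phi>] closure_subset[of "{x. \<Phi> x \<noteq> 0}"] by auto
    thus False using c[of y] c[of x0] z by simp
  qed
  ultimately show ?thesis unfolding h1_seminorm_test_function[OF S \<Phi>] by simp
qed

lemma triangle_normal_bounds:
  assumes T: "T = convex hull {A, B, C}" and D: "cross2 (B - A) (C - A) \<noteq> 0"
    and sr: "shape_regular \<gamma> T" and g: "\<gamma> > 0" and d: "0 < d" "d \<le> diameter T"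
  shows "norm (bary_normal A B C) \<le> 1 / (\<gamma> * d)" "norm (bary_normal B C A) \<le> 1 / (\<gamma> * d)"
    "norm (bary_normal C A B) \<le> 1 / (\<gamma> * d)"
proof -
  obtain z r where r: "r \<ge> \<gamma> * diameter T" "r > 0" "ball z r \<subseteq> T"
    using sr unfolding shape_regular_def star_shaped_wrt_def by blast
  have "\<gamma> * d \<le> \<gamma> * diameter T" using g d by (intro mult_left_mono) auto
  hence "\<gamma> * d \<le> r" using r(1) by linarith
  moreover have "0 < \<gamma> * d" using g d by simp
  ultimately have le: "1 / r \<le> 1 / (\<gamma> * d)" using r(2) g d(1) by (intro divide_left_mono mult_pos_pos) auto
  have D2: "cross2 (C - B) (A - B) \<noteq> 0" "cross2 (A - C) (B - C) \<noteq> 0"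
    using D by (simp_all add: cross2_def algebra_simps)
  have h: "T = convex hull {B, C, A}" "T = convex hull {C, A, B}" unfolding T by (simp_all add: insert_commute)
  show "norm (bary_normal A B C) \<le> 1 / (\<gamma> * d)"
    by (rule order.trans[OF bary_normal_bound[OF D r(2) r(3)[unfolded T]] le])
  show "norm (bary_normal B C A) \<le> 1 / (\<gamma> * d)"
    by (rule order.trans[OF bary_normal_bound[OF D2(1) r(2) r(3)[unfolded h(1)]] le])
  show "norm (bary_normal C A B) \<le> 1 / (\<gamma> * d)"
    by (rule order.trans[OF bary_normal_bound[OF D2(2) r(2) r(3)[unfolded h(2)]] le])
qed

lemma grad_sum:
  fixes f :: "'i \<Rightarrow> real^'n::finite \<Rightarrow> real"
  assumes "\<And>i. i \<in> I \<Longrightarrow> f i differentiable (at x)"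
  shows "grad (\<lambda>x. \<Sum>i\<in>I. f i x) x = (\<Sum>i\<in>I. grad (f i) x)"
proof (rule grad_unique)
  have "((\<lambda>x. \<Sum>i\<in>I. f i x) has_derivative (\<lambda>h. \<Sum>i\<in>I. grad (f i) x \<bullet> h)) (at x)"
    by (intro has_derivative_sum differentiable_has_grad assms)
  thus "((\<lambda>x. \<Sum>i\<in>I. f i x) has_derivative (\<lambda>h. (\<Sum>i\<in>I. grad (f i) x) \<bullet> h)) (at x)"
    by (simp add: inner_sum_left)
qed

text \<open>The sum of the cutoff polynomials on the triangles. The supports are disjoint and avoid all frontiers, so on
each triangle both \<open>\<Phi>\<close> and its gradient consist of one summand only.\<close>

lemma polygon_test_function:
  assumes K: "polygon K" and T: "subtriangulation \<T> K" and P: "P \<in> poly_space p UNIV"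
    and cutoff: "\<And>T. T \<in> \<T> \<Longrightarrow> \<exists>\<eta> S. interior_cutoff k P T \<eta> S"
  obtains \<Phi> where "\<Phi> \<in> test_functions K"
    "integral K (\<lambda>x. (P x)^2) \<le> 2 * integral K (\<lambda>x. P x * \<Phi> x)"
    "integral K (\<lambda>x. (norm (grad \<Phi> x))^2) \<le> k * integral K (\<lambda>x. (P x)^2)"
proof -
  note F = subtriangulation_facts[OF K T]
  obtain \<eta> S where "\<And>T. T \<in> \<T> \<Longrightarrow> interior_cutoff k P T (\<eta> T) (S T)" using cutoff by metis
  hence \<eta>: "\<And>T. T \<in> \<T> \<Longrightarrow> smooth_alg (\<eta> T)" "\<And>T. T \<in> \<T> \<Longrightarrow> compact (S T)"
    "\<And>T. T \<in> \<T> \<Longrightarrow> {x. \<eta> T x \<noteq> 0} \<subseteq> S T" "\<And>T. T \<in> \<T> \<Longrightarrow> S T \<subseteq> interior T"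
    "\<And>T. T \<in> \<T> \<Longrightarrow> integral T (\<lambda>x. (P x)^2) \<le> 2 * integral T (\<lambda>x. \<eta> T x * (P x)^2)"
    "\<And>T. T \<in> \<T> \<Longrightarrow> integral T (\<lambda>x. (norm (grad (\<lambda>x. \<eta> T x * P x) x))^2)
          \<le> k * integral T (\<lambda>x. (P x)^2)"
    unfolding interior_cutoff_def by blast+
  note sm = poly_space_smooth[OF P]
  define \<Phi> where "\<Phi> x = (\<Sum>T\<in>\<T>. \<eta> T x * P x)" for x
  have \<Phi>_sm: "smooth_alg \<Phi>" unfolding \<Phi>_def by (intro smooth_alg_sum F(1) smooth_alg.mult sm \<eta>)
  have test: "\<Phi> \<in> test_functions K"
  proof (rule test_functionI[OF \<Phi>_sm])
    show "compact (\<Union>T\<in>\<T>. S T)" by (intro compact_UN F(1) \<eta>)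
    show "(\<Union>T\<in>\<T>. S T) \<subseteq> K" using \<eta>(4) F(5) by blast
    show "{x. \<Phi> x \<noteq> 0} \<subseteq> (\<Union>T\<in>\<T>. S T)"
    proof
      fix x assume "x \<in> {x. \<Phi> x \<noteq> 0}"
      then obtain T where "T \<in> \<T>" "\<eta> T x * P x \<noteq> 0" unfolding \<Phi>_def by (auto elim: sum.not_neutral_contains_not_neutral)
      thus "x \<in> (\<Union>T\<in>\<T>. S T)" using \<eta>(3) by auto
    qed
  qed
  have other: "x \<notin> S T'" if "T \<in> \<T>" "T' \<in> \<T>" "T' \<noteq> T" "x \<in> T" for T T' x
    using F(6)[OF that(2,1,3)] \<eta>(4)[OF that(2)] that(4) by blast
  have local: "\<Phi> x = \<eta> T x * P x" if "T \<in> \<T>" "x \<in> T" for T x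
  proof -
    have "\<eta> T' x = 0" if "T' \<in> \<T> - {T}" for T'
      using other[of T T' x] \<open>T \<in> \<T>\<close> \<open>x \<in> T\<close> that \<eta>(3)[of T'] by auto
    hence "(\<Sum>T'\<in>\<T> - {T}. \<eta> T' x * P x) = 0" by (intro sum.neutral) auto
    thus ?thesis unfolding \<Phi>_def using sum.remove[OF F(1) that(1), of "\<lambda>T'. \<eta> T' x * P x"] by simp
  qed
  have local_grad: "grad \<Phi> x = grad (\<lambda>x. \<eta> T x * P x) x" if "T \<in> \<T>" "x \<in> T" for T x
  proof -
    have "grad (\<lambda>x. \<eta> T' x * P x) x = 0" if T': "T' \<in> \<T> - {T}" for T'
    proof (rule grad_zero_outside)
      have "closure {x. \<eta> T' x * P x \<noteq> 0} \<subseteq> S T'"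
        using \<eta>(3)[of T'] T' by (intro closure_minimal compact_imp_closed \<eta>(2)) auto
      thus "x \<notin> closure {x. \<eta> T' x * P x \<noteq> 0}"
        using other[of T T' x] \<open>T \<in> \<T>\<close> \<open>x \<in> T\<close> T' by auto
    qed
    hence "(\<Sum>T'\<in>\<T> - {T}. grad (\<lambda>x. \<eta> T' x * P x) x) = 0" by (intro sum.neutral) auto
    moreover have "grad \<Phi> x = (\<Sum>T'\<in>\<T>. grad (\<lambda>x. \<eta> T' x * P x) x)"
      unfolding \<Phi>_def by (intro grad_sum smooth_alg_differentiable smooth_alg.mult sm \<eta>)
    ultimately show ?thesis using sum.remove[OF F(1) that(1), of "\<lambda>T'. grad (\<lambda>x. \<eta> T' x * P x) x"] by simp
  qed
  have cP: "continuous_on UNIV (\<lambda>x. (P x)^2)" by (intro continuous_intros smooth_alg_continuous sm)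
  have c\<Phi>: "continuous_on UNIV (\<lambda>x. P x * \<Phi> x)" by (intro continuous_intros smooth_alg_continuous sm \<Phi>_sm)
  have cG: "continuous_on UNIV (\<lambda>x. (norm (grad \<Phi> x))^2)"
    by (intro continuous_intros smooth_alg_continuous_grad \<Phi>_sm)
  note int = integral_subtriangulation[OF K T]
  have "integral K (\<lambda>x. (P x)^2) \<le> (\<Sum>T\<in>\<T>. 2 * integral T (\<lambda>x. P x * \<Phi> x))"
    unfolding int[OF cP]
  proof (rule sum_mono)
    fix T assume TT: "T \<in> \<T>"
    have "integral T (\<lambda>x. \<eta> T x * (P x)^2) = integral T (\<lambda>x. P x * \<Phi> x)"
      by (intro integral_cong) (simp add: local[OF TT] power2_eq_square)
    thus "integral T (\<lambda>x. (P x)^2) \<le> 2 * integral T (\<lambda>x. P x * \<Phi> x)" using \<eta>(5)[OF TT] by simp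
  qed
  also have "\<dots> = 2 * integral K (\<lambda>x. P x * \<Phi> x)" unfolding int[OF c\<Phi>] by (simp add: sum_distrib_left)
  finally have 1: "integral K (\<lambda>x. (P x)^2) \<le> 2 * integral K (\<lambda>x. P x * \<Phi> x)" .
  have "integral K (\<lambda>x. (norm (grad \<Phi> x))^2)
      \<le> (\<Sum>T\<in>\<T>. k * integral T (\<lambda>x. (P x)^2))"
    unfolding int[OF cG]
  proof (rule sum_mono)
    fix T assume TT: "T \<in> \<T>"
    have "integral T (\<lambda>x. (norm (grad \<Phi> x))^2) = integral T (\<lambda>x. (norm (grad (\<lambda>x. \<eta> T x * P x) x))^2)"
      by (intro integral_cong) (simp add: local_grad[OF TT])
    thus "integral T (\<lambda>x. (norm (grad \<Phi> x))^2) \<le> k * integral T (\<lambda>x. (P x)^2)"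
      using \<eta>(6)[OF TT] by simp
  qed
  also have "\<dots> = k * integral K (\<lambda>x. (P x)^2)"
    unfolding int[OF cP] by (simp add: sum_distrib_left)
  finally show thesis using that test 1 by blast
qed

lemma hm1_norm_test_function:
  fixes \<Phi> :: "real^2 \<Rightarrow> real"
  assumes S: "open S" "bounded S" and \<Phi>: "\<Phi> \<in> test_functions S"
    and P: "continuous_on UNIV P" "integral S (\<lambda>x. P x * \<Phi> x) > 0"
  shows "h1_seminorm S \<Phi> > 0" "ereal (l2_inner S q \<Phi> / h1_seminorm S \<Phi>) \<le> hm1_norm S q"
proof -
  have Sm: "S \<in> sets lebesgue" using S(1) by auto
  have "\<exists>x. \<Phi> x \<noteq> 0"
  proof (rule ccontr)
    assume "\<nexists>x. \<Phi> x \<noteq> 0"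
    thus False using P(2) by simp
  qed
  thus "h1_seminorm S \<Phi> > 0" using test_function_seminorm_pos[OF S \<Phi>] by blast
  have "\<not> (AE x in lebesgue_on S. \<Phi> x = 0)"
  proof
    assume "AE x in lebesgue_on S. \<Phi> x = 0"
    hence "AE x in lebesgue_on S. P x * \<Phi> x = 0" by (rule AE_mp) auto
    hence "(LINT x|lebesgue_on S. P x * \<Phi> x) = 0" by (rule integral_eq_zero_AE)
    moreover have "continuous_on UNIV (\<lambda>x. P x * \<Phi> x)" by (intro continuous_intros P test_functionD[OF \<Phi>])
    ultimately show False using continuous_integral_lebesgue_on(2)[OF _ S(2) Sm] P(2) by simp
  qed
  thus "ereal (l2_inner S q \<Phi> / h1_seminorm S \<Phi>) \<le> hm1_norm S q"
    unfolding hm1_norm_def using test_function_h10[OF S \<Phi>] by (intro SUP_upper) auto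
qed

theorem theoremA5:
  fixes \<gamma>1 c1 c2 :: real
  assumes "\<gamma>1 > 0" and "c1 > 0" and "c2 > 0"
  shows "\<exists>c>0. \<forall>(K :: (real^2) set) (\<T> :: (real^2) set set) (p :: nat) (q :: real^2 \<Rightarrow> real).
    polygon K \<longrightarrow>
    subtriangulation \<T> K \<longrightarrow>
    (\<forall>T\<in>\<T>. shape_regular \<gamma>1 T) \<longrightarrow>
    (\<forall>T\<in>\<T>. c1 * diameter K \<le> diameter T \<and> diameter T \<le> c2 * diameter K) \<longrightarrow>
    q \<in> poly_space p K \<longrightarrow>
    ereal (l2_norm K q) \<le> ereal (c * (real p + 1)^2 / diameter K) * hm1_norm K q"
proof -
  obtain c :: real where c: "c > 0"
    "\<And>A B C N p P. cross2 (B - A) (C - A) \<noteq> 0 \<Longrightarrow> P \<in> poly_space p UNIV \<Longrightarrow>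
      norm (bary_normal A B C) \<le> N \<Longrightarrow> norm (bary_normal B C A) \<le> N \<Longrightarrow> norm (bary_normal C A B) \<le> N \<Longrightarrow>
      \<exists>\<eta> S. interior_cutoff (c * N^2 * (real p + 1)^4) P (convex hull {A, B, C}) \<eta> S"
    using triangle_test_factor by blast
  define c' where "c' = 2 * sqrt c / (\<gamma>1 * c1)"
  show ?thesis
  proof (intro exI[of _ c'] conjI allI impI)
    show "c' > 0" using c(1) assms by (simp add: c'_def)
  next
    fix K :: "(real^2) set" and \<T> p and q :: "real^2 \<Rightarrow> real"
    assume K: "polygon K" and T: "subtriangulation \<T> K" and sr: "\<forall>T\<in>\<T>. shape_regular \<gamma>1 T"
      and diam: "\<forall>T\<in>\<T>. c1 * diameter K \<le> diameter T \<and> diameter T \<le> c2 * diameter K"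
      and q: "q \<in> poly_space p K"
    let ?h = "diameter K"
    note S = polygon_topology(1,2)[OF K]
    have Sm: "K \<in> sets lebesgue" using S(1) by auto
    have h: "?h > 0" by (rule polygon_diameter_pos[OF K])
    have d: "0 < c1 * ?h" using h assms by simp
    define N where "N = 1 / (\<gamma>1 * (c1 * ?h))"
    have N: "N > 0" using d assms by (simp add: N_def)
    obtain a :: "nat \<Rightarrow> nat \<Rightarrow> real" where a: "\<And>x. x \<in> K \<Longrightarrow> q x = (\<Sum>i\<le>p. \<Sum>j\<le>p - i. a i j * (x$1)^i * (x$2)^j)"
      using q unfolding poly_space_def by auto
    define P where "P = (\<lambda>x::real^2. \<Sum>i\<le>p. \<Sum>j\<le>p - i. a i j * (x$1)^i * (x$2)^j)"
    have P: "P \<in> poly_space p UNIV" unfolding poly_space_def P_def by auto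
    have qP: "q x = P x" if "x \<in> K" for x using a[OF that] by (simp add: P_def)
    have inner: "l2_inner K q f = integral K (\<lambda>x. P x * f x)" if f: "continuous_on UNIV f" for f
    proof -
      have "l2_inner K q f = (LINT x|lebesgue_on K. P x * f x)"
        unfolding l2_inner_def by (intro Bochner_Integration.integral_cong) (auto simp: qP)
      also have "\<dots> = integral K (\<lambda>x. P x * f x)"
        by (intro continuous_integral_lebesgue_on(2) S Sm continuous_intros f smooth_alg_continuous poly_space_smooth[OF P])
      finally show ?thesis .
    qed
    define I where "I = integral K (\<lambda>x. (P x)^2)"
    have cP2: "continuous_on UNIV (\<lambda>x. (P x)^2)"
      by (intro continuous_intros smooth_alg_continuous poly_space_smooth[OF P])
    have I0: "I \<ge> 0" unfolding I_def by (intro integral_nonneg continuous_integrable_on cP2 S Sm) auto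
    have norm: "l2_norm K q = sqrt I"
    proof -
      have "l2_inner K q q = (LINT x|lebesgue_on K. (P x)^2)"
        unfolding l2_inner_def by (intro Bochner_Integration.integral_cong) (auto simp: qP power2_eq_square)
      thus ?thesis
        using continuous_integral_lebesgue_on(2)[OF cP2 S(2) Sm] by (simp add: l2_norm_def I_def)
    qed
    have test: "\<exists>\<Phi>\<in>test_functions K. integral K (\<lambda>x. (R x)^2) \<le> 2 * integral K (\<lambda>x. R x * \<Phi> x) \<and>
        integral K (\<lambda>x. (norm (grad \<Phi> x))^2) \<le> c * N^2 * (real p + 1)^4 * integral K (\<lambda>x. (R x)^2)"
      if R: "R \<in> poly_space p UNIV" for R
    proof -
      have "\<exists>\<eta> S. interior_cutoff (c * N^2 * (real p + 1)^4) R T \<eta> S" if TT: "T \<in> \<T>" for T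
      proof -
        have sr': "shape_regular \<gamma>1 T" and diam': "c1 * ?h \<le> diameter T" using sr diam TT by blast+
        obtain A B C where ABC: "T = convex hull {A, B, C}" "cross2 (B - A) (C - A) \<noteq> 0"
          using simplex_triangle[OF subtriangulation_facts(2)[OF K T TT]] .
        note b = triangle_normal_bounds[OF ABC sr' assms(1) d diam', folded N_def]
        show ?thesis using c(2)[OF ABC(2) R b] unfolding ABC(1) .
      qed
      from polygon_test_function[OF K T R this] show ?thesis by blast
    qed
    show "ereal (l2_norm K q) \<le> ereal (c' * (real p + 1)^2 / ?h) * hm1_norm K q"
    proof (cases "I = 0")
      case True
      \<comment> \<open>For \<open>q = 0\<close> almost everywhere the supremum still has to be taken over a nonempty set: the constant polynomial yields a nonzero test function.\<close>
      have "(\<lambda>x. 1) \<in> poly_space p (UNIV :: (real^2) set)"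
      proof -
        have "(\<Sum>i\<le>p. \<Sum>j\<le>p - i. (if i = 0 \<and> j = 0 then 1 else 0) * x ^ i * y ^ j) = (1::real)" for x y
        proof -
          have 0: "(if j = 0 then 1 else 0) * y ^ j = (if j = 0 then 1 else 0 :: real)" for j by simp
          have "(\<Sum>j\<le>p - i. (if i = 0 \<and> j = 0 then 1 else 0) * x ^ i * y ^ j) = (if i = 0 then 1 else 0)" for i
            by (cases "i = 0") (simp_all add: 0)
          thus ?thesis by simp
        qed
        thus ?thesis unfolding poly_space_def
          by (intro CollectI exI[of _ "\<lambda>i j. if i = 0 \<and> j = 0 then 1 else 0"]) simp
      qed
      from test[OF this] obtain \<Phi> where \<Phi>: "\<Phi> \<in> test_functions K"
        and m: "integral K (\<lambda>x. 1^2) \<le> 2 * integral K (\<lambda>x. 1 * \<Phi> x)" by blast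
      have c1': "continuous_on UNIV (\<lambda>x::real^2. 1::real)" by (intro continuous_intros)
      have "integral K (\<lambda>x. 1 :: real) \<ge> 0"
        by (intro integral_nonneg continuous_integrable_on c1' S Sm) auto
      moreover have "integral K (\<lambda>x. 1 :: real) \<noteq> 0"
        using open_integral_zero[OF S c1'] polygon_topology(3)[OF K] by auto
      ultimately have "integral K (\<lambda>x. 1 * \<Phi> x) > 0" using m by simp
      from hm1_norm_test_function(2)[OF S \<Phi> c1' this]
      have le: "ereal (l2_inner K q \<Phi> / h1_seminorm K \<Phi>) \<le> hm1_norm K q" .
      have "P x = 0" if "x \<in> K" for x
        using open_integral_zero[OF S cP2 _ _ that] True by (simp add: I_def)
      hence "integral K (\<lambda>x. P x * \<Phi> x) = integral K (\<lambda>x. 0)" by (intro integral_cong) simp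
      hence "l2_inner K q \<Phi> = 0" using inner[OF test_functionD(2)[OF \<Phi>]] by simp
      hence "0 \<le> hm1_norm K q" using le by (simp add: zero_ereal_def)
      moreover have "0 \<le> c' * (real p + 1)^2 / ?h" using h assms c(1) by (simp add: c'_def)
      ultimately show ?thesis using norm True by (simp add: zero_ereal_def[symmetric])
    next
      case False
      hence Ipos: "I > 0" using I0 by simp
      obtain \<Phi> where \<Phi>: "\<Phi> \<in> test_functions K" "I \<le> 2 * integral K (\<lambda>x. P x * \<Phi> x)"
        "integral K (\<lambda>x. (norm (grad \<Phi> x))^2) \<le> c * N^2 * (real p + 1)^4 * I"
        using test[OF P] unfolding I_def by blast
      have pos: "integral K (\<lambda>x. P x * \<Phi> x) > 0" using \<Phi>(2) Ipos by simp
      note H = hm1_norm_test_function[OF S \<Phi>(1) smooth_alg_continuous[OF poly_space_smooth[OF P]] pos]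
      let ?g = "h1_seminorm K \<Phi>"
      have "?g \<le> sqrt (c * N^2 * (real p + 1)^4 * I)"
        unfolding h1_seminorm_test_function[OF S \<Phi>(1)] by (rule real_sqrt_le_mono[OF \<Phi>(3)])
      also have "\<dots> = sqrt c * N * (real p + 1)^2 * sqrt I"
      proof -
        have "c * N^2 * (real p + 1)^4 * I = (sqrt c * N * (real p + 1)^2 * sqrt I)^2"
          using c(1) I0 by (simp add: power_mult_distrib flip: power_mult)
        thus ?thesis using c(1) N I0 by (simp add: real_sqrt_abs)
      qed
      finally have g: "?g \<le> sqrt c * N * (real p + 1)^2 * sqrt I" .
      let ?m = "sqrt c * N * (real p + 1)^2"
      have mpos: "?m > 0" using c(1) N by (simp add: zero_less_power)
      have "sqrt I * ?g \<le> sqrt I * (?m * sqrt I)" using g I0 by (intro mult_left_mono) auto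
      also have "\<dots> = ?m * I" using I0 by (simp add: mult.left_commute)
      also have "\<dots> \<le> ?m * (2 * integral K (\<lambda>x. P x * \<Phi> x))" using \<Phi>(2) mpos by (intro mult_left_mono) auto
      finally have "sqrt I \<le> (?m * (2 * integral K (\<lambda>x. P x * \<Phi> x))) / ?g"
        using H(1) by (simp only: pos_le_divide_eq)
      also have "\<dots> = (c' * (real p + 1)^2 / ?h) * (l2_inner K q \<Phi> / ?g)"
        unfolding inner[OF test_functionD(2)[OF \<Phi>(1)]] N_def c'_def by (simp add: mult_ac)
      finally have "ereal (l2_norm K q) \<le> ereal (c' * (real p + 1)^2 / ?h) * ereal (l2_inner K q \<Phi> / ?g)"
        unfolding norm by simp
      also have "\<dots> \<le> ereal (c' * (real p + 1)^2 / ?h) * hm1_norm K q"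
        using h assms c(1) by (intro ereal_mult_left_mono H(2)) (simp add: c'_def)
      finally show ?thesis .
    qed
  qed
qed

end
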